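(* Let $(\mathcal X,\mathfrak S)$ be a hierarchically hyperbolic space. Then there exists $s_0$ such that for all $s\ge s_0$ there exist constants $K,C$ such that for all $x,y\in\mathcal X$, $$d_{\mathcal X}(x,y)\asymp_{(K,C)}\sum_{W\in\mathfrak S}\{\!\{d_W(x,y)\}\!\}_s .$$
   Context: Notation: for real $A,B$, $\{\!\{A\}\!\}_B$ is $A$ if $A\ge B$ and $0$ otherwise; $A\asymp_{(K,C)}B$ means $K^{-1}A-C\le B\le KA+C$. Hierarchically hyperbolic spaces (HHS). A $q$-quasigeodesic space is a metric space in which any two points are joined by a $(q,q)$-quasigeodesic. A $q$-quasigeodesic space $(\mathcal X,d_{\mathcal X})$ is an HHS (with structure $\mathfrak S$; one writes $(\mathcal X,\mathfrak S)$) if there are $\delta\ge0$, an index set $\mathfrak S$ and $\delta$-hyperbolic geodesic spaces $(\mathcal CW,d_W)$, $W\in\mathfrak S$, such that (1)–(9) below hold. Conventions: the distance between two sets is the infimum of distances between their points; for $x,y\in\mathcal X$ and $p\subseteq\mathcal CW$, $d_W(x,y)=d_W(\pi_W(x),\pi_W(y))$ and $d_W(x,p)=d_W(\pi_W(x),p)$; $V\sqsubset W$ means $V\sqsubseteq W$ and $V\ne W$. (1) Projections: there are $\xi,K\ge 0$ and maps $\pi_W:\mathcal X\to2^{\mathcal CW}$ ($W\in\mathfrak S$) sending points to nonempty sets of diameter $\le\xi$; each $\pi_W$ is $(K,K)$-coarsely Lipschitz and $\pi_W(\mathcal X)$ is $K$-quasiconvex in $\mathcal CW$. (2) Nesting: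 $\mathfrak S$ has a partial order $\sqsubseteq$, and either $\mathfrak S=\emptyset$ or there is a unique $\sqsubseteq$-maximal element. Put $\mathfrak S_W=\{V:V\sqsubseteq W\}$. If $V\sqsubset W$ there is a specified subset $\rho^V_W\subset\mathcal CW$ of diameter $\le\xi$ and a map $\rho^W_V:\mathcal CW\to2^{\mathcal CV}$. (3) Orthogonality: $\mathfrak S$ has a symmetric anti-reflexive relation $\perp$. If $V\sqsubseteq W$ and $W\perp U$ then $V\perp U$. For each $T\in\mathfrak S$ and $U\in\mathfrak S_T$ with $\{V\in\mathfrak S_T:V\perp U\}\ne\emptyset$ there is $W\in\mathfrak S_T-\{T\}$ such that $V\sqsubseteq W$ whenever $V\perp U$ and $V\sqsubseteq T$. If $V\perp W$ then $V,W$ are not $\sqsubseteq$-comparable. (4) Transversality and consistency: if $V,W$ are not orthogonal and neither is nested in the other they are transverse, $V\pitchfork W$. There is $\kappa_0\ge0$ such that: if $V\pitchfork W$ there are sets $\rho^V_W\subseteq\mathcal CW$, $\rho^W_V\subseteq\mathcal CV$ of diameter $\le\xi$ with $\min\{d_W(\pi_W(x),\rho^V_W),d_V(\pi_V(x),\rho^W_V)\}\le\kappa_0$ for all $x\in\mathcal X$; if $V\sqsubset W$ then $\min\{d_W(\pi_W(x),\rho^V_W),\mathrm{diam}_{\mathcal CV}(\pi_V(x)\cup\rho^W_V(\pi_W(x)))\}\le\kappa_0$ for all $x$; and if $U\sqsubseteq V$ then $d_W(\rho^U_W,\rho^V_W)\le\kappa_0$ whenever $V\sqsubset W$, or $V\pitchfork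 W$ and $W\not\perp U$. (5) Finite complexity: there is $n\ge0$ (the complexity) such that any set of pairwise $\sqsubseteq$-comparable elements has at most $n$ elements. (6) Large links: there are $\lambda\ge1$, $E\ge\max\{\xi,\kappa_0\}$ such that for $W\in\mathfrak S$, $x,x'\in\mathcal X$ and $N=\lambda d_W(x,x')+\lambda$ there is a collection $\{T_i\}\subseteq\mathfrak S_W-\{W\}$ of at most $\lfloor N\rfloor$ elements such that every $T\in\mathfrak S_W-\{W\}$ either lies in some $\mathfrak S_{T_i}$ or satisfies $d_T(x,x')<E$; moreover $d_W(x,\rho^{T_i}_W)\le N$ for all $i$. (7) Bounded geodesic image: there is $E>0$ such that for all $V\sqsubset W$ and all geodesics $\gamma$ of $\mathcal CW$, either $\mathrm{diam}_{\mathcal CV}(\rho^W_V(\gamma))\le E$ or $\gamma$ meets the $E$-neighborhood of $\rho^V_W$. (8) Partial realization: there is $\alpha$ such that for every family $\{V_j\}$ of pairwise orthogonal elements and $p_j\in\pi_{V_j}(\mathcal X)$ there is $x\in\mathcal X$ with $d_{V_j}(x,p_j)\le\alpha$ for all $j$, and $d_V(x,\rho^{V_j}_V)\le\alpha$ whenever $V_j\sqsubset V$ or $V\pitchfork V_j$ for some $j$. (9) Uniqueness: for each $\kappa\ge0$ there is $\theta_u(\kappa)$ such that $d_{\mathcal X}(x,y)\ge\theta_u(\kappa)$ implies $d_V(x,y)\ge\kappa$ for some $V\in\mathfrak S$. *)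

theory Defs
  imports "HOL-Analysis.Analysis"
begin

section \<open>Metric notions\<close>

text \<open>Carrier-based metric spaces \<open>(M, d)\<close> are those of \<^locale>\<open>Metric_space\<close>. The infimum is
  only meaningful for nonempty sets; every set whose distance is taken below is nonempty.\<close>

definition set_dist :: "('a \<Rightarrow> 'a \<Rightarrow> real) \<Rightarrow> 'a set \<Rightarrow> 'a set \<Rightarrow> real" where
  "set_dist d A B = (INF (a, b) \<in> A \<times> B. d a b)"

text \<open>\<open>diam A \<le> r\<close>, the diameter being a supremum in \<open>[0, \<infinity>]\<close> (for \<open>r \<ge> 0\<close>).\<close>

definition diam_le :: "('a \<Rightarrow> 'a \<Rightarrow> real) \<Rightarrow> 'a set \<Rightarrow> real \<Rightarrow> bool" where
  "diam_le d A r \<longleftrightarrow> (\<forall>a\<in>A. \<forall>b\<in>A. d a b \<le> r)"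

definition nbhd :: "'a set \<Rightarrow> ('a \<Rightarrow> 'a \<Rightarrow> real) \<Rightarrow> real \<Rightarrow> 'a set \<Rightarrow> 'a set" where
  "nbhd M d r A = {p \<in> M. set_dist d {p} A \<le> r}"

definition geodesic :: "'a set \<Rightarrow> ('a \<Rightarrow> 'a \<Rightarrow> real) \<Rightarrow> 'a \<Rightarrow> 'a \<Rightarrow> 'a set \<Rightarrow> bool" where
  "geodesic M d x y G \<longleftrightarrow>
     (\<exists>L\<ge>0. \<exists>g. g \<in> {0..L} \<rightarrow> M \<and> g 0 = x \<and> g L = y \<and> G = g ` {0..L} \<and>
        (\<forall>s\<in>{0..L}. \<forall>t\<in>{0..L}. d (g s) (g t) = \<bar>s - t\<bar>))"

definition geodesic_space :: "'a set \<Rightarrow> ('a \<Rightarrow> 'a \<Rightarrow> real) \<Rightarrow> bool" where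
  "geodesic_space M d \<longleftrightarrow> Metric_space M d \<and> (\<forall>x\<in>M. \<forall>y\<in>M. \<exists>G. geodesic M d x y G)"

definition quasigeodesic_space :: "real \<Rightarrow> 'a set \<Rightarrow> ('a \<Rightarrow> 'a \<Rightarrow> real) \<Rightarrow> bool" where
  "quasigeodesic_space q M d \<longleftrightarrow> Metric_space M d \<and> q \<ge> 1 \<and>
     (\<forall>x\<in>M. \<forall>y\<in>M. \<exists>L\<ge>0. \<exists>g. g \<in> {0..L} \<rightarrow> M \<and> g 0 = x \<and> g L = y \<and>
        (\<forall>s\<in>{0..L}. \<forall>t\<in>{0..L}.
           \<bar>s - t\<bar> / q - q \<le> d (g s) (g t) \<and> d (g s) (g t) \<le> q * \<bar>s - t\<bar> + q))"

text \<open>Gromov hyperbolicity through slim triangles; by the quantification over all triangles it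
  suffices to treat one of the three sides.\<close>

definition hyperbolic_space :: "real \<Rightarrow> 'a set \<Rightarrow> ('a \<Rightarrow> 'a \<Rightarrow> real) \<Rightarrow> bool" where
  "hyperbolic_space \<delta> M d \<longleftrightarrow> geodesic_space M d \<and>
     (\<forall>x\<in>M. \<forall>y\<in>M. \<forall>z\<in>M. \<forall>G\<^sub>1 G\<^sub>2 G\<^sub>3.
        geodesic M d x y G\<^sub>1 \<longrightarrow> geodesic M d y z G\<^sub>2 \<longrightarrow> geodesic M d x z G\<^sub>3 \<longrightarrow>
        G\<^sub>1 \<subseteq> nbhd M d \<delta> (G\<^sub>2 \<union> G\<^sub>3))"

definition quasiconvex :: "real \<Rightarrow> 'a set \<Rightarrow> ('a \<Rightarrow> 'a \<Rightarrow> real) \<Rightarrow> 'a set \<Rightarrow> bool" where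
  "quasiconvex K M d A \<longleftrightarrow> A \<subseteq> M \<and>
     (\<forall>x\<in>A. \<forall>y\<in>A. \<forall>G. geodesic M d x y G \<longrightarrow> G \<subseteq> nbhd M d K A)"


section \<open>Hierarchically hyperbolic structures\<close>

text \<open>The spaces \<open>\<C>W\<close> are subsets of one type \<open>'c\<close>, each with its own metric; this is
  no restriction, since any family of metric spaces embeds in a disjoint union.

  \<open>rho \<SS> V W\<close> is the set \<open>\<rho>\<^sup>V\<^sub>W \<subseteq> \<C>W\<close>, relevant if \<open>V\<close> is
  properly nested in or transverse to \<open>W\<close>; \<open>rho_map \<SS> W V\<close> is the map
  \<open>\<rho>\<^sup>W\<^sub>V\<close> from \<open>\<C>W\<close> to subsets of \<open>\<C>V\<close>, relevant if \<open>V\<close> is properly nested in \<open>W\<close>.\<close>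

record ('x, 'w, 'c) hh_structure =
  domains :: "'w set"
  cspace :: "'w \<Rightarrow> 'c set"
  cdist :: "'w \<Rightarrow> 'c \<Rightarrow> 'c \<Rightarrow> real"
  proj :: "'w \<Rightarrow> 'x \<Rightarrow> 'c set"
  nest :: "'w rel"
  orth :: "'w rel"
  rho :: "'w \<Rightarrow> 'w \<Rightarrow> 'c set"
  rho_map :: "'w \<Rightarrow> 'w \<Rightarrow> 'c \<Rightarrow> 'c set"

abbreviation nested :: "'w \<Rightarrow> ('x, 'w, 'c) hh_structure \<Rightarrow> 'w \<Rightarrow> bool"
    ("(_ \<sqsubseteq>\<^bsub>_\<^esub> _)" [51, 0, 51] 50) where
  "V \<sqsubseteq>\<^bsub>\<SS>\<^esub> W \<equiv> (V, W) \<in> nest \<SS>"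

abbreviation proper_nested :: "'w \<Rightarrow> ('x, 'w, 'c) hh_structure \<Rightarrow> 'w \<Rightarrow> bool"
    ("(_ \<sqsubset>\<^bsub>_\<^esub> _)" [51, 0, 51] 50) where
  "V \<sqsubset>\<^bsub>\<SS>\<^esub> W \<equiv> V \<sqsubseteq>\<^bsub>\<SS>\<^esub> W \<and> V \<noteq> W"

abbreviation orthogonal_dom :: "'w \<Rightarrow> ('x, 'w, 'c) hh_structure \<Rightarrow> 'w \<Rightarrow> bool"
    ("(_ \<bottom>\<^bsub>_\<^esub> _)" [51, 0, 51] 50) where
  "V \<bottom>\<^bsub>\<SS>\<^esub> W \<equiv> (V, W) \<in> orth \<SS>"

definition transverse :: "'w \<Rightarrow> ('x, 'w, 'c) hh_structure \<Rightarrow> 'w \<Rightarrow> bool"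
    ("(_ \<pitchfork>\<^bsub>_\<^esub> _)" [51, 0, 51] 50) where
  "V \<pitchfork>\<^bsub>\<SS>\<^esub> W \<longleftrightarrow> V \<in> domains \<SS> \<and> W \<in> domains \<SS> \<and>
     \<not> V \<bottom>\<^bsub>\<SS>\<^esub> W \<and> \<not> V \<sqsubseteq>\<^bsub>\<SS>\<^esub> W \<and> \<not> W \<sqsubseteq>\<^bsub>\<SS>\<^esub> V"

definition domains_below :: "('x, 'w, 'c) hh_structure \<Rightarrow> 'w \<Rightarrow> 'w set" where
  "domains_below \<SS> W = {V \<in> domains \<SS>. V \<sqsubseteq>\<^bsub>\<SS>\<^esub> W}"

definition dom_dist :: "('x, 'w, 'c) hh_structure \<Rightarrow> 'w \<Rightarrow> 'x \<Rightarrow> 'x \<Rightarrow> real" where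
  "dom_dist \<SS> W x y = set_dist (cdist \<SS> W) (proj \<SS> W x) (proj \<SS> W y)"

definition dom_dist_set :: "('x, 'w, 'c) hh_structure \<Rightarrow> 'w \<Rightarrow> 'x \<Rightarrow> 'c set \<Rightarrow> real" where
  "dom_dist_set \<SS> W x p = set_dist (cdist \<SS> W) (proj \<SS> W x) p"

definition hh_projections ::
    "real \<Rightarrow> real \<Rightarrow> 'x set \<Rightarrow> ('x \<Rightarrow> 'x \<Rightarrow> real) \<Rightarrow> ('x, 'w, 'c) hh_structure \<Rightarrow> bool" where
  "hh_projections \<xi> K X d \<SS> \<longleftrightarrow>
     (\<forall>W\<in>domains \<SS>.
        (\<forall>x\<in>X. proj \<SS> W x \<subseteq> cspace \<SS> W \<and> proj \<SS> W x \<noteq> {} \<and>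
           diam_le (cdist \<SS> W) (proj \<SS> W x) \<xi>) \<and>
        (\<forall>x\<in>X. \<forall>y\<in>X. dom_dist \<SS> W x y \<le> K * d x y + K) \<and>
        quasiconvex K (cspace \<SS> W) (cdist \<SS> W) (\<Union>x\<in>X. proj \<SS> W x))"

definition hh_nesting :: "real \<Rightarrow> ('x, 'w, 'c) hh_structure \<Rightarrow> bool" where
  "hh_nesting \<xi> \<SS> \<longleftrightarrow>
     partial_order_on (domains \<SS>) (nest \<SS>) \<and>
     (domains \<SS> = {} \<or>
       (\<exists>!M. M \<in> domains \<SS> \<and> (\<forall>V\<in>domains \<SS>. M \<sqsubseteq>\<^bsub>\<SS>\<^esub> V \<longrightarrow> V = M))) \<and>
     (\<forall>V\<in>domains \<SS>. \<forall>W\<in>domains \<SS>. V \<sqsubset>\<^bsub>\<SS>\<^esub> W \<longrightarrow>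
        rho \<SS> V W \<subseteq> cspace \<SS> W \<and> rho \<SS> V W \<noteq> {} \<and>
        diam_le (cdist \<SS> W) (rho \<SS> V W) \<xi> \<and>
        (\<forall>p\<in>cspace \<SS> W. rho_map \<SS> W V p \<subseteq> cspace \<SS> V \<and> rho_map \<SS> W V p \<noteq> {}))"

definition hh_orthogonality :: "('x, 'w, 'c) hh_structure \<Rightarrow> bool" where
  "hh_orthogonality \<SS> \<longleftrightarrow>
     orth \<SS> \<subseteq> domains \<SS> \<times> domains \<SS> \<and> sym (orth \<SS>) \<and> irrefl (orth \<SS>) \<and>
     (\<forall>V W U. V \<sqsubseteq>\<^bsub>\<SS>\<^esub> W \<and> W \<bottom>\<^bsub>\<SS>\<^esub> U \<longrightarrow> V \<bottom>\<^bsub>\<SS>\<^esub> U) \<and>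
     (\<forall>T\<in>domains \<SS>. \<forall>U\<in>domains_below \<SS> T.
        {V \<in> domains_below \<SS> T. V \<bottom>\<^bsub>\<SS>\<^esub> U} \<noteq> {} \<longrightarrow>
        (\<exists>W\<in>domains_below \<SS> T - {T}.
           \<forall>V. V \<bottom>\<^bsub>\<SS>\<^esub> U \<and> V \<sqsubseteq>\<^bsub>\<SS>\<^esub> T \<longrightarrow> V \<sqsubseteq>\<^bsub>\<SS>\<^esub> W)) \<and>
     (\<forall>V W. V \<bottom>\<^bsub>\<SS>\<^esub> W \<longrightarrow> \<not> V \<sqsubseteq>\<^bsub>\<SS>\<^esub> W \<and> \<not> W \<sqsubseteq>\<^bsub>\<SS>\<^esub> V)"

definition hh_consistency ::
    "real \<Rightarrow> real \<Rightarrow> 'x set \<Rightarrow> ('x, 'w, 'c) hh_structure \<Rightarrow> bool" where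
  "hh_consistency \<xi> \<kappa>\<^sub>0 X \<SS> \<longleftrightarrow>
     (\<forall>V W. V \<pitchfork>\<^bsub>\<SS>\<^esub> W \<longrightarrow>
        rho \<SS> V W \<subseteq> cspace \<SS> W \<and> rho \<SS> V W \<noteq> {} \<and>
        diam_le (cdist \<SS> W) (rho \<SS> V W) \<xi> \<and>
        rho \<SS> W V \<subseteq> cspace \<SS> V \<and> rho \<SS> W V \<noteq> {} \<and>
        diam_le (cdist \<SS> V) (rho \<SS> W V) \<xi> \<and>
        (\<forall>x\<in>X. min (dom_dist_set \<SS> W x (rho \<SS> V W)) (dom_dist_set \<SS> V x (rho \<SS> W V)) \<le> \<kappa>\<^sub>0)) \<and>
     (\<forall>V W. V \<sqsubset>\<^bsub>\<SS>\<^esub> W \<longrightarrow>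
        (\<forall>x\<in>X. dom_dist_set \<SS> W x (rho \<SS> V W) \<le> \<kappa>\<^sub>0 \<or>
           diam_le (cdist \<SS> V) (proj \<SS> V x \<union> (\<Union>p\<in>proj \<SS> W x. rho_map \<SS> W V p)) \<kappa>\<^sub>0)) \<and>
     (\<forall>U V W. U \<sqsubseteq>\<^bsub>\<SS>\<^esub> V \<longrightarrow>
        V \<sqsubset>\<^bsub>\<SS>\<^esub> W \<or> (V \<pitchfork>\<^bsub>\<SS>\<^esub> W \<and> \<not> W \<bottom>\<^bsub>\<SS>\<^esub> U) \<longrightarrow>
        set_dist (cdist \<SS> W) (rho \<SS> U W) (rho \<SS> V W) \<le> \<kappa>\<^sub>0)"

definition hh_finite_complexity :: "nat \<Rightarrow> ('x, 'w, 'c) hh_structure \<Rightarrow> bool" where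
  "hh_finite_complexity n \<SS> \<longleftrightarrow>
     (\<forall>\<A>\<subseteq>domains \<SS>. (\<forall>V\<in>\<A>. \<forall>W\<in>\<A>. V \<sqsubseteq>\<^bsub>\<SS>\<^esub> W \<or> W \<sqsubseteq>\<^bsub>\<SS>\<^esub> V) \<longrightarrow>
        finite \<A> \<and> card \<A> \<le> n)"

definition hh_large_links ::
    "real \<Rightarrow> real \<Rightarrow> 'x set \<Rightarrow> ('x, 'w, 'c) hh_structure \<Rightarrow> bool" where
  "hh_large_links \<Lambda> E X \<SS> \<longleftrightarrow>
     (\<forall>W\<in>domains \<SS>. \<forall>x\<in>X. \<forall>x'\<in>X. let N = \<Lambda> * dom_dist \<SS> W x x' + \<Lambda> in
        \<exists>\<T>\<subseteq>domains_below \<SS> W - {W}.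
          finite \<T> \<and> int (card \<T>) \<le> \<lfloor>N\<rfloor> \<and>
          (\<forall>T\<in>domains_below \<SS> W - {W}.
             (\<exists>T'\<in>\<T>. T \<in> domains_below \<SS> T') \<or> dom_dist \<SS> T x x' < E) \<and>
          (\<forall>T'\<in>\<T>. dom_dist_set \<SS> W x (rho \<SS> T' W) \<le> N))"

text \<open>It is enough to consider geodesic segments: the condition for segments implies the one for
  geodesic rays and lines, by exhausting them by segments.\<close>

definition hh_bounded_geodesic_image :: "real \<Rightarrow> ('x, 'w, 'c) hh_structure \<Rightarrow> bool" where
  "hh_bounded_geodesic_image E \<SS> \<longleftrightarrow>
     (\<forall>V W. V \<sqsubset>\<^bsub>\<SS>\<^esub> W \<longrightarrow>
        (\<forall>a\<in>cspace \<SS> W. \<forall>b\<in>cspace \<SS> W. \<forall>G. geodesic (cspace \<SS> W) (cdist \<SS> W) a b G \<longrightarrow>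
           diam_le (cdist \<SS> V) (\<Union>p\<in>G. rho_map \<SS> W V p) E \<or>
           G \<inter> nbhd (cspace \<SS> W) (cdist \<SS> W) E (rho \<SS> V W) \<noteq> {}))"

text \<open>A family of pairwise orthogonal elements has no repetitions, so it is given as a set.\<close>

definition hh_partial_realization ::
    "real \<Rightarrow> 'x set \<Rightarrow> ('x, 'w, 'c) hh_structure \<Rightarrow> bool" where
  "hh_partial_realization \<alpha> X \<SS> \<longleftrightarrow>
     (\<forall>\<V>\<subseteq>domains \<SS>. \<forall>p.
        (\<forall>V\<in>\<V>. \<forall>W\<in>\<V>. V \<noteq> W \<longrightarrow> V \<bottom>\<^bsub>\<SS>\<^esub> W) \<longrightarrow>
        (\<forall>V\<in>\<V>. p V \<in> (\<Union>x\<in>X. proj \<SS> V x)) \<longrightarrow>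
        (\<exists>x\<in>X. \<forall>V\<in>\<V>. dom_dist_set \<SS> V x {p V} \<le> \<alpha> \<and>
           (\<forall>W\<in>domains \<SS>. V \<sqsubset>\<^bsub>\<SS>\<^esub> W \<or> W \<pitchfork>\<^bsub>\<SS>\<^esub> V \<longrightarrow>
              dom_dist_set \<SS> W x (rho \<SS> V W) \<le> \<alpha>)))"

definition hh_uniqueness ::
    "(real \<Rightarrow> real) \<Rightarrow> 'x set \<Rightarrow> ('x \<Rightarrow> 'x \<Rightarrow> real) \<Rightarrow> ('x, 'w, 'c) hh_structure \<Rightarrow> bool" where
  "hh_uniqueness \<theta> X d \<SS> \<longleftrightarrow>
     (\<forall>\<kappa>\<ge>0. \<forall>x\<in>X. \<forall>y\<in>X. d x y \<ge> \<theta> \<kappa> \<longrightarrow> (\<exists>V\<in>domains \<SS>. dom_dist \<SS> V x y \<ge> \<kappa>))"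

definition hierarchically_hyperbolic_space ::
    "'x set \<Rightarrow> ('x \<Rightarrow> 'x \<Rightarrow> real) \<Rightarrow> ('x, 'w, 'c) hh_structure \<Rightarrow> bool" where
  "hierarchically_hyperbolic_space X d \<SS> \<longleftrightarrow>
     (\<exists>q. quasigeodesic_space q X d) \<and>
     (\<exists>\<delta>\<ge>0. \<forall>W\<in>domains \<SS>. hyperbolic_space \<delta> (cspace \<SS> W) (cdist \<SS> W)) \<and>
     (\<exists>\<xi>\<ge>0. \<exists>\<kappa>\<^sub>0\<ge>0.
        (\<exists>K\<ge>0. hh_projections \<xi> K X d \<SS>) \<and>
        hh_nesting \<xi> \<SS> \<and>
        hh_orthogonality \<SS> \<and>
        hh_consistency \<xi> \<kappa>\<^sub>0 X \<SS> \<and>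
        (\<exists>n. hh_finite_complexity n \<SS>) \<and>
        (\<exists>\<Lambda>\<ge>1. \<exists>E\<ge>max \<xi> \<kappa>\<^sub>0. hh_large_links \<Lambda> E X \<SS>) \<and>
        (\<exists>E>0. hh_bounded_geodesic_image E \<SS>) \<and>
        (\<exists>\<alpha>. hh_partial_realization \<alpha> X \<SS>) \<and>
        (\<exists>\<theta>. hh_uniqueness \<theta> X d \<SS>))"


section \<open>Notation of the distance formula\<close>

definition threshold :: "real \<Rightarrow> real \<Rightarrow> real" where
  "threshold B A = (if A \<ge> B then A else 0)"

definition coarse_eq :: "real \<Rightarrow> real \<Rightarrow> real \<Rightarrow> real \<Rightarrow> bool" where
  "coarse_eq K C A B \<longleftrightarrow> inverse K * A - C \<le> B \<and> B \<le> K * A + C"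

end

theory Submission
  imports Defs
begin

text \<open>Both bounds are read off the pseudometrics on \<open>\<X>\<close> pulled back from the spaces \<open>\<C>W\<close>.

  For the bound on the sum, follow a coarse path from \<open>x\<close> to \<open>y\<close>. A relevant domain is active at
  the times at which the path projects far from both ends, which is about \<open>d\<^sub>W(x, y)\<close> many
  times; consistency prevents transverse domains from being active simultaneously, and
  families without transverse pairs have bounded size.

  For the bound on the distance, a consistent tuple of coordinates is realised by a point: start
  from partial realisations of orthogonal families, and repeatedly pass to a domain in which the
  coordinate is wrong that is maximal and last in the time order towards the tuple; the levels
  of the family bound the number of steps. Applied to medians, with the coordinates orthogonal to
  \<open>U\<close> frozen, this gives points between \<open>x\<close> and \<open>y\<close> over a geodesic of \<open>\<C>U\<close>. If
  \<open>U\<close> is a relevant domain of the highest level, then every other domain sees a bounded number of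
  the steps of the resulting subdivision, while \<open>U\<close> itself is no longer relevant for a step. Large
  links bounds the number of relevant domains of the highest level, so a double induction on level and
  number terminates after boundedly many rounds; in each round multiplicative constants are harmless.\<close>


section \<open>Coordinate systems\<close>

text \<open>The coordinates orthogonal to \<open>U\<close> are frozen because a point realising a
  coordinate in \<open>U\<close> is not controlled in domains orthogonal to \<open>U\<close>:
  medians with such points could move there at every step of a subdivision. Kept at the coordinates
  of \<open>x\<close>, they are left to change in the single last step. The resulting tuple mixes
  coordinates of \<open>x\<close> with medians, so it need not come from a point, and the general
  argument for consistent tuples is required. That argument presupposes finitely many wrong
  coordinates at some point, which is why the bound on the sum comes before it.

  A step of a subdivision is only known to be about twice as long as the whole in any domain. So
  each round compares sums for a raised threshold, and the induction carries one threshold for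
  counting domains and another for the sum, both arbitrary. A domain properly containing
  \<open>U\<close> may see every step; choosing \<open>U\<close> of the highest relevant level keeps
  such domains irrelevant.\<close>

text \<open>\<open>dd V x y\<close> plays the role of \<open>d\<^sub>V(x, y)\<close>, \<open>V \<preceq> W\<close> and \<open>V \<bottom>\<bottom> W\<close> those of
  nesting and orthogonality. Partial realization provides a point \<open>r V W\<close> of \<open>\<X>\<close> that projects
  close to \<open>\<rho>\<^sup>V\<^sub>W\<close>, and the maps \<open>\<rho>\<^sup>W\<^sub>V\<close> are eliminated by combining
  consistency with bounded geodesic image. A single constant \<open>E\<close> serves all axioms.\<close>

locale coordinate_system =
  fixes X :: "'x set" and d :: "'x \<Rightarrow> 'x \<Rightarrow> real"
    and D :: "'w set" and dd :: "'w \<Rightarrow> 'x \<Rightarrow> 'x \<Rightarrow> real"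
    and sub :: "'w \<Rightarrow> 'w \<Rightarrow> bool" (infix \<open>\<preceq>\<close> 50)
    and ort :: "'w \<Rightarrow> 'w \<Rightarrow> bool" (infix \<open>\<bottom>\<bottom>\<close> 50)
    and r :: "'w \<Rightarrow> 'w \<Rightarrow> 'x" and lev :: "'w \<Rightarrow> nat" and n :: nat and E :: real
  assumes E_ge: "E \<ge> 1"
    and d_triangle: "\<lbrakk>x \<in> X; y \<in> X; z \<in> X\<rbrakk> \<Longrightarrow> d x z \<le> d x y + d y z"
    and dd_nonneg: "V \<in> D \<Longrightarrow> dd V x y \<ge> 0"
    and dd_commute: "V \<in> D \<Longrightarrow> dd V x y = dd V y x"
    and dd_self: "\<lbrakk>V \<in> D; x \<in> X\<rbrakk> \<Longrightarrow> dd V x x = 0"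
    and dd_tri: "\<lbrakk>V \<in> D; x \<in> X; y \<in> X; z \<in> X\<rbrakk> \<Longrightarrow> dd V x z \<le> dd V x y + dd V y z"
    and sub_dom: "V \<preceq> W \<Longrightarrow> V \<in> D \<and> W \<in> D"
    and sub_refl: "V \<in> D \<Longrightarrow> V \<preceq> V"
    and sub_trans: "\<lbrakk>U \<preceq> V; V \<preceq> W\<rbrakk> \<Longrightarrow> U \<preceq> W"
    and sub_antisym: "\<lbrakk>V \<preceq> W; W \<preceq> V\<rbrakk> \<Longrightarrow> V = W"
    and ort_dom: "V \<bottom>\<bottom> W \<Longrightarrow> V \<in> D \<and> W \<in> D"
    and ort_sym: "V \<bottom>\<bottom> W \<Longrightarrow> W \<bottom>\<bottom> V"
    and ort_sub: "\<lbrakk>V \<preceq> W; W \<bottom>\<bottom> U\<rbrakk> \<Longrightarrow> V \<bottom>\<bottom> U"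
    and ort_not_sub: "V \<bottom>\<bottom> W \<Longrightarrow> \<not> V \<preceq> W"
    and lev_less: "\<lbrakk>V \<preceq> W; V \<noteq> W\<rbrakk> \<Longrightarrow> lev V < lev W"
    and lev_le: "V \<in> D \<Longrightarrow> lev V \<le> n"
    and ort_card: "\<lbrakk>finite \<V>; \<V> \<subseteq> D; \<And>V W. \<lbrakk>V \<in> \<V>; W \<in> \<V>; V \<noteq> W\<rbrakk> \<Longrightarrow> V \<bottom>\<bottom> W\<rbrakk> \<Longrightarrow> card \<V> \<le> n"
    and ex_top: "D \<noteq> {} \<Longrightarrow> \<exists>T\<in>D. \<forall>V\<in>D. V \<preceq> T"
    and r_in: "\<lbrakk>V \<in> D; W \<in> D\<rbrakk> \<Longrightarrow> \<not> V \<bottom>\<bottom> W \<Longrightarrow> \<not> W \<preceq> V \<Longrightarrow> r V W \<in> X"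
    and consistent: "\<lbrakk>V \<in> D; W \<in> D; \<not> V \<bottom>\<bottom> W; \<not> V \<preceq> W; \<not> W \<preceq> V; x \<in> X\<rbrakk>
        \<Longrightarrow> dd W x (r V W) \<le> E \<or> dd V x (r W V) \<le> E"
    and r_sub: "\<lbrakk>U \<preceq> V; W \<in> D; \<not> V \<bottom>\<bottom> W; \<not> W \<preceq> V; \<not> W \<bottom>\<bottom> U\<rbrakk> \<Longrightarrow> dd W (r U W) (r V W) \<le> E"
    and bounded_image: "\<lbrakk>V \<preceq> W; V \<noteq> W; x \<in> X; y \<in> X\<rbrakk>
        \<Longrightarrow> dd V x y \<le> E \<or> dd W x (r V W) + dd W (r V W) y \<le> dd W x y + E"
    and realize_orthogonal: "\<lbrakk>\<V> \<subseteq> D; \<And>V W. \<lbrakk>V \<in> \<V>; W \<in> \<V>; V \<noteq> W\<rbrakk> \<Longrightarrow> V \<bottom>\<bottom> W; \<And>V. V \<in> \<V> \<Longrightarrow> p V \<in> X\<rbrakk>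
        \<Longrightarrow> \<exists>x\<in>X. \<forall>V\<in>\<V>. dd V x (p V) \<le> E \<and>
              (\<forall>W\<in>D. \<not> V \<bottom>\<bottom> W \<and> \<not> W \<preceq> V \<longrightarrow> dd W x (r V W) \<le> E)"
    and large_links: "\<exists>N::nat. \<forall>W\<in>D. \<forall>x\<in>X. \<forall>y\<in>X. dd W x y \<le> a \<longrightarrow>
        (\<exists>\<T>. finite \<T> \<and> card \<T> \<le> N \<and> (\<forall>T\<in>\<T>. T \<preceq> W \<and> T \<noteq> W) \<and>
           (\<forall>V\<in>D. V \<preceq> W \<and> V \<noteq> W \<and> dd V x y \<ge> E \<longrightarrow> (\<exists>T\<in>\<T>. V \<preceq> T)))"
    and uniqueness: "\<exists>\<theta>\<ge>0. \<forall>x\<in>X. \<forall>y\<in>X. (\<forall>V\<in>D. dd V x y < \<kappa>) \<longrightarrow> d x y \<le> \<theta>"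
    and ex_median: "\<lbrakk>V \<in> D; x \<in> X; y \<in> X; z \<in> X\<rbrakk> \<Longrightarrow> \<exists>m\<in>X. dd V x m + dd V m y \<le> dd V x y + E \<and>
        dd V x m + dd V m z \<le> dd V x z + E \<and> dd V y m + dd V m z \<le> dd V y z + E"
    and ex_geodesic: "\<lbrakk>V \<in> D; x \<in> X; y \<in> X\<rbrakk> \<Longrightarrow> \<exists>g. (\<forall>t\<in>{0..dd V x y}. g t \<in> X) \<and>
        (\<forall>s\<in>{0..dd V x y}. \<forall>t\<in>{0..dd V x y}. \<bar>dd V (g s) (g t) - \<bar>s - t\<bar>\<bar> \<le> E) \<and>
        dd V x (g 0) \<le> E \<and> dd V (g (dd V x y)) y \<le> E"
    and ex_chain: "\<lbrakk>x \<in> X; y \<in> X\<rbrakk> \<Longrightarrow> \<exists>c N. c 0 = x \<and> c N = y \<and> (\<forall>i\<le>N. c i \<in> X) \<and>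
        (\<forall>i<N. \<forall>V\<in>D. dd V (c i) (c (Suc i)) \<le> E) \<and> real N \<le> E * d x y + E"
begin

text \<open>\<open>V\<close> is properly nested in or transverse to \<open>W\<close>, i.e. \<open>\<rho>\<^sup>V\<^sub>W\<close> is a subset of \<open>\<C>W\<close>.\<close>

definition shadows :: "'w \<Rightarrow> 'w \<Rightarrow> bool" (infix \<open>\<leadsto>\<close> 50) where
  "V \<leadsto> W \<longleftrightarrow> V \<in> D \<and> W \<in> D \<and> \<not> V \<bottom>\<bottom> W \<and> \<not> W \<preceq> V"

definition transv :: "'w \<Rightarrow> 'w \<Rightarrow> bool" (infix \<open>\<sqinter>\<close> 50) where
  "V \<sqinter> W \<longleftrightarrow> V \<leadsto> W \<and> W \<leadsto> V"

lemma transv_sym: "V \<sqinter> W \<Longrightarrow> W \<sqinter> V"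
  by (auto simp: transv_def)

lemma shadows_cases:
  assumes "V \<leadsto> W"
  obtains "V \<preceq> W" "V \<noteq> W" | "V \<sqinter> W"
  using assms sub_refl ort_sym unfolding shadows_def transv_def by blast

lemma dom_cases:
  assumes "V \<in> D" "W \<in> D"
  obtains "V \<bottom>\<bottom> W" | "V = W" | "W \<preceq> V" "V \<noteq> W" | "V \<leadsto> W"
  using assms unfolding shadows_def by blast

lemma shadows_dom: "V \<leadsto> W \<Longrightarrow> V \<in> D \<and> W \<in> D"
  by (auto simp: shadows_def)

lemma transvD:
  assumes "V \<sqinter> W"
  shows "V \<in> D" "W \<in> D" "V \<leadsto> W" "W \<leadsto> V" "\<not> V \<bottom>\<bottom> W" "\<not> W \<bottom>\<bottom> V" "\<not> V \<preceq> W" "\<not> W \<preceq> V" "V \<noteq> W"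
  using assms ort_sym sub_refl unfolding transv_def shadows_def by blast+

lemma proper_shadows: "\<lbrakk>V \<preceq> W; V \<noteq> W\<rbrakk> \<Longrightarrow> V \<leadsto> W"
  using ort_not_sub sub_antisym sub_dom unfolding shadows_def by blast

lemma r_carrier: "V \<leadsto> W \<Longrightarrow> r V W \<in> X"
  using r_in unfolding shadows_def by blast

lemma consistent_transv: "\<lbrakk>V \<sqinter> W; x \<in> X\<rbrakk> \<Longrightarrow> dd W x (r V W) \<le> E \<or> dd V x (r W V) \<le> E"
  using consistent transvD by blast

lemma r_sub_shadows: "\<lbrakk>U \<preceq> V; V \<leadsto> W; \<not> W \<bottom>\<bottom> U\<rbrakk> \<Longrightarrow> dd W (r U W) (r V W) \<le> E"
  using r_sub unfolding shadows_def by blast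

lemma realize_single:
  assumes "V \<in> D" "p \<in> X"
  obtains x where "x \<in> X" "dd V x p \<le> E" "\<And>W. V \<leadsto> W \<Longrightarrow> dd W x (r V W) \<le> E"
  using realize_orthogonal[of "{V}" "\<lambda>_. p"] assms unfolding shadows_def by fastforce

lemma dd_tri3:
  assumes "V \<in> D" "a \<in> X" "b \<in> X" "c \<in> X"
  shows "dd V a c \<le> dd V a b + dd V b c" "dd V a b \<le> dd V a c + dd V b c" "dd V b c \<le> dd V a b + dd V a c"
  using dd_tri[OF assms(1), of a b c] dd_tri[OF assms(1), of a c b] dd_tri[OF assms(1), of b a c]
    dd_commute[OF assms(1), of b c] dd_commute[OF assms(1), of a b] assms by auto

text \<open>One point realising \<open>{U, V}\<close> projects near both shadows in
  \<open>W\<close>.\<close>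

lemma r_orthogonal:
  assumes "U \<bottom>\<bottom> V" "U \<leadsto> W" "V \<leadsto> W"
  shows "dd W (r U W) (r V W) \<le> 2 * E"
proof -
  have D: "U \<in> D" "V \<in> D" "W \<in> D" using assms shadows_dom by auto
  obtain x0 where "x0 \<in> X" using r_carrier assms by blast
  moreover have "T \<bottom>\<bottom> T'" if "T \<in> {U,V}" "T' \<in> {U,V}" "T \<noteq> T'" for T T'
    using that assms ort_sym by auto
  ultimately obtain x where x: "x \<in> X" "\<forall>T\<in>{U,V}. dd T x x0 \<le> E \<and>
     (\<forall>W\<in>D. \<not> T \<bottom>\<bottom> W \<and> \<not> W \<preceq> T \<longrightarrow> dd W x (r T W) \<le> E)"
    using realize_orthogonal[of "{U,V}" "\<lambda>_. x0"] D by auto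
  then have "dd W x (r U W) \<le> E" "dd W x (r V W) \<le> E"
    using assms by (auto simp: shadows_def)
  then show ?thesis
    using dd_tri3(3)[OF D(3) x(1) r_carrier[OF assms(2)] r_carrier[OF assms(3)]] by simp
qed

lemma ort_irrefl: "\<not> V \<bottom>\<bottom> V"
  using ort_not_sub ort_dom sub_refl by blast

text \<open>Distinct domains of equal level are not nested, so each level contributes a pairwise
  orthogonal set of at most \<open>n\<close> domains, and there are \<open>Suc n\<close>
  levels.\<close>

lemma non_transverse_card:
  assumes F: "finite F" "F \<subseteq> D" and nt: "\<And>V W. \<lbrakk>V \<in> F; W \<in> F\<rbrakk> \<Longrightarrow> \<not> V \<sqinter> W"
  shows "card F \<le> n * Suc n"
proof -
  have *: "card {V \<in> F. lev V = k} \<le> n" for k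
  proof (rule ort_card)
    fix V W assume "V \<in> {V \<in> F. lev V = k}" "W \<in> {V \<in> F. lev V = k}" "V \<noteq> W"
    then show "V \<bottom>\<bottom> W"
      using nt[of V W] lev_less[of V W] lev_less[of W V] F ort_sym
      unfolding transv_def shadows_def by auto
  qed (use F in auto)
  have "F = (\<Union>k\<le>n. {V \<in> F. lev V = k})" using F lev_le by auto
  then have "card F \<le> (\<Sum>k\<le>n. card {V \<in> F. lev V = k})"
    using card_UN_le[of "{..n}"] by (metis finite_atMost)
  also have "\<dots> \<le> (\<Sum>k\<le>n. n)" by (rule sum_mono) (rule *)
  finally show ?thesis by (simp add: mult.commute)
qed

section \<open>Bounding the sum by counting the times at which domains are active\<close>

definition far :: "'x \<Rightarrow> 'x \<Rightarrow> 'w \<Rightarrow> 'x \<Rightarrow> bool" where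
  "far x y V z \<longleftrightarrow> 3 * E < dd V x z \<and> 3 * E < dd V z y"

text \<open>Consistency at \<open>x\<close> puts \<open>x\<close> near one of the two shadows, say
  near \<open>r A B\<close> in \<open>B\<close>. Then \<open>z\<close> and \<open>y\<close>, which
  are at least \<open>3 * E\<close> from \<open>x\<close> in \<open>B\<close>, are away from that
  shadow, so consistency puts both within \<open>E\<close> of \<open>r B A\<close> in
  \<open>A\<close>; but \<open>z\<close> is far from \<open>y\<close> in \<open>A\<close>.\<close>

lemma far_non_transverse:
  assumes X: "x \<in> X" "y \<in> X" "z \<in> X" and far: "far x y V z" "far x y W z"
    and large: "dd V x y \<ge> 3 * E" "dd W x y \<ge> 3 * E"
  shows "\<not> V \<sqinter> W"
proof
  assume "V \<sqinter> W"
  have *: False if "A \<sqinter> B" "far x y A z" "far x y B z" "dd B x y \<ge> 3 * E" "dd B x (r A B) \<le> E" for A B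
  proof -
    note t = transvD[OF that(1)]
    note rX = r_carrier[OF t(3)] r_carrier[OF t(4)]
    have "dd B z (r A B) > E"
      using that dd_tri3[OF t(2) X(1) X(3) rX(1)] E_ge by (auto simp: far_def)
    then have 1: "dd A z (r B A) \<le> E" using consistent_transv[OF that(1) X(3)] by auto
    have "dd B y (r A B) > E"
      using that dd_tri3[OF t(2) X(1) X(2) rX(1)] E_ge by (auto simp: far_def)
    then have 2: "dd A y (r B A) \<le> E" using consistent_transv[OF that(1) X(2)] by auto
    show False using 1 2 that dd_tri3[OF t(1) X(3) X(2) rX(2)] E_ge by (auto simp: far_def)
  qed
  from consistent_transv[OF \<open>V \<sqinter> W\<close> X(1)] show False
    using *[of V W] *[of W V] transv_sym \<open>V \<sqinter> W\<close> far large by blast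
qed

text \<open>The distance to \<open>x\<close>, clipped to the middle part of \<open>[0, L]\<close>,
  moves by at most \<open>E\<close> per step and only at active times, yet has to climb
  \<open>L - 8 * E\<close>, which is at least \<open>L / 2\<close>.\<close>

lemma far_steps:
  assumes x: "x \<in> X" and y: "y \<in> X" and V: "V \<in> D"
    and c: "c 0 = x" "c N = y" "\<And>i. i \<le> N \<Longrightarrow> c i \<in> X" "\<And>i. i < N \<Longrightarrow> dd V (c i) (c (Suc i)) \<le> E"
    and large: "dd V x y \<ge> 16 * E"
  shows "dd V x y \<le> 2 * E * card {i. i < N \<and> far x y V (c i)}"
proof -
  define L where "L = dd V x y"
  \<comment> \<open>Clipping at \<open>4 * E\<close> instead of \<open>3 * E\<close> allows for one
    step of length \<open>E\<close>: if the clipped value changes, \<open>c i\<close> itself is more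
    than \<open>3 * E\<close> from both ends.\<close>
  define g where "g i = max (4 * E) (min (L - 4 * E) (dd V x (c i)))" for i
  have g: "\<bar>g (Suc i) - g i\<bar> \<le> E" "g (Suc i) \<noteq> g i \<Longrightarrow> far x y V (c i)" if "i < N" for i
  proof -
    have i: "c i \<in> X" "c (Suc i) \<in> X" using c that by auto
    have 1: "\<bar>dd V x (c (Suc i)) - dd V x (c i)\<bar> \<le> E"
      using dd_tri3[OF V x i] c(4)[OF that] by linarith
    then show "\<bar>g (Suc i) - g i\<bar> \<le> E" unfolding g_def by linarith
    assume "g (Suc i) \<noteq> g i"
    then have "3 * E < dd V x (c i)" "dd V x (c i) < L - 3 * E"
      using 1 unfolding g_def by linarith+
    then show "far x y V (c i)"
      using dd_tri3[OF V x i(1) y] unfolding far_def L_def by linarith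
  qed
  have g0: "g 0 = 4 * E" "g N = L - 4 * E"
    using large E_ge dd_self[OF V x] c unfolding g_def L_def by auto
  have "L - 8 * E = (\<Sum>i<N. g (Suc i) - g i)"
    using g0 by (simp add: sum_lessThan_telescope)
  also have "\<dots> = (\<Sum>i | i < N \<and> far x y V (c i). g (Suc i) - g i)"
    by (rule sum.mono_neutral_right) (use g in auto)
  also have "\<dots> \<le> (\<Sum>i | i < N \<and> far x y V (c i). E)"
    by (rule sum_mono) (use g in \<open>auto simp: abs_le_iff\<close>)
  finally show ?thesis using large unfolding L_def by (simp add: algebra_simps)
qed

definition relevant :: "real \<Rightarrow> 'x \<Rightarrow> 'x \<Rightarrow> 'w set" where
  "relevant s x y = {V \<in> D. dd V x y \<ge> s}"

text \<open>Double counting of pairs of a domain and an active time: each distance is paid for by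
  active times, and at any one time the active domains contain no transverse pair. The set
  \<open>F\<close> is an arbitrary finite one because finiteness of \<open>relevant\<close> is
  itself a consequence of this bound.\<close>

lemma sum_le_dist:
  assumes x: "x \<in> X" and y: "y \<in> X" and F: "finite F" "F \<subseteq> relevant (16 * E) x y"
  shows "(\<Sum>V\<in>F. dd V x y) \<le> 2 * E * (n * Suc n) * (E * d x y + E)"
proof -
  obtain c N where c: "c 0 = x" "c N = y" "\<And>i. i \<le> N \<Longrightarrow> c i \<in> X"
    "\<And>i V. \<lbrakk>i < N; V \<in> D\<rbrakk> \<Longrightarrow> dd V (c i) (c (Suc i)) \<le> E" and N: "real N \<le> E * d x y + E"
    using ex_chain[OF x y] by metis
  have F': "V \<in> D" "dd V x y \<ge> 16 * E" if "V \<in> F" for V using F that by (auto simp: relevant_def)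
  have "(\<Sum>V\<in>F. dd V x y) \<le> (\<Sum>V\<in>F. 2 * E * card {i. i < N \<and> far x y V (c i)})"
    by (rule sum_mono, rule far_steps) (use F' x y c in auto)
  also have "\<dots> = 2 * E * (\<Sum>V\<in>F. \<Sum>i<N. if far x y V (c i) then 1 else 0)"
    by (simp add: sum_distrib_left flip: sum.inter_filter)
  also have "(\<Sum>V\<in>F. \<Sum>i<N. if far x y V (c i) then 1 else 0::real)
      = (\<Sum>i<N. real (card {V\<in>F. far x y V (c i)}))"
    by (subst sum.swap) (simp add: F flip: sum.inter_filter)
  also have "\<dots> \<le> (\<Sum>i<N. real (n * Suc n))"
  proof (rule sum_mono)
    fix i assume "i \<in> {..<N}"
    have "card {V\<in>F. far x y V (c i)} \<le> n * Suc n"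
    proof (rule non_transverse_card)
      fix V W assume "V \<in> {V\<in>F. far x y V (c i)}" "W \<in> {V\<in>F. far x y V (c i)}"
      then show "\<not> V \<sqinter> W"
        using far_non_transverse[OF x y, of "c i" V W] c(3)[of i] \<open>i \<in> {..<N}\<close> F'(2)[of V] F'(2)[of W] E_ge by auto
    qed (use F F' in auto)
    then show "real (card {V\<in>F. far x y V (c i)}) \<le> real (n * Suc n)"
      by (simp only: of_nat_le_iff)
  qed
  also have "\<dots> = real (n * Suc n) * N" by simp
  also have "\<dots> \<le> real (n * Suc n) * (E * d x y + E)"
    using N by (intro mult_left_mono) auto
  finally show ?thesis using E_ge by (simp add: algebra_simps)
qed

text \<open>Every relevant domain contributes at least 1 to a sum with an a priori bound.\<close>

lemma finite_relevant:
  assumes x: "x \<in> X" and y: "y \<in> X" and s: "s \<ge> 16 * E"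
  shows "finite (relevant s x y)"
proof (rule ccontr)
  define B where "B = 2 * E * (n * Suc n) * (E * d x y + E)"
  assume "infinite (relevant s x y)"
  then obtain F where F: "F \<subseteq> relevant s x y" "card F = nat \<lceil>B\<rceil> + 1" "finite F"
    by (metis infinite_arbitrarily_large)
  have ge: "dd V x y \<ge> 16 * E" if "V \<in> F" for V using F that s by (auto simp: relevant_def)
  have "real (card F) * 1 \<le> (\<Sum>V\<in>F. dd V x y)"
    by (rule sum_bounded_below) (use ge E_ge in fastforce)
  also have "\<dots> \<le> B" unfolding B_def
    by (rule sum_le_dist[OF x y]) (use F s in \<open>auto simp: relevant_def\<close>)
  finally show False using F by linarith
qed


subsection \<open>Realization of consistent tuples\<close>

text \<open>A coordinate in \<open>V\<close> is represented by a point \<open>\<beta> V\<close> of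
  \<open>X\<close>, of which the projection to \<open>V\<close> is meant. In the nested clause,
  \<open>dd V (\<beta> V) (\<beta> W)\<close> uses the projection of \<open>\<beta> W\<close> to
  \<open>V\<close> in place of the image of the \<open>W\<close>-coordinate under the map \<rho>; so
  this clause depends on the representing point and not only on its projection to
  \<open>W\<close>.\<close>

definition consistent_tuple :: "real \<Rightarrow> ('w \<Rightarrow> 'x) \<Rightarrow> bool" where
  "consistent_tuple \<kappa> \<beta> \<longleftrightarrow> (\<forall>V\<in>D. \<beta> V \<in> X) \<and>
     (\<forall>V W. V \<sqinter> W \<longrightarrow> dd W (\<beta> W) (r V W) \<le> \<kappa> \<or> dd V (\<beta> V) (r W V) \<le> \<kappa>) \<and>
     (\<forall>V W. V \<preceq> W \<and> V \<noteq> W \<longrightarrow> dd W (\<beta> W) (r V W) \<le> \<kappa> \<or> dd V (\<beta> V) (\<beta> W) \<le> \<kappa>)"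

lemma consistent_tupleD:
  assumes "consistent_tuple \<kappa> \<beta>"
  shows "V \<in> D \<Longrightarrow> \<beta> V \<in> X"
    and "V \<sqinter> W \<Longrightarrow> dd W (\<beta> W) (r V W) \<le> \<kappa> \<or> dd V (\<beta> V) (r W V) \<le> \<kappa>"
    and "\<lbrakk>V \<preceq> W; V \<noteq> W\<rbrakk> \<Longrightarrow> dd W (\<beta> W) (r V W) \<le> \<kappa> \<or> dd V (\<beta> V) (\<beta> W) \<le> \<kappa>"
  using assms by (simp_all add: consistent_tuple_def)

lemma consistent_tuple_mono:
  assumes \<beta>: "consistent_tuple \<kappa> \<beta>" and le: "\<kappa> \<le> \<kappa>'"
  shows "consistent_tuple \<kappa>' \<beta>"
  unfolding consistent_tuple_def
proof (intro conjI allI impI ballI)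
  fix V W assume "V \<sqinter> W"
  then show "dd W (\<beta> W) (r V W) \<le> \<kappa>' \<or> dd V (\<beta> V) (r W V) \<le> \<kappa>'"
    using consistent_tupleD(2)[OF \<beta>, of V W] le by linarith
next
  fix V W assume "V \<preceq> W \<and> V \<noteq> W"
  then show "dd W (\<beta> W) (r V W) \<le> \<kappa>' \<or> dd V (\<beta> V) (\<beta> W) \<le> \<kappa>'"
    using consistent_tupleD(3)[OF \<beta>, of V W] le by linarith
qed (rule consistent_tupleD(1)[OF \<beta>])

text \<open>The orthogonal family on which the tuple has been settled. By the last clause the tuple
  agrees with the shadow of every member, so a point realising the coordinates of the family is
  nearly right in every domain shadowed by a member.\<close>

definition good_family :: "real \<Rightarrow> ('w \<Rightarrow> 'x) \<Rightarrow> 'w set \<Rightarrow> bool" where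
  "good_family \<theta> \<beta> \<V> \<longleftrightarrow> finite \<V> \<and> \<V> \<subseteq> D \<and> (\<forall>V\<in>\<V>. \<forall>W\<in>\<V>. V \<noteq> W \<longrightarrow> V \<bottom>\<bottom> W) \<and>
     (\<forall>V\<in>\<V>. \<forall>U. V \<leadsto> U \<longrightarrow> dd U (\<beta> U) (r V U) \<le> \<theta>)"

text \<open>A potential that increases when an orthogonal domain joins the family or when a member
  is exchanged for a domain properly nested in it: weights are positive and decrease with the
  level.\<close>

definition depth :: "'w set \<Rightarrow> nat" where
  "depth \<V> = (\<Sum>V\<in>\<V>. Suc n - lev V)"

lemma depth_le:
  assumes "good_family \<theta> \<beta> \<V>"
  shows "depth \<V> \<le> n * Suc n"
proof -
  have "depth \<V> \<le> card \<V> * Suc n"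
    unfolding depth_def using sum_bounded_above[of \<V> "\<lambda>V. Suc n - lev V" "Suc n"] by simp
  moreover have "card \<V> \<le> n"
    by (rule ort_card) (use assms in \<open>auto simp: good_family_def\<close>)
  ultimately show ?thesis by (meson le_trans mult_le_mono1)
qed

definition discrepant :: "real \<Rightarrow> ('w \<Rightarrow> 'x) \<Rightarrow> 'x \<Rightarrow> 'w set" where
  "discrepant c \<beta> x = {V \<in> D. dd V x (\<beta> V) \<ge> c}"

text \<open>Two points of \<open>X\<close> are far apart in finitely many domains only, so
  finiteness at one point passes to every other.\<close>

lemma finite_discrepant:
  assumes \<beta>: "\<And>V. V \<in> D \<Longrightarrow> \<beta> V \<in> X" and x: "x \<in> X" "x0 \<in> X"
    and fin: "finite (discrepant \<kappa> \<beta> x0)" and c: "c \<ge> \<kappa> + 16 * E"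
  shows "finite (discrepant c \<beta> x)"
proof (rule finite_subset)
  show "discrepant c \<beta> x \<subseteq> discrepant \<kappa> \<beta> x0 \<union> relevant (16 * E) x x0"
  proof
    fix V assume "V \<in> discrepant c \<beta> x"
    then have V: "V \<in> D" "dd V x (\<beta> V) \<ge> c" by (auto simp: discrepant_def)
    then show "V \<in> discrepant \<kappa> \<beta> x0 \<union> relevant (16 * E) x x0"
      using dd_tri[OF V(1) x \<beta>[OF V(1)]] c by (auto simp: discrepant_def relevant_def)
  qed
qed (simp add: fin finite_relevant x)

text \<open>For maximal discrepant domains, \<open>behind\<close> says that \<open>U\<close> separates the point \<open>x\<close> and \<open>T\<close>
  from \<open>\<beta>\<close>. A domain with no other domain behind it in this order can be corrected first.\<close>

definition behind :: "real \<Rightarrow> ('w \<Rightarrow> 'x) \<Rightarrow> 'w \<Rightarrow> 'w \<Rightarrow> bool" where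
  "behind \<kappa> \<beta> T U \<longleftrightarrow> T \<sqinter> U \<and> dd T (\<beta> T) (r U T) \<le> \<kappa>"

text \<open>In \<open>T\<close> the tuple is near \<open>r U T\<close> and \<open>x\<close> is not,
  so consistency at \<open>x\<close> leaves only the shadow in \<open>U\<close>.\<close>

lemma behind_start:
  assumes \<beta>: "\<And>V. V \<in> D \<Longrightarrow> \<beta> V \<in> X" and x: "x \<in> X"
    and TU: "behind \<kappa> \<beta> T U" and T: "dd T x (\<beta> T) > \<kappa> + E"
  shows "dd U x (r T U) \<le> E"
proof -
  have t: "T \<sqinter> U" and le: "dd T (\<beta> T) (r U T) \<le> \<kappa>" using TU by (auto simp: behind_def)
  have "dd T x (r U T) > E"
    using dd_tri3[OF transvD(1)[OF t] x \<beta>[OF transvD(1)[OF t]] r_carrier[OF transvD(4)[OF t]]]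
      le T by simp
  then show ?thesis using consistent_transv[OF t x] by auto
qed

text \<open>In \<open>U\<close>, the point \<open>x\<close> is near \<open>r T U\<close> and the
  tuple is near \<open>r V U\<close>, so these shadows are far apart; this rules out
  \<open>T = V\<close> and, by \<open>r_orthogonal\<close>, orthogonality. The order of
  \<open>T\<close> and \<open>V\<close> is decided by a point \<open>p\<close> with the shadows of
  \<open>T\<close>: if the tuple were near \<open>r T V\<close> in \<open>V\<close>, then
  \<open>p\<close> would be near it there, hence away from \<open>r U V\<close>, and consistency
  would put \<open>p\<close> near \<open>r V U\<close> in \<open>U\<close>, where it is near
  \<open>r T U\<close>.\<close>

lemma behind_trans:
  assumes \<beta>: "consistent_tuple \<kappa> \<beta>" and x: "x \<in> X" and E: "E \<le> \<kappa>"
    and TU: "behind \<kappa> \<beta> T U" and UV: "behind \<kappa> \<beta> U V"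
    and T: "dd T x (\<beta> T) > \<kappa> + 4 * E" and U: "dd U x (\<beta> U) > \<kappa> + 4 * E" and V: "dd V x (\<beta> V) > \<kappa> + 4 * E"
    and incomparable: "T \<noteq> V \<Longrightarrow> \<not> T \<preceq> V" "T \<noteq> V \<Longrightarrow> \<not> V \<preceq> T"
  shows "behind \<kappa> \<beta> T V"
proof -
  note \<beta>X = consistent_tupleD(1)[OF \<beta>]
  have t: "T \<sqinter> U" "U \<sqinter> V" using TU UV by (auto simp: behind_def)
  have D: "T \<in> D" "U \<in> D" "V \<in> D" using transvD[OF t(1)] transvD[OF t(2)] by auto
  have rX: "r T U \<in> X" "r U T \<in> X" "r U V \<in> X" "r V U \<in> X"
    using r_carrier transvD t by blast+
  have 1: "dd U x (r T U) \<le> E" "dd V x (r U V) \<le> E"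
    using behind_start[OF \<beta>X x TU] behind_start[OF \<beta>X x UV] T U E_ge by auto
  have 2: "dd U (\<beta> U) (r V U) \<le> \<kappa>" using UV by (auto simp: behind_def)
  have sep: "dd U (r T U) (r V U) > 2 * E"
    using 1 2 U dd_tri3[OF D(2) x \<beta>X[OF D(2)] rX(4)] dd_tri3[OF D(2) x rX(1) rX(4)] E_ge by linarith
  have "T \<noteq> V" using sep dd_self[OF D(2) rX(4)] E_ge by auto
  moreover have "\<not> T \<bottom>\<bottom> V"
    using r_orthogonal[of T V U] transvD[OF t(1)] transvD[OF t(2)] sep by auto
  ultimately have TV: "T \<sqinter> V"
    using incomparable D ort_sym by (auto simp: transv_def shadows_def)
  have rX': "r T V \<in> X" using r_carrier transvD TV by blast
  have "dd T (\<beta> T) (r V T) \<le> \<kappa>"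
  proof (rule ccontr)
    assume "\<not> ?thesis"
    then have 3: "dd V (\<beta> V) (r T V) \<le> \<kappa>" using consistent_tupleD(2)[OF \<beta> TV] by auto
    obtain p where p: "p \<in> X" "\<And>W. T \<leadsto> W \<Longrightarrow> dd W p (r T W) \<le> E"
      using realize_single[OF D(1) x] by metis
    have p': "dd U p (r T U) \<le> E" "dd V p (r T V) \<le> E"
      using p(2) transvD t TV by blast+
    have "dd V p (r U V) > E"
      using 1 3 p' V dd_tri3[OF D(3) x \<beta>X[OF D(3)] rX'] dd_tri3[OF D(3) x p(1) rX'] dd_tri3[OF D(3) x p(1) rX(3)]
        E_ge by linarith
    then have "dd U p (r V U) \<le> E" using consistent_transv[OF t(2) p(1)] by auto
    then show False using sep p' dd_tri3[OF D(2) p(1) rX(1) rX(4)] by linarith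
  qed
  then show ?thesis using TV by (simp add: behind_def)
qed

lemma ex_sub_maximal:
  assumes "finite R" "V \<in> R"
  obtains M where "M \<in> R" "V \<preceq> M \<or> V = M" "\<And>W. W \<in> R \<Longrightarrow> M \<preceq> W \<Longrightarrow> W = M"
proof -
  let ?S = "{M \<in> R. V \<preceq> M \<or> V = M}"
  have S: "finite ?S" "?S \<noteq> {}" using assms by auto
  have "Max (lev ` ?S) \<in> lev ` ?S" using S by (intro Max_in) auto
  then obtain M where "Max (lev ` ?S) = lev M" and M: "M \<in> ?S" by (rule imageE)
  then have max: "lev W \<le> lev M" if "W \<in> ?S" for W using Max_ge[OF finite_imageI[OF S(1)] imageI[OF that, of lev]] \<open>Max (lev ` ?S) = lev M\<close> by simp
  show thesis
  proof (rule that[of M])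
    fix W assume "W \<in> R" "M \<preceq> W"
    moreover from this have "W \<in> ?S" using M sub_trans by auto
    ultimately show "W = M" using max[of W] lev_less[of M W] by fastforce
  qed (use M in auto)
qed

text \<open>Among the finitely many maximal discrepant domains some \<open>T\<close> has nothing
  behind it. If \<open>T\<close> is nested in \<open>U\<close>, maximality makes \<open>x\<close>
  and the tuple agree in \<open>U\<close> up to \<open>c\<close>; then either nested consistency
  applies or \<open>bounded_image\<close> puts \<open>r T U\<close> between them. If a transverse
  \<open>U\<close> violated the claim, it would be discrepant and behind \<open>T\<close>, and so
  would be a maximal discrepant domain above it.\<close>

lemma ex_last_discrepant:
  assumes \<beta>: "consistent_tuple \<kappa> \<beta>" and x: "x \<in> X" and E: "E \<le> \<kappa>"
    and fin: "finite (discrepant c \<beta> x)" and ne: "discrepant c \<beta> x \<noteq> {}" and c: "c > \<kappa> + 5 * E"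
  obtains T where "T \<in> discrepant c \<beta> x" "\<And>U. T \<leadsto> U \<Longrightarrow> dd U (\<beta> U) (r T U) \<le> c + 2 * E"
proof -
  note \<beta>X = consistent_tupleD(1)[OF \<beta>]
  \<comment> \<open>The additional \<open>E\<close> pays for replacing a domain by a maximal one
    above it: their shadows in \<open>T\<close> differ by at most \<open>E\<close>.\<close>
  let ?R = "discrepant c \<beta> x" and ?\<kappa> = "\<kappa> + E"
  have \<beta>': "consistent_tuple ?\<kappa> \<beta>" by (rule consistent_tuple_mono[OF \<beta>]) (use E_ge in auto)
  define M where "M = {T \<in> ?R. \<forall>U\<in>?R. T \<preceq> U \<longrightarrow> U = T}"
  have max: "\<exists>M'\<in>M. V \<preceq> M'" if V: "V \<in> ?R" for V
  proof -
    have "V \<preceq> V" using V sub_refl by (auto simp: discrepant_def)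
    moreover obtain M' where "M' \<in> ?R" "V \<preceq> M' \<or> V = M'" "\<And>W. W \<in> ?R \<Longrightarrow> M' \<preceq> W \<Longrightarrow> W = M'"
      by (rule ex_sub_maximal[OF fin V]) (rule that)
    ultimately show ?thesis unfolding M_def by auto
  qed
  have M: "finite M" using fin unfolding M_def by simp
  define Q where "Q = {(T, U). T \<in> M \<and> U \<in> M \<and> behind ?\<kappa> \<beta> T U}"
  have R: "V \<in> D" "dd V x (\<beta> V) > ?\<kappa> + 4 * E" "dd V x (\<beta> V) \<ge> c" if "V \<in> ?R" for V
    using that c by (auto simp: discrepant_def)
  have "Relation.trans Q"
  proof (rule transI)
    fix T U V assume "(T, U) \<in> Q" "(U, V) \<in> Q"
    then have M: "T \<in> M" "U \<in> M" "V \<in> M" and b: "behind ?\<kappa> \<beta> T U" "behind ?\<kappa> \<beta> U V"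
      by (auto simp: Q_def)
    then have "T \<in> ?R" "U \<in> ?R" "V \<in> ?R" by (auto simp: M_def)
    moreover have "T = V \<or> \<not> T \<preceq> V" "T = V \<or> \<not> V \<preceq> T"
      using M unfolding M_def by blast+
    moreover have "E \<le> ?\<kappa>" using E E_ge by linarith
    ultimately have "behind ?\<kappa> \<beta> T V"
      using behind_trans[OF \<beta>' x _ b] R(2) by blast
    then show "(T, V) \<in> Q" using M by (simp add: Q_def)
  qed
  moreover have "(T, T) \<notin> Q" for T using transvD(9)[of T T] by (auto simp: Q_def behind_def)
  ultimately have "acyclic Q" unfolding acyclic_def by (simp add: trancl_id)
  moreover have "finite Q" by (rule finite_subset[of _ "M \<times> M"]) (auto simp: Q_def M)
  ultimately have "wf (Q\<inverse>)" by (rule finite_acyclic_wf_converse[rotated])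
  then obtain T where T: "T \<in> M" "\<And>U. (T, U) \<in> Q \<Longrightarrow> U \<notin> M"
    using ne max unfolding wf_eq_minimal by (metis converse_iff ex_in_conv)
  have TR: "T \<in> ?R" using T by (auto simp: M_def)
  note TD = R(1)[OF TR]
  have "dd U (\<beta> U) (r T U) \<le> c + 2 * E" if TU: "T \<leadsto> U" for U
  proof -
    have UD: "U \<in> D" using shadows_dom TU by auto
    note rX = r_carrier[OF TU]
    from TU show ?thesis
    proof (cases rule: shadows_cases)
      case 1
      have "U \<notin> ?R" using T 1 by (auto simp: M_def)
      then have U: "dd U x (\<beta> U) < c" using UD by (auto simp: discrepant_def)
      consider "dd U (\<beta> U) (r T U) \<le> \<kappa>" | "dd T (\<beta> T) (\<beta> U) \<le> \<kappa>"
        using consistent_tupleD(3)[OF \<beta> 1] by blast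
      then show ?thesis
      proof cases
        case 2
        have "dd T x (\<beta> U) > E"
          using R(2)[OF TR] 2 dd_tri3[OF TD x \<beta>X[OF TD] \<beta>X[OF UD]] E_ge by linarith
        then have "dd U x (r T U) + dd U (r T U) (\<beta> U) \<le> dd U x (\<beta> U) + E"
          using bounded_image[OF 1 x \<beta>X[OF UD]] by auto
        then show ?thesis using U dd_nonneg[OF UD, of x "r T U"] dd_commute[OF UD, of "r T U"] E_ge by simp
      qed (use c E_ge in auto)
    next
      case 2
      have rX': "r U T \<in> X" using r_carrier transvD 2 by blast
      show ?thesis
      proof (rule ccontr)
        assume not: "\<not> ?thesis"
        then have 3: "dd T (\<beta> T) (r U T) \<le> \<kappa>"
          using consistent_tupleD(2)[OF \<beta> 2] c E_ge by auto
        then have "behind \<kappa> \<beta> T U" using 2 by (simp add: behind_def)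
        then have 4: "dd U x (r T U) \<le> E" using behind_start[OF \<beta>X x] R(2)[OF TR] E_ge by auto
        have "dd U x (\<beta> U) \<ge> c"
          using 4 not dd_tri3[OF UD x \<beta>X[OF UD] rX] E_ge by linarith
        then have "U \<in> ?R" using UD by (simp add: discrepant_def)
        then obtain U' where U': "U' \<in> M" "U \<preceq> U'"
          using max by blast
        have U'D: "U' \<in> D" "U' \<in> ?R" using U' R by (auto simp: M_def)
        have t: "T \<sqinter> U'"
          using U' T(1) transvD[OF 2] ort_sub ort_sym sub_trans U'D TD
          unfolding M_def transv_def shadows_def by blast
        have "dd T (r U T) (r U' T) \<le> E"
          by (rule r_sub_shadows[OF U'(2)]) (use transvD[OF t] transvD[OF 2] in auto)
        then have "dd T (\<beta> T) (r U' T) \<le> ?\<kappa>"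
          using 3 dd_tri3[OF TD \<beta>X[OF TD] rX' r_carrier[OF transvD(4)[OF t]]] by linarith
        then have "(T, U') \<in> Q" using t T(1) U'(1) by (simp add: Q_def behind_def)
        then show False using T(2) U'(1) by blast
      qed
    qed
  qed
  with TR show thesis using that by blast
qed

text \<open>A point \<open>x\<close> realising the family either realises the whole tuple or has a
  last discrepant domain \<open>T\<close>. No member equals or shadows \<open>T\<close>, since
  \<open>x\<close> and the tuple would then be close in \<open>T\<close>. So \<open>T\<close> is
  orthogonal to or properly nested in each member, and it replaces those to which it is not
  orthogonal.\<close>

lemma good_family_step:
  assumes \<beta>: "consistent_tuple \<kappa> \<beta>" and x0: "x0 \<in> X" and fin: "finite (discrepant \<kappa> \<beta> x0)"
    and E: "E \<le> \<kappa>" and good: "good_family \<theta> \<beta> \<V>" and \<kappa>\<theta>: "\<kappa> \<le> \<theta>"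
  shows "(\<exists>z\<in>X. \<forall>V\<in>D. dd V z (\<beta> V) \<le> \<theta> + 20 * E + \<kappa>) \<or>
    (\<exists>\<V>'. good_family (\<theta> + 20 * E + \<kappa>) \<beta> \<V>' \<and> depth \<V> < depth \<V>')"
proof -
  \<comment> \<open>\<open>c\<close> exceeds \<open>\<kappa> + 16 * E\<close>, for finiteness, and
    \<open>\<theta> + E\<close>, the most that \<open>x\<close> and the tuple can differ in a domain
    shadowed by a member; the extra \<open>2 * E\<close> of \<open>ex_last_discrepant\<close> stays
    below \<open>\<theta> + 20 * E + \<kappa>\<close>.\<close>
  define c where "c = \<theta> + 16 * E + \<kappa>"
  note \<beta>X = consistent_tupleD(1)[OF \<beta>]
  have VD: "\<V> \<subseteq> D" "finite \<V>" and orth: "\<And>V W. \<lbrakk>V \<in> \<V>; W \<in> \<V>; V \<noteq> W\<rbrakk> \<Longrightarrow> V \<bottom>\<bottom> W"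
    and gd: "\<And>V U. V \<in> \<V> \<Longrightarrow> V \<leadsto> U \<Longrightarrow> dd U (\<beta> U) (r V U) \<le> \<theta>"
    using good by (auto simp: good_family_def)
  obtain x where x: "x \<in> X" "\<And>V. V \<in> \<V> \<Longrightarrow> dd V x (\<beta> V) \<le> E"
    "\<And>V U. V \<in> \<V> \<Longrightarrow> V \<leadsto> U \<Longrightarrow> dd U x (r V U) \<le> E"
    using realize_orthogonal[OF VD(1) orth, of \<beta>] \<beta>X VD(1) unfolding shadows_def by blast
  show ?thesis
  proof (cases "discrepant c \<beta> x = {}")
    case True
    then have "\<forall>V\<in>D. dd V x (\<beta> V) \<le> \<theta> + 20 * E + \<kappa>"
      using E_ge unfolding discrepant_def c_def by fastforce
    then show ?thesis using x by blast
  next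
    case False
    have "finite (discrepant c \<beta> x)"
      by (rule finite_discrepant[OF \<beta>X x(1) x0 fin]) (use \<kappa>\<theta> E E_ge in \<open>auto simp: c_def\<close>)
    moreover have "c > \<kappa> + 5 * E" using \<kappa>\<theta> E E_ge unfolding c_def by linarith
    ultimately obtain T where T: "T \<in> discrepant c \<beta> x" "\<And>U. T \<leadsto> U \<Longrightarrow> dd U (\<beta> U) (r T U) \<le> c + 2 * E"
      by (rule ex_last_discrepant[OF \<beta> x(1) E _ False]) (rule that)
    have TD: "T \<in> D" and Tc: "dd T x (\<beta> T) \<ge> c" using T by (auto simp: discrepant_def)
    have TV: "T \<bottom>\<bottom> V \<or> T \<preceq> V \<and> T \<noteq> V" if V: "V \<in> \<V>" for V
    proof -
      have "T \<noteq> V" using x(2)[OF V] Tc E E_ge \<kappa>\<theta> unfolding c_def by auto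
      moreover have "\<not> V \<leadsto> T"
      proof
        assume VT: "V \<leadsto> T"
        show False
          using x(3)[OF V VT] gd[OF V VT] Tc dd_tri3[OF TD x(1) \<beta>X[OF TD] r_carrier[OF VT]]
            E E_ge unfolding c_def by linarith
      qed
      ultimately show ?thesis using V VD TD ort_sym unfolding shadows_def by blast
    qed
    have TnV: "T \<notin> \<V>" using TV ort_irrefl by blast
    define \<V>' where "\<V>' = insert T {V \<in> \<V>. T \<bottom>\<bottom> V}"
    have "good_family (\<theta> + 20 * E + \<kappa>) \<beta> \<V>'"
      unfolding good_family_def
    proof (intro conjI ballI allI impI)
      fix V U assume "V \<in> \<V>'" "V \<leadsto> U"
      then show "dd U (\<beta> U) (r V U) \<le> \<theta> + 20 * E + \<kappa>"
        using T(2)[of U] gd[of V U] E E_ge unfolding \<V>'_def c_def by fastforce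
    qed (use VD TD orth ort_sym in \<open>auto simp: \<V>'_def\<close>)
    moreover have "depth \<V> < depth \<V>'"
    proof -
      let ?f = "\<lambda>V. Suc n - lev V" and ?A = "{V \<in> \<V>. T \<bottom>\<bottom> V}"
      have d': "depth \<V>' = ?f T + sum ?f ?A"
        unfolding \<V>'_def depth_def using TnV VD by (subst sum.insert) auto
      have pos: "0 < ?f T" using lev_le[OF TD] by simp
      show ?thesis
      proof (cases "\<V> = ?A")
        case True
        have "depth \<V> = sum ?f ?A" unfolding depth_def by (rule sum.cong[OF True refl])
        then show ?thesis using d' pos by linarith
      next
        case False
        \<comment> \<open>Exactly one member is exchanged: once \<open>T\<close> is nested in
          \<open>V\<close>, it is orthogonal to everything orthogonal to \<open>V\<close>, so to all
          other members.\<close>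
        then obtain V where V: "V \<in> \<V>" "\<not> T \<bottom>\<bottom> V" by blast
        then have TV': "T \<preceq> V" "T \<noteq> V" using TV by auto
        have "T \<bottom>\<bottom> W" if "W \<in> \<V>" "W \<noteq> V" for W
          using orth[of V W] V that ort_sub[OF TV'(1)] by blast
        then have "\<V> = insert V ?A" using V by auto
        then have "depth \<V> = ?f V + sum ?f ?A"
          unfolding depth_def using V VD by (metis (no_types, lifting) finite_insert mem_Collect_eq sum.insert)
        moreover have "?f V < ?f T"
          using lev_less[OF TV'] lev_le[of V] V VD(1) by auto
        ultimately show ?thesis using d' by linarith
      qed
    qed
    ultimately show ?thesis by blast
  qed
qed

text \<open>Starting from the empty family, \<open>good_family_step\<close> can raise the depth only
  boundedly often; the constant grows with every step but is independent of the tuple and of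
  \<open>x0\<close>.\<close>

theorem realization:
  assumes "E \<le> \<kappa>"
  obtains \<theta> where "\<And>\<beta> x0. \<lbrakk>consistent_tuple \<kappa> \<beta>; x0 \<in> X; finite (discrepant \<kappa> \<beta> x0)\<rbrakk>
    \<Longrightarrow> \<exists>z\<in>X. \<forall>V\<in>D. dd V z (\<beta> V) \<le> \<theta>"
proof -
  define B where "B = n * Suc n"
  \<comment> \<open>\<open>j\<close> bounds how much the depth can still grow. The tuple is
    quantified inside, so that \<open>\<theta>'\<close> is chosen first.\<close>
  define P where "P \<theta> j \<theta>' \<longleftrightarrow> (\<forall>\<beta> x0 \<V>. consistent_tuple \<kappa> \<beta> \<longrightarrow> x0 \<in> X \<longrightarrow> finite (discrepant \<kappa> \<beta> x0) \<longrightarrow>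
      good_family \<theta> \<beta> \<V> \<longrightarrow> B \<le> depth \<V> + j \<longrightarrow> (\<exists>z\<in>X. \<forall>V\<in>D. dd V z (\<beta> V) \<le> \<theta>'))" for \<theta> \<theta>' and j :: nat
  have "\<exists>\<theta>'. P \<theta> j \<theta>'" if "\<kappa> \<le> \<theta>" for \<theta> j
    using that
  proof (induction j arbitrary: \<theta>)
    case 0
    have "P \<theta> 0 (\<theta> + 20 * E + \<kappa>)"
      unfolding P_def
    proof (intro allI impI)
      fix \<beta> x0 \<V> assume a: "consistent_tuple \<kappa> \<beta>" "x0 \<in> X" "finite (discrepant \<kappa> \<beta> x0)" "good_family \<theta> \<beta> \<V>"
        "B \<le> depth \<V> + 0"
      have "\<not> depth \<V> < depth \<V>'" if "good_family (\<theta> + 20 * E + \<kappa>) \<beta> \<V>'" for \<V>'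
        using depth_le[OF that] a(5) unfolding B_def[symmetric] by linarith
      then show "\<exists>z\<in>X. \<forall>V\<in>D. dd V z (\<beta> V) \<le> \<theta> + 20 * E + \<kappa>"
        using good_family_step[OF a(1-3) assms a(4) 0] by blast
    qed
    then show ?case ..
  next
    case (Suc j)
    let ?\<theta> = "\<theta> + 20 * E + \<kappa>"
    have "\<kappa> \<le> ?\<theta>" using Suc.prems E_ge assms by linarith
    then obtain \<theta>' where \<theta>': "P ?\<theta> j \<theta>'" using Suc.IH by blast
    have "P \<theta> (Suc j) (max ?\<theta> \<theta>')"
      unfolding P_def
    proof (intro allI impI)
      fix \<beta> x0 \<V> assume a: "consistent_tuple \<kappa> \<beta>" "x0 \<in> X" "finite (discrepant \<kappa> \<beta> x0)" "good_family \<theta> \<beta> \<V>"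
        "B \<le> depth \<V> + Suc j"
      from good_family_step[OF a(1-3) assms a(4) Suc.prems]
      show "\<exists>z\<in>X. \<forall>V\<in>D. dd V z (\<beta> V) \<le> max ?\<theta> \<theta>'"
      proof
        assume "\<exists>\<V>'. good_family ?\<theta> \<beta> \<V>' \<and> depth \<V> < depth \<V>'"
        then obtain \<V>' where "good_family ?\<theta> \<beta> \<V>'" "depth \<V> < depth \<V>'" by blast
        moreover have "B \<le> depth \<V>' + j"
          using a(5) \<open>depth \<V> < depth \<V>'\<close> by linarith
        ultimately have "\<exists>z\<in>X. \<forall>V\<in>D. dd V z (\<beta> V) \<le> \<theta>'"
          using \<theta>' a(1-3) unfolding P_def by blast
        then show ?thesis by (meson max.coboundedI2)
      next
        assume "\<exists>z\<in>X. \<forall>V\<in>D. dd V z (\<beta> V) \<le> ?\<theta>"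
        then show ?thesis by (meson max.coboundedI1)
      qed
    qed
    then show ?case ..
  qed
  from this[OF order_refl, of B] obtain \<theta> where \<theta>: "P \<kappa> B \<theta>" ..
  show thesis
  proof (rule that)
    fix \<beta> x0 assume "consistent_tuple \<kappa> \<beta>" "x0 \<in> X" "finite (discrepant \<kappa> \<beta> x0)"
    moreover have "good_family \<kappa> \<beta> {}" by (simp add: good_family_def)
    ultimately show "\<exists>z\<in>X. \<forall>V\<in>D. dd V z (\<beta> V) \<le> \<theta>" using \<theta> le_add2 unfolding P_def by blast
  qed
qed


subsection \<open>Medians and interpolation\<close>

text \<open>The point is chosen for each \<open>V\<close> separately, and only its projection to
  \<open>V\<close> is controlled; points for different domains are related only through the
  consistency proved below.\<close>

definition median :: "'w \<Rightarrow> 'x \<Rightarrow> 'x \<Rightarrow> 'x \<Rightarrow> 'x" where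
  "median V x y z = (SOME m. m \<in> X \<and> dd V x m + dd V m y \<le> dd V x y + E \<and>
        dd V x m + dd V m z \<le> dd V x z + E \<and> dd V y m + dd V m z \<le> dd V y z + E)"

lemma medianD:
  assumes "V \<in> D" "x \<in> X" "y \<in> X" "z \<in> X"
  shows "median V x y z \<in> X"
    and "dd V x (median V x y z) + dd V (median V x y z) y \<le> dd V x y + E"
    and "dd V x (median V x y z) + dd V (median V x y z) z \<le> dd V x z + E"
    and "dd V y (median V x y z) + dd V (median V x y z) z \<le> dd V y z + E"
  using someI_ex[OF ex_median[OF assms, unfolded Bex_def]] unfolding median_def by blast+

lemma between_near:
  assumes V: "V \<in> D" and X: "a \<in> X" "b \<in> X" "m \<in> X" "w \<in> X"
    and btw: "dd V a m + dd V m b \<le> dd V a b + E" and near: "dd V a w \<le> t" "dd V b w \<le> t"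
  shows "dd V m w \<le> 2 * t + E"
  using dd_tri3[OF V X(1) X(3) X(4)] dd_tri3[OF V X(2) X(3) X(4)] dd_tri3[OF V X(1) X(2) X(4)]
    btw near dd_commute[OF V, of m b] dd_nonneg[OF V, of m w] E_ge by linarith

lemma median_near:
  assumes V: "V \<in> D" and X: "x \<in> X" "y \<in> X" "z \<in> X" "w \<in> X"
    and near: "dd V x w \<le> t \<and> dd V y w \<le> t \<or> dd V x w \<le> t \<and> dd V z w \<le> t \<or> dd V y w \<le> t \<and> dd V z w \<le> t"
  shows "dd V (median V x y z) w \<le> 2 * t + E"
proof -
  note m = medianD[OF V X(1-3)]
  show ?thesis
    using near between_near[OF V X(1) X(2) m(1) X(4) m(2)] between_near[OF V X(1) X(3) m(1) X(4) m(3)]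
      between_near[OF V X(2) X(3) m(1) X(4) m(4)] by blast
qed

text \<open>Adding the two estimates that involve \<open>z\<close> puts the median within
  \<open>e / 2 + t + E\<close> of \<open>z\<close>.\<close>

lemma median_of_between:
  assumes V: "V \<in> D" and X: "x \<in> X" "y \<in> X" "z \<in> X" "w \<in> X"
    and btw: "dd V x w + dd V w y \<le> dd V x y + e" and near: "dd V z w \<le> t"
  shows "dd V (median V x y z) w \<le> e / 2 + 2 * t + E"
proof -
  note m = medianD[OF V X(1-3)]
  show ?thesis
    using m(3,4) btw near dd_tri3[OF V X(1) X(3) X(4)] dd_tri3[OF V X(2) X(3) X(4)]
      dd_tri3[OF V m(1) X(3) X(4)] dd_tri3[OF V X(1) m(1) X(2)]
      dd_commute[OF V, of w y] dd_commute[OF V, of "median V x y z" y] by linarith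
qed

text \<open>Each of the three ends is near one of the two shadows, so two ends are near the same
  one, and the tripod centre follows them.\<close>

lemma median_consistent_transv:
  assumes VW: "V \<sqinter> W" and X: "x \<in> X" "y \<in> X" "z \<in> X"
  shows "dd W (median W x y z) (r V W) \<le> 3 * E \<or> dd V (median V x y z) (r W V) \<le> 3 * E"
  using consistent_transv[OF VW X(1)] consistent_transv[OF VW X(2)] consistent_transv[OF VW X(3)]
    median_near[OF transvD(2)[OF VW] X r_carrier[OF transvD(3)[OF VW]], of E]
    median_near[OF transvD(1)[OF VW] X r_carrier[OF transvD(4)[OF VW]], of E] by argo

text \<open>A tripod centre lies near a point that separates it from two of the three ends.\<close>

lemma median_consistent_nested:
  assumes VW: "V \<preceq> W" "V \<noteq> W" and X: "x \<in> X" "y \<in> X" "z \<in> X"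
  shows "dd W (median W x y z) (r V W) \<le> 3 * E \<or> dd V (median V x y z) (median W x y z) \<le> 3 * E"
proof -
  have D: "V \<in> D" "W \<in> D" using sub_dom VW by auto
  note rX = r_carrier[OF proper_shadows[OF VW]]
  note m = medianD[OF D(2) X]
  let ?m = "median W x y z"
  have split: "dd V a ?m \<le> E \<or> dd W a (r V W) + dd W (r V W) ?m \<le> dd W a ?m + E" if "a \<in> X" for a
    by (rule bounded_image[OF VW that m(1)])
  have two: "dd W ?m (r V W) \<le> 3 * E"
    if ab: "a \<in> X" "b \<in> X" "dd W a ?m + dd W ?m b \<le> dd W a b + E"
      and "dd W a (r V W) + dd W (r V W) ?m \<le> dd W a ?m + E"
      and "dd W b (r V W) + dd W (r V W) ?m \<le> dd W b ?m + E" for a b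
    using that dd_tri3[OF D(2) ab(1) ab(2) rX] dd_commute[OF D(2), of ?m] E_ge by smt
  show ?thesis
    using split[OF X(1)] split[OF X(2)] split[OF X(3)] two[OF X(1,2) m(2)] two[OF X(1,3) m(3)] two[OF X(2,3) m(4)]
      median_near[OF D(1) X m(1), of E] by argo
qed

definition slide :: "'w \<Rightarrow> 'x \<Rightarrow> 'x \<Rightarrow> 'x \<Rightarrow> 'w \<Rightarrow> 'x" where
  "slide U x y z V = (if V \<bottom>\<bottom> U then x else median V x y z)"

text \<open>The median in \<open>W\<close> follows \<open>z\<close> to the shadow of
  \<open>U\<close> as soon as that shadow lies between \<open>x\<close> and \<open>y\<close>. For
  nested \<open>U\<close> this is \<open>bounded_image\<close>. For transverse \<open>U\<close>, one
  of \<open>x\<close> and \<open>y\<close> is away from \<open>r W U\<close> in \<open>U\<close>, as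
  they are more than \<open>2 * E\<close> apart there, and is therefore near \<open>r U W\<close> in
  \<open>W\<close>, like \<open>z\<close>.\<close>

lemma slide_shadow:
  assumes X: "x \<in> X" "y \<in> X" "z \<in> X" and long: "dd U x y > 2 * E" and UW: "U \<leadsto> W"
    and z: "dd W z (r U W) \<le> E"
  shows "dd W (median W x y z) (r U W) \<le> 4 * E"
proof -
  have D: "U \<in> D" "W \<in> D" using shadows_dom UW by auto
  note rX = r_carrier[OF UW]
  from UW show ?thesis
  proof (cases rule: shadows_cases)
    case 1
    have "dd W x (r U W) + dd W (r U W) y \<le> dd W x y + E"
      using bounded_image[OF 1 X(1,2)] long E_ge by auto
    then show ?thesis using median_of_between[OF D(2) X rX _ z] E_ge by fastforce
  next
    case 2
    have "dd U x (r W U) > E \<or> dd U y (r W U) > E"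
      using dd_tri3[OF D(1) X(1) X(2) r_carrier[OF transvD(4)[OF 2]]] long by linarith
    then have "dd W x (r U W) \<le> E \<or> dd W y (r U W) \<le> E"
      using consistent_transv[OF 2 X(1)] consistent_transv[OF 2 X(2)] by linarith
    then show ?thesis using median_near[OF D(2) X rX, of E] z E_ge by fastforce
  qed
qed

text \<open>Pairs of two frozen or of two median coordinates are consistent because \<open>x\<close>
  and medians are. If \<open>V\<close> is orthogonal to \<open>U\<close>, and \<open>W\<close> is
  not but is shadowed by \<open>V\<close>, then \<open>U\<close> shadows \<open>W\<close> too; both
  shadows in \<open>W\<close> are \<open>2 * E\<close>-close by orthogonality, and the median in
  \<open>W\<close> is near that of \<open>U\<close>.\<close>

lemma slide_consistent:
  assumes X: "x \<in> X" "y \<in> X" "z \<in> X" and UD: "U \<in> D" and long: "dd U x y > 2 * E"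
    and z: "\<And>W. U \<leadsto> W \<Longrightarrow> dd W z (r U W) \<le> E"
  shows "consistent_tuple (6 * E) (slide U x y z)"
proof -
  have mixed: "dd W (slide U x y z W) (r V W) \<le> 6 * E"
    if V: "V \<bottom>\<bottom> U" and W: "\<not> W \<bottom>\<bottom> U" and VW: "V \<leadsto> W" for V W
  proof -
    have D: "V \<in> D" "W \<in> D" using shadows_dom VW by auto
    have "\<not> W \<preceq> U"
    proof
      assume "W \<preceq> U"
      then have "W \<bottom>\<bottom> V" using V ort_sub ort_sym by blast
      then show False using VW ort_sym by (auto simp: shadows_def)
    qed
    then have UW: "U \<leadsto> W" using W UD D ort_sym by (auto simp: shadows_def)
    show ?thesis
      using slide_shadow[OF X long UW z[OF UW]] r_orthogonal[OF V VW UW] W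
        dd_tri3[OF D(2) medianD(1)[OF D(2) X] r_carrier[OF VW] r_carrier[OF UW]]
      by (simp add: slide_def)
  qed
  show ?thesis
    unfolding consistent_tuple_def
  proof (intro conjI ballI allI impI)
    fix V assume "V \<in> D"
    then show "slide U x y z V \<in> X" using X medianD(1)[of V x y z] by (simp add: slide_def)
  next
    fix V W assume VW: "V \<sqinter> W"
    consider "V \<bottom>\<bottom> U" "W \<bottom>\<bottom> U" | "V \<bottom>\<bottom> U" "\<not> W \<bottom>\<bottom> U" | "\<not> V \<bottom>\<bottom> U" "W \<bottom>\<bottom> U" | "\<not> V \<bottom>\<bottom> U" "\<not> W \<bottom>\<bottom> U"
      by blast
    then show "dd W (slide U x y z W) (r V W) \<le> 6 * E \<or> dd V (slide U x y z V) (r W V) \<le> 6 * E"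
    proof cases
      case 1
      then show ?thesis using consistent_transv[OF VW X(1)] E_ge by (auto simp: slide_def)
    next
      case 4
      then show ?thesis using median_consistent_transv[OF VW X] E_ge by (auto simp: slide_def)
    qed (use mixed[of V W] mixed[of W V] transvD(3,4)[OF VW] in blast)+
  next
    fix V W assume VW: "V \<preceq> W \<and> V \<noteq> W"
    then have D: "V \<in> D" using sub_dom by blast
    consider "W \<bottom>\<bottom> U" "V \<bottom>\<bottom> U" | "V \<bottom>\<bottom> U" "\<not> W \<bottom>\<bottom> U" | "\<not> V \<bottom>\<bottom> U" "\<not> W \<bottom>\<bottom> U"
      using VW ort_sub by blast
    then show "dd W (slide U x y z W) (r V W) \<le> 6 * E \<or> dd V (slide U x y z V) (slide U x y z W) \<le> 6 * E"
    proof cases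
      case 1
      then show ?thesis using dd_self[OF D X(1)] E_ge by (auto simp: slide_def)
    next
      case 2
      then show ?thesis using mixed[of V W] proper_shadows VW by blast
    next
      case 3
      then show ?thesis using median_consistent_nested[of V W, OF _ _ X] VW E_ge by (auto simp: slide_def)
    qed
  qed
qed

text \<open>The tuple \<open>slide\<close> of a point lying over \<open>q\<close> is realised. The
  slack \<open>4 * E\<close> is what points on the coarse geodesics of \<open>ex_geodesic\<close>
  need.\<close>

proposition interpolation:
  obtains \<theta> where "\<theta> \<ge> 0"
    "\<And>x y q U. \<lbrakk>x \<in> X; y \<in> X; q \<in> X; U \<in> D; dd U x y > 2 * E; dd U x q + dd U q y \<le> dd U x y + 4 * E\<rbrakk> \<Longrightarrow>
      \<exists>z\<in>X. dd U z q \<le> \<theta> \<and> (\<forall>V. V \<bottom>\<bottom> U \<longrightarrow> dd V x z \<le> \<theta>) \<and>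
        (\<forall>V\<in>D. dd V x z \<le> dd V x y + \<theta>)"
proof -
  \<comment> \<open>No coordinate of the tuple is more than \<open>dd V x y + E\<close> from
    \<open>x\<close>, so with \<open>17 * E\<close> it is discrepant at \<open>x\<close> only in
    domains where \<open>dd V x y\<close> is at least \<open>16 * E\<close>; these are finitely
    many.\<close>
  obtain \<theta> where \<theta>: "\<And>\<beta> x0. \<lbrakk>consistent_tuple (17 * E) \<beta>; x0 \<in> X; finite (discrepant (17 * E) \<beta> x0)\<rbrakk>
    \<Longrightarrow> \<exists>z\<in>X. \<forall>V\<in>D. dd V z (\<beta> V) \<le> \<theta>"
    using realization[of "17 * E"] E_ge by auto
  show thesis
  proof (rule that[of "\<bar>\<theta>\<bar> + 6 * E"])
    fix x y q U assume X: "x \<in> X" "y \<in> X" "q \<in> X" and UD: "U \<in> D" and long: "dd U x y > 2 * E"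
      and btw: "dd U x q + dd U q y \<le> dd U x y + 4 * E"
    obtain z where z: "z \<in> X" "dd U z q \<le> E" "\<And>W. U \<leadsto> W \<Longrightarrow> dd W z (r U W) \<le> E"
      by (rule realize_single[OF UD X(3)]) (rule that)
    define \<beta> where "\<beta> = slide U x y z"
    have "consistent_tuple (6 * E) \<beta>"
      unfolding \<beta>_def by (rule slide_consistent[OF X(1,2) z(1) UD long z(3)])
    then have cons: "consistent_tuple (17 * E) \<beta>"
      by (rule consistent_tuple_mono) (use E_ge in auto)
    note \<beta>X = consistent_tupleD(1)[OF cons]
    have le: "dd V x (\<beta> V) \<le> dd V x y + E" if "V \<in> D" for V
      using medianD(2)[OF that X(1,2) z(1)] dd_nonneg[OF that, of "median V x y z" y] dd_self[OF that X(1)]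
        dd_nonneg[OF that, of x y] E_ge unfolding \<beta>_def slide_def by auto
    have "finite (discrepant (17 * E) \<beta> x)"
      by (rule finite_subset[OF _ finite_relevant[OF X(1,2) order_refl]])
        (use le in \<open>fastforce simp: discrepant_def relevant_def\<close>)
    then obtain w where w: "w \<in> X" "\<And>V. V \<in> D \<Longrightarrow> dd V w (\<beta> V) \<le> \<theta>"
      using \<theta>[OF cons X(1)] by blast
    have "\<beta> U = median U x y z" using ort_irrefl by (simp add: \<beta>_def slide_def)
    then have "dd U (\<beta> U) q \<le> 5 * E"
      using median_of_between[OF UD X(1,2) z(1) X(3) btw z(2)] E_ge by simp
    then have "dd U w q \<le> \<bar>\<theta>\<bar> + 6 * E"
      using w(2)[OF UD] dd_tri3(1)[OF UD w(1) \<beta>X[OF UD] X(3)] E_ge by linarith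
    moreover have "dd V x w \<le> \<bar>\<theta>\<bar> + 6 * E" if "V \<bottom>\<bottom> U" for V
    proof -
      have "V \<in> D" using ort_dom that by blast
      then show ?thesis
        using w(2)[of V] that dd_commute[of V x w] E_ge by (simp add: \<beta>_def slide_def)
    qed
    moreover have "dd V x w \<le> dd V x y + (\<bar>\<theta>\<bar> + 6 * E)" if "V \<in> D" for V
      using le[OF that] w(2)[OF that] dd_tri3(2)[OF that X(1) w(1) \<beta>X[OF that]] E_ge by linarith
    ultimately show "\<exists>z\<in>X. dd U z q \<le> \<bar>\<theta>\<bar> + 6 * E \<and> (\<forall>V. V \<bottom>\<bottom> U \<longrightarrow> dd V x z \<le> \<bar>\<theta>\<bar> + 6 * E) \<and>
        (\<forall>V\<in>D. dd V x z \<le> dd V x y + (\<bar>\<theta>\<bar> + 6 * E))"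
      using w(1) by blast
  qed (use E_ge in auto)
qed


end


subsection \<open>Subdivision along a domain of highest level\<close>

lemma card_le_of_spread:
  fixes S :: "nat set"
  assumes "finite S" and close: "\<And>i j. \<lbrakk>i \<in> S; j \<in> S\<rbrakk> \<Longrightarrow> \<bar>real i - real j\<bar> \<le> R"
  shows "card S \<le> nat \<lfloor>R\<rfloor> + 1"
proof (cases "S = {}")
  case False
  define a where "a = Min S"
  have a: "a \<in> S" "\<And>i. i \<in> S \<Longrightarrow> a \<le> i" using assms(1) False by (auto simp: a_def)
  have "S \<subseteq> {a..a + nat \<lfloor>R\<rfloor>}"
  proof
    fix i assume i: "i \<in> S"
    then have "real (i - a) \<le> R" using close[OF i a(1)] a(2)[OF i] by (simp add: of_nat_diff)
    then have "i - a \<le> nat \<lfloor>R\<rfloor>" by (simp add: le_nat_floor)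
    then show "i \<in> {a..a + nat \<lfloor>R\<rfloor>}" using a(2)[OF i] by auto
  qed
  then have "card S \<le> card {a..a + nat \<lfloor>R\<rfloor>}" by (intro card_mono) auto
  then show ?thesis by simp
qed simp

context coordinate_system
begin

text \<open>Descend from the top domain. A relevant domain has no other relevant domain of the
  highest level below it. Below an irrelevant \<open>W\<close>, large links with bound
  \<open>s\<close> covers the relevant domains by at most \<open>N\<close> domains of smaller level,
  so the count is at most a power of \<open>Suc N\<close>. Below a relevant domain large links gives
  no bound independent of \<open>x\<close> and \<open>y\<close>, whence the restriction to the
  highest level.\<close>

lemma card_top_level:
  assumes s: "s \<ge> 16 * E"
  obtains m :: nat where "\<And>x y k. \<lbrakk>x \<in> X; y \<in> X; \<forall>V\<in>relevant s x y. lev V \<le> k\<rbrakk>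
    \<Longrightarrow> card {V \<in> relevant s x y. lev V = k} \<le> m"
proof -
  obtain N :: nat where N: "\<forall>W\<in>D. \<forall>x\<in>X. \<forall>y\<in>X. dd W x y \<le> s \<longrightarrow>
        (\<exists>\<T>. finite \<T> \<and> card \<T> \<le> N \<and> (\<forall>T\<in>\<T>. T \<preceq> W \<and> T \<noteq> W) \<and>
           (\<forall>V\<in>D. V \<preceq> W \<and> V \<noteq> W \<and> dd V x y \<ge> E \<longrightarrow> (\<exists>T\<in>\<T>. V \<preceq> T)))"
    using large_links[of s] ..
  show thesis
  proof (rule that[of "Suc N ^ Suc n"])
    fix x y k assume X: "x \<in> X" "y \<in> X" and top: "\<forall>V\<in>relevant s x y. lev V \<le> k"
    define A where "A W = {V \<in> relevant s x y. lev V = k \<and> V \<preceq> W}" for W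
    have finA: "finite (A W)" for W using finite_relevant[OF X s] by (simp add: A_def)
    have A: "card (A W) \<le> Suc N ^ j" if "W \<in> D" "lev W < j" for W j
      using that
    proof (induction j arbitrary: W)
      case (Suc j)
      show ?case
      proof (cases "W \<in> relevant s x y")
        case True
        then have "A W \<subseteq> {W}" using bspec[OF top True] lev_less[of _ W] by (fastforce simp: A_def)
        then have "card (A W) \<le> card {W}" by (intro card_mono) auto
        also have "\<dots> \<le> Suc N ^ Suc j" using one_le_power[of "Suc N" "Suc j"] by (simp del: power_Suc)
        finally show ?thesis .
      next
        case False
        then have "dd W x y \<le> s" using Suc.prems by (auto simp: relevant_def)
        from N[rule_format, OF Suc.prems(1) X this] obtain \<T> where T: "finite \<T>" "card \<T> \<le> N"
          "\<And>T. T \<in> \<T> \<Longrightarrow> T \<preceq> W \<and> T \<noteq> W"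
          "\<And>V. \<lbrakk>V \<in> D; V \<preceq> W; V \<noteq> W; dd V x y \<ge> E\<rbrakk> \<Longrightarrow> \<exists>T\<in>\<T>. V \<preceq> T" by blast
        have "A W \<subseteq> (\<Union>T\<in>\<T>. A T)"
        proof
          fix V assume V: "V \<in> A W"
          then have "V \<in> D" "V \<preceq> W" "V \<noteq> W" "dd V x y \<ge> E"
            using False s E_ge by (auto simp: A_def relevant_def)
          then show "V \<in> (\<Union>T\<in>\<T>. A T)" using T(4) V by (fastforce simp: A_def)
        qed
        then have "card (A W) \<le> card (\<Union>T\<in>\<T>. A T)" using T(1) finA by (intro card_mono) auto
        also have "\<dots> \<le> (\<Sum>T\<in>\<T>. card (A T))" by (rule card_UN_le[OF T(1)])
        also have "\<dots> \<le> (\<Sum>T\<in>\<T>. Suc N ^ j)"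
        proof (rule sum_mono)
          fix T assume "T \<in> \<T>"
          then have "T \<preceq> W" "T \<noteq> W" using T(3) by auto
          then show "card (A T) \<le> Suc N ^ j"
            using Suc.IH[of T] Suc.prems lev_less[of T W] sub_dom by force
        qed
        also have "\<dots> = card \<T> * Suc N ^ j" by simp
        also have "\<dots> \<le> Suc N * Suc N ^ j" using T(2) by (intro mult_right_mono) auto
        finally show ?thesis by simp
      qed
    qed simp
    show "card {V \<in> relevant s x y. lev V = k} \<le> Suc N ^ Suc n"
    proof (cases "D = {}")
      case True
      then have "{V \<in> relevant s x y. lev V = k} = {}" unfolding relevant_def by blast
      then show ?thesis by (simp only: card.empty le0)
    next
      case False
      then obtain T where T: "T \<in> D" "\<And>V. V \<in> D \<Longrightarrow> V \<preceq> T" using ex_top by blast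
      then have "{V \<in> relevant s x y. lev V = k} = A T" by (auto simp: A_def relevant_def)
      then show ?thesis using A[OF T(1), of "Suc n"] lev_le[OF T(1)] by simp
    qed
  qed
qed

proposition subdivision:
  obtains \<theta> :: real and B :: nat where "\<theta> \<ge> 0"
    "\<And>x y U. \<lbrakk>x \<in> X; y \<in> X; U \<in> D; dd U x y > 2 * E\<rbrakk> \<Longrightarrow> \<exists>w N. w 0 = x \<and> w (Suc N) = y \<and>
       (\<forall>i\<le>Suc N. w i \<in> X) \<and> real N \<le> dd U x y \<and>
       (\<forall>i\<le>N. dd U (w i) (w (Suc i)) \<le> \<theta>) \<and>
       (\<forall>i\<le>N. \<forall>V\<in>D. dd V (w i) (w (Suc i)) \<le> 2 * dd V x y + \<theta>) \<and>
       (\<forall>V\<in>D. (U \<preceq> V \<longrightarrow> U = V) \<longrightarrow> card {i. i \<le> N \<and> dd V (w i) (w (Suc i)) > \<theta>} \<le> B)"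
proof -
  obtain t where t: "t \<ge> 0" and interpolate:
    "\<And>x y q U. \<lbrakk>x \<in> X; y \<in> X; q \<in> X; U \<in> D; dd U x y > 2 * E; dd U x q + dd U q y \<le> dd U x y + 4 * E\<rbrakk> \<Longrightarrow>
      \<exists>z\<in>X. dd U z q \<le> t \<and> (\<forall>V. V \<bottom>\<bottom> U \<longrightarrow> dd V x z \<le> t) \<and> (\<forall>V\<in>D. dd V x z \<le> dd V x y + t)"
    using interpolation by blast
  \<comment> \<open>Two distances \<open>t + E\<close> from points \<open>w i\<close> to the
    geodesic and \<open>1 + E\<close> for a unit step along it.\<close>
  define \<theta> where "\<theta> = 2 * t + 4 * E"
  show thesis
  proof (rule that[of \<theta> "nat \<lfloor>4 * \<theta>\<rfloor> + 1"])
    fix x y U assume X: "x \<in> X" "y \<in> X" and UD: "U \<in> D" and long: "dd U x y > 2 * E"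
    define L where "L = dd U x y"
    define N where "N = nat \<lfloor>L\<rfloor>"
    have L: "L > 2" using long E_ge by (simp add: L_def)
    have NL: "real N \<le> L" "L \<le> real N + 1" "0 < N" using L unfolding N_def by linarith+
    have mem: "real i \<in> {0..L}" if "i \<le> N" for i using that NL by simp
    have LL: "L \<in> {0..L}" "0 \<in> {0..L}" using L by auto
    obtain g where g: "\<And>s. s \<in> {0..L} \<Longrightarrow> g s \<in> X"
      "\<And>s u. \<lbrakk>s \<in> {0..L}; u \<in> {0..L}\<rbrakk> \<Longrightarrow> \<bar>dd U (g s) (g u) - \<bar>s - u\<bar>\<bar> \<le> E"
      "dd U x (g 0) \<le> E" "dd U (g L) y \<le> E"
      using ex_geodesic[OF UD X] unfolding L_def by metis
    have "\<exists>z\<in>X. dd U z (g i) \<le> t \<and> (\<forall>V. V \<bottom>\<bottom> U \<longrightarrow> dd V x z \<le> t) \<and> (\<forall>V\<in>D. dd V x z \<le> dd V x y + t)"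
      if i: "i \<le> N" for i :: nat
    proof (rule interpolate[OF X g(1)[OF mem[OF i]] UD long])
      show "dd U x (g i) + dd U (g i) y \<le> dd U x y + 4 * E"
        using g(2)[OF LL(2) mem[OF i]] g(2)[OF mem[OF i] LL(1)] g(3,4) mem[OF i]
          dd_tri3(1)[OF UD X(1) g(1)[OF LL(2)] g(1)[OF mem[OF i]]]
          dd_tri3(1)[OF UD g(1)[OF mem[OF i]] g(1)[OF LL(1)] X(2)]
        unfolding L_def[symmetric] atLeastAtMost_iff by linarith
    qed
    then obtain z where z: "\<And>i. i \<le> N \<Longrightarrow> z i \<in> X" "\<And>i. i \<le> N \<Longrightarrow> dd U (z i) (g i) \<le> t"
      "\<And>i V. i \<le> N \<Longrightarrow> V \<bottom>\<bottom> U \<Longrightarrow> dd V x (z i) \<le> t"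
      "\<And>i V. i \<le> N \<Longrightarrow> V \<in> D \<Longrightarrow> dd V x (z i) \<le> dd V x y + t" by metis
    \<comment> \<open>\<open>z 0\<close> is only known to project near \<open>x\<close> in
      \<open>U\<close>, so it is replaced by \<open>x\<close>. The step from \<open>z N\<close> to
      \<open>y\<close> is still short in \<open>U\<close>, as \<open>N\<close> is the integer part
      of \<open>L\<close>.\<close>
    define w where "w i = (if i = 0 then x else if i \<le> N then z i else y)" for i
    have w0: "w 0 = x" "w (Suc N) = y" by (auto simp: w_def)
    have wX: "w i \<in> X" for i using z(1) X by (auto simp: w_def)
    have wg: "dd U (w i) (g i) \<le> t + E" if "i \<le> N" for i
      using z(2)[OF that] g(3) t E_ge that by (auto simp: w_def)
    have wort: "dd V x (w i) \<le> t" if "V \<bottom>\<bottom> U" "i \<le> N" for V i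
      using z(3)[OF that(2) that(1)] dd_self[of V x] X ort_dom[OF that(1)] t that(2) by (auto simp: w_def)
    have wle: "dd V x (w i) \<le> dd V x y + t" if "V \<in> D" for V i
      using z(4)[OF _ that] dd_self[OF that X(1)] dd_nonneg[OF that, of x y] t by (auto simp: w_def)
    have gap: "dd U (w i) (w (Suc i)) \<le> \<theta>" if i: "i \<le> N" for i
    proof (cases "i = N")
      case True
      have "dd U (w i) y \<le> dd U (w i) (g i) + dd U (g i) y"
        using dd_tri3(1)[OF UD wX g(1)[OF mem[OF i]] X(2)] .
      moreover have "dd U (g i) y \<le> dd U (g i) (g L) + dd U (g L) y"
        using dd_tri3(1)[OF UD g(1)[OF mem[OF i]] g(1)[OF LL(1)] X(2)] .
      ultimately show ?thesis
        using g(2)[OF mem[OF i] LL(1)] g(4) wg[OF i] NL True w0 t E_ge unfolding \<theta>_def by simp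
    next
      case False
      then have Si: "Suc i \<le> N" using i by simp
      show ?thesis
        using g(2)[OF mem[OF i] mem[OF Si]] wg[OF i] wg[OF Si] E_ge t
          dd_tri3(1)[OF UD wX[of i] g(1)[OF mem[OF i]] g(1)[OF mem[OF Si]]]
          dd_tri3(2)[OF UD wX[of i] wX[of "Suc i"] g(1)[OF mem[OF Si]]]
        unfolding \<theta>_def by simp
    qed
    have step: "dd V (w i) (w (Suc i)) \<le> 2 * dd V x y + \<theta>" if V: "V \<in> D" for V i
      using wle[OF V, of i] wle[OF V, of "Suc i"] dd_tri3(3)[OF V X(1) wX[of i] wX[of "Suc i"]] E_ge
      unfolding \<theta>_def by linarith
    have count: "card {i. i \<le> N \<and> dd V (w i) (w (Suc i)) > \<theta>} \<le> nat \<lfloor>4 * \<theta>\<rfloor> + 1" (is "card ?S \<le> _")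
      if V: "V \<in> D" and UV: "U \<preceq> V \<longrightarrow> U = V" for V
      using V UD
    proof (cases rule: dom_cases)
      case 1
      \<comment> \<open>Up to index \<open>N\<close> the coordinates orthogonal to \<open>U\<close>
        stay within \<open>t\<close> of those of \<open>x\<close>; only the step to \<open>y\<close>
        can be long.\<close>
      have "?S \<subseteq> {N}"
      proof
        fix i assume i: "i \<in> ?S"
        have "\<not> Suc i \<le> N"
        proof
          assume Si: "Suc i \<le> N"
          show False
            using i wort[OF 1, of i] wort[OF 1 Si] dd_tri3(3)[OF V X(1) wX[of i] wX[of "Suc i"]] E_ge t Si
            unfolding \<theta>_def by simp
        qed
        then show "i \<in> {N}" using i by simp
      qed
      then have "card ?S \<le> card {N}" by (intro card_mono) auto
      then show ?thesis by simp
    next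
      case 2
      then have "?S = {}" using gap by fastforce
      then show ?thesis by (simp only: card.empty)
    next
      case 3
      then show ?thesis using UV by simp
    next
      case 4
      note rX = r_carrier[OF 4]
      have near: "dd U (w i) (r V U) \<le> \<theta> + E" if "i \<in> ?S" for i
      proof -
        have i: "i \<le> N" and big: "dd V (w i) (w (Suc i)) > 2 * E" using that E_ge t by (auto simp: \<theta>_def)
        from 4 show ?thesis
        proof (cases rule: shadows_cases)
          case 1
          then show ?thesis
            using bounded_image[OF 1 wX[of i] wX[of "Suc i"]] big E_ge gap[OF i] dd_nonneg[OF UD, of "r V U" "w (Suc i)"]
            by linarith
        next
          case 2
          have "dd V (w i) (r U V) > E \<or> dd V (w (Suc i)) (r U V) > E"
            using dd_tri3[OF V wX[of i] wX[of "Suc i"] r_carrier[OF transvD(4)[OF 2]]] big by linarith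
          then have "dd U (w i) (r V U) \<le> E \<or> dd U (w (Suc i)) (r V U) \<le> E"
            using consistent_transv[OF 2 wX[of i]] consistent_transv[OF 2 wX[of "Suc i"]] by linarith
          then show ?thesis
            using gap[OF i] dd_tri3[OF UD wX[of i] wX[of "Suc i"] rX] E_ge t unfolding \<theta>_def by linarith
        qed
      qed
      show ?thesis
      proof (rule card_le_of_spread)
        fix i j assume ij: "i \<in> ?S" "j \<in> ?S"
        then have le: "i \<le> N" "j \<le> N" by auto
        have "dd U (g i) (g j) \<le> 4 * \<theta> - E"
          using near[OF ij(1)] near[OF ij(2)] wg[OF le(1)] wg[OF le(2)]
            dd_tri3(3)[OF UD wX[of i] g(1)[OF mem[OF le(1)]] g(1)[OF mem[OF le(2)]]]
            dd_tri3(1)[OF UD wX[of i] wX[of j] g(1)[OF mem[OF le(2)]]]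
            dd_tri3(2)[OF UD wX[of i] wX[of j] rX] E_ge t
          unfolding \<theta>_def by argo
        then show "\<bar>real i - real j\<bar> \<le> 4 * \<theta>"
          using g(2)[OF mem[OF le(1)] mem[OF le(2)]] unfolding abs_le_iff by linarith
      qed simp
    qed
    show "\<exists>w N. w 0 = x \<and> w (Suc N) = y \<and>
       (\<forall>i\<le>Suc N. w i \<in> X) \<and> real N \<le> dd U x y \<and>
       (\<forall>i\<le>N. dd U (w i) (w (Suc i)) \<le> \<theta>) \<and>
       (\<forall>i\<le>N. \<forall>V\<in>D. dd V (w i) (w (Suc i)) \<le> 2 * dd V x y + \<theta>) \<and>
       (\<forall>V\<in>D. (U \<preceq> V \<longrightarrow> U = V) \<longrightarrow>
          card {i. i \<le> N \<and> dd V (w i) (w (Suc i)) > \<theta>} \<le> nat \<lfloor>4 * \<theta>\<rfloor> + 1)"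
      by (rule exI[of _ w], rule exI[of _ N]) (use w0 wX NL gap step count in \<open>auto simp: L_def\<close>)
  qed (use t E_ge in \<open>simp add: \<theta>_def\<close>)
qed

section \<open>Bounding the distance: induction on the highest level and its number of relevant
  domains\<close>

definition total :: "real \<Rightarrow> 'x \<Rightarrow> 'x \<Rightarrow> real" where
  "total s x y = (\<Sum>V\<in>relevant s x y. dd V x y)"

lemma total_nonneg: "total s x y \<ge> 0"
  unfolding total_def by (rule sum_nonneg) (auto simp: relevant_def dd_nonneg)

lemma le_total:
  assumes "x \<in> X" "y \<in> X" "s \<ge> 16 * E" "V \<in> relevant s x y"
  shows "dd V x y \<le> total s x y"
  unfolding total_def
  by (rule member_le_sum[OF assms(4) _ finite_relevant[OF assms(1-3)]]) (auto simp: relevant_def dd_nonneg)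

lemma d_path:
  assumes "\<And>i. i \<le> Suc N \<Longrightarrow> w i \<in> X"
  shows "d (w 0) (w (Suc N)) \<le> (\<Sum>i\<le>N. d (w i) (w (Suc i)))"
  using assms
proof (induction N)
  case (Suc N)
  have "d (w 0) (w (Suc (Suc N))) \<le> d (w 0) (w (Suc N)) + d (w (Suc N)) (w (Suc (Suc N)))"
    by (rule d_triangle) (use Suc.prems in auto)
  also have "d (w 0) (w (Suc N)) \<le> (\<Sum>i\<le>N. d (w i) (w (Suc i)))"
    by (rule Suc.IH) (use Suc.prems in auto)
  finally show ?case by simp
qed simp

text \<open>Exchange the sums. From \<open>2 * dd V x y + \<theta> \<ge> s'\<close> and
  \<open>s' \<ge> 2 * s + 3 * \<theta>\<close>, a domain that contributes to some step has
  \<open>dd V x y \<ge> s + \<theta>\<close>; so it is relevant for the ends, each contribution is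
  at most \<open>3 * dd V x y\<close>, and there are at most \<open>B\<close> of them.\<close>

lemma sum_total_subdivision:
  assumes X: "x \<in> X" "y \<in> X" and wX: "\<And>i. i \<le> Suc N \<Longrightarrow> w i \<in> X" and s: "s \<ge> 16 * E" and \<theta>: "\<theta> \<ge> 0"
    and s': "s' \<ge> 2 * s + 3 * \<theta>"
    and step: "\<And>i V. \<lbrakk>i \<le> N; V \<in> D\<rbrakk> \<Longrightarrow> dd V (w i) (w (Suc i)) \<le> 2 * dd V x y + \<theta>"
    and count: "\<And>i V. \<lbrakk>V \<in> D; i \<le> N; dd V (w i) (w (Suc i)) \<ge> s'\<rbrakk>
        \<Longrightarrow> card {i. i \<le> N \<and> dd V (w i) (w (Suc i)) > \<theta>} \<le> B"
  shows "(\<Sum>i\<le>N. total s' (w i) (w (Suc i))) \<le> 3 * real B * total s x y"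
proof -
  define F where "F = relevant s x y"
  have F: "finite F" unfolding F_def by (rule finite_relevant[OF X s])
  let ?f = "\<lambda>V i. dd V (w i) (w (Suc i))"
  have big: "dd V x y \<ge> s + \<theta>" if "i \<le> N" "V \<in> D" "?f V i \<ge> s'" for i V
    using step[OF that(1,2)] that(3) s' by linarith
  have "total s' (w i) (w (Suc i)) = (\<Sum>V\<in>F. if s' \<le> ?f V i then ?f V i else 0)" if i: "i \<le> N" for i
  proof -
    have "relevant s' (w i) (w (Suc i)) = {V \<in> F. s' \<le> ?f V i}"
      using big[OF i] \<theta> by (force simp: F_def relevant_def)
    then show ?thesis by (simp add: total_def sum.inter_filter[OF F])
  qed
  then have "(\<Sum>i\<le>N. total s' (w i) (w (Suc i))) = (\<Sum>i\<le>N. \<Sum>V\<in>F. if s' \<le> ?f V i then ?f V i else 0)"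
    by (intro sum.cong) auto
  also have "\<dots> = (\<Sum>V\<in>F. \<Sum>i\<le>N. if s' \<le> ?f V i then ?f V i else 0)" by (rule sum.swap)
  also have "\<dots> \<le> (\<Sum>V\<in>F. 3 * real B * dd V x y)"
  proof (rule sum_mono)
    fix V assume "V \<in> F"
    then have V: "V \<in> D" by (simp add: F_def relevant_def)
    let ?I = "{i. i \<le> N \<and> s' \<le> ?f V i}"
    have nonneg: "dd V x y \<ge> 0" by (rule dd_nonneg[OF V])
    have "(\<Sum>i\<le>N. if s' \<le> ?f V i then ?f V i else 0) = (\<Sum>i\<in>?I. ?f V i)"
      by (simp flip: sum.inter_filter)
    also have "\<dots> \<le> (\<Sum>i\<in>?I. 3 * dd V x y)"
    proof (rule sum_mono)
      fix i assume "i \<in> ?I"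
      then show "?f V i \<le> 3 * dd V x y" using step[of i V] big[of i V] V s E_ge by fastforce
    qed
    also have "\<dots> = 3 * card ?I * dd V x y" by simp
    finally have sum_le: "(\<Sum>i\<le>N. if s' \<le> ?f V i then ?f V i else 0) \<le> 3 * card ?I * dd V x y" .
    have "card ?I \<le> B"
    proof (cases "?I = {}")
      case False
      then obtain i where "i \<le> N" "s' \<le> ?f V i" by blast
      then have "card {i. i \<le> N \<and> ?f V i > \<theta>} \<le> B" using count V by blast
      moreover have "card ?I \<le> card {i. i \<le> N \<and> ?f V i > \<theta>}"
        by (rule card_mono) (use s' s \<theta> E_ge in auto)
      ultimately show ?thesis by linarith
    qed (simp only: card.empty le0)
    then have "3 * card ?I * dd V x y \<le> 3 * real B * dd V x y"
      using nonneg by (intro mult_right_mono) auto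
    with sum_le show "(\<Sum>i\<le>N. if s' \<le> ?f V i then ?f V i else 0) \<le> 3 * real B * dd V x y" by linarith
  qed
  also have "\<dots> = 3 * real B * total s x y" by (simp add: total_def F_def sum_distrib_left)
  finally show ?thesis .
qed

text \<open>\<open>\<rho>\<close> is the threshold at which domains are counted, \<open>s\<close>
  the one of the sum. They differ because a round raises the first, while the sum must return to the
  threshold it started with; both are universally quantified since a round uses the statement at
  other thresholds.\<close>

definition bounded_above_level :: "nat \<Rightarrow> nat \<Rightarrow> bool" where
  "bounded_above_level k m \<longleftrightarrow> (\<forall>\<rho>\<ge>16 * E. \<forall>s\<ge>16 * E. \<exists>K\<ge>0. \<exists>C\<ge>0. \<forall>x\<in>X. \<forall>y\<in>X.
     (\<forall>V\<in>relevant \<rho> x y. lev V \<le> k) \<and> card {V \<in> relevant \<rho> x y. lev V = k} \<le> m \<longrightarrow>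
     d x y \<le> K * total s x y + C)"

text \<open>Subdividing along a relevant \<open>U\<close> of level \<open>k\<close> gives steps for
  which \<open>U\<close> is irrelevant and no new domain of level \<open>k\<close> becomes relevant,
  so the induction hypothesis applies to each. The additive constants of the \<open>N + 1\<close>
  steps are absorbed because \<open>N\<close> is at most \<open>dd U x y\<close>, a term of the
  sum.\<close>

lemma bounded_above_level_Suc_card:
  assumes IH: "bounded_above_level k m"
  shows "bounded_above_level k (Suc m)"
  unfolding bounded_above_level_def
proof (intro allI impI)
  fix \<rho> s assume \<rho>: "\<rho> \<ge> 16 * E" and s: "s \<ge> 16 * E"
  obtain \<theta> :: real and B :: nat where \<theta>: "\<theta> \<ge> 0" and subdivide:
    "\<And>x y U. \<lbrakk>x \<in> X; y \<in> X; U \<in> D; dd U x y > 2 * E\<rbrakk> \<Longrightarrow> \<exists>w N. w 0 = x \<and> w (Suc N) = y \<and>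
       (\<forall>i\<le>Suc N. w i \<in> X) \<and> real N \<le> dd U x y \<and>
       (\<forall>i\<le>N. dd U (w i) (w (Suc i)) \<le> \<theta>) \<and>
       (\<forall>i\<le>N. \<forall>V\<in>D. dd V (w i) (w (Suc i)) \<le> 2 * dd V x y + \<theta>) \<and>
       (\<forall>V\<in>D. (U \<preceq> V \<longrightarrow> U = V) \<longrightarrow> card {i. i \<le> N \<and> dd V (w i) (w (Suc i)) > \<theta>} \<le> B)"
    by (rule subdivision) (rule that)
  \<comment> \<open>A domain relevant at \<open>\<tau>\<close> is a term of the sum at
    \<open>s\<close> and obeys the bound on levels at \<open>\<rho>\<close>.\<close>
  define \<tau> where "\<tau> = max \<rho> s"
  \<comment> \<open>A domain relevant at \<open>s'\<close> for some step is then relevant at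
    \<open>\<tau>\<close> for the ends, while \<open>U\<close>, which moves by at most
    \<open>\<theta>\<close>, is not relevant at \<open>s'\<close> for any step.\<close>
  define s' where "s' = 2 * \<tau> + 3 * \<theta> + 1"
  have \<tau>: "\<tau> \<ge> 16 * E" "\<tau> \<ge> s" "\<tau> \<ge> \<rho>" using \<rho> by (auto simp: \<tau>_def)
  have s': "s' \<ge> 16 * E" using \<tau> \<theta> E_ge by (simp add: s'_def)
  obtain K C where KC: "K \<ge> 0" "C \<ge> 0" and bd: "\<And>x y. \<lbrakk>x \<in> X; y \<in> X; \<forall>V\<in>relevant s' x y. lev V \<le> k;
      card {V \<in> relevant s' x y. lev V = k} \<le> m\<rbrakk> \<Longrightarrow> d x y \<le> K * total s' x y + C"
    using IH[unfolded bounded_above_level_def, rule_format, OF s' s'] by blast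
  obtain K' C' where KC': "K' \<ge> 0" "C' \<ge> 0" and bd': "\<And>x y. \<lbrakk>x \<in> X; y \<in> X; \<forall>V\<in>relevant \<tau> x y. lev V \<le> k;
      card {V \<in> relevant \<tau> x y. lev V = k} \<le> m\<rbrakk> \<Longrightarrow> d x y \<le> K' * total s x y + C'"
    using IH[unfolded bounded_above_level_def, rule_format, OF \<tau>(1) s] by blast
  have "d x y \<le> (K * (3 * real B) + C + K') * total s x y + (C + C')"
    if X: "x \<in> X" "y \<in> X" and top: "\<forall>V\<in>relevant \<rho> x y. lev V \<le> k"
      and card: "card {V \<in> relevant \<rho> x y. lev V = k} \<le> Suc m" for x y
  proof -
    let ?H = "{V \<in> relevant \<tau> x y. lev V = k}"
    have sub: "relevant \<tau> x y \<subseteq> relevant \<rho> x y" using \<tau> by (auto simp: relevant_def)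
    have "card ?H \<le> card {V \<in> relevant \<rho> x y. lev V = k}"
      by (rule card_mono) (use sub finite_relevant[OF X \<rho>] in auto)
    then have cardH: "card ?H \<le> Suc m" using card by simp
    have topH: "\<forall>V\<in>relevant \<tau> x y. lev V \<le> k" using top sub by blast
    have finH: "finite ?H" using finite_relevant[OF X \<tau>(1)] by simp
    have T: "total s x y \<ge> 0" by (rule total_nonneg)
    show "d x y \<le> (K * (3 * real B) + C + K') * total s x y + (C + C')"
    proof (cases "?H = {}")
      case True
      then have "d x y \<le> K' * total s x y + C'" using bd'[OF X topH] by (metis card.empty le0)
      moreover have "0 \<le> (K * (3 * real B) + C) * total s x y"
        using KC T by (intro mult_nonneg_nonneg add_nonneg_nonneg) auto
      ultimately show ?thesis using KC by (simp add: algebra_simps)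
    next
      case False
      then obtain U where U: "U \<in> relevant \<tau> x y" "lev U = k" by blast
      then have UD: "U \<in> D" "dd U x y \<ge> \<tau>" by (auto simp: relevant_def)
      have "dd U x y > 2 * E" using UD \<tau> E_ge by linarith
      from subdivide[OF X UD(1) this] obtain w N where w: "w 0 = x" "w (Suc N) = y"
        "\<And>i. i \<le> Suc N \<Longrightarrow> w i \<in> X" "real N \<le> dd U x y"
        "\<And>i. i \<le> N \<Longrightarrow> dd U (w i) (w (Suc i)) \<le> \<theta>"
        "\<And>i V. \<lbrakk>i \<le> N; V \<in> D\<rbrakk> \<Longrightarrow> dd V (w i) (w (Suc i)) \<le> 2 * dd V x y + \<theta>"
        "\<And>V. \<lbrakk>V \<in> D; U \<preceq> V \<longrightarrow> U = V\<rbrakk> \<Longrightarrow> card {i. i \<le> N \<and> dd V (w i) (w (Suc i)) > \<theta>} \<le> B"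
        by blast
      have visible: "V \<in> relevant \<tau> x y" if "V \<in> relevant s' (w i) (w (Suc i))" "i \<le> N" for V i
        using that w(6)[of i V] \<theta> by (auto simp: relevant_def s'_def)
      have "d (w i) (w (Suc i)) \<le> K * total s' (w i) (w (Suc i)) + C" if i: "i \<le> N" for i
      proof (rule bd)
        have "{V \<in> relevant s' (w i) (w (Suc i)). lev V = k} \<subseteq> ?H - {U}"
          using visible[OF _ i] w(5)[OF i] \<tau> \<theta> E_ge by (auto simp: relevant_def s'_def)
        then have "card {V \<in> relevant s' (w i) (w (Suc i)). lev V = k} \<le> card (?H - {U})"
          using finH by (intro card_mono) auto
        also have "\<dots> \<le> m" using cardH U finH by (subst card_Diff_singleton) auto
        finally show "card {V \<in> relevant s' (w i) (w (Suc i)). lev V = k} \<le> m" .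
      qed (use w(3) i visible[OF _ i] topH in auto)
      then have "(\<Sum>i\<le>N. d (w i) (w (Suc i))) \<le> (\<Sum>i\<le>N. K * total s' (w i) (w (Suc i)) + C)"
        by (intro sum_mono) auto
      also have "\<dots> = K * (\<Sum>i\<le>N. total s' (w i) (w (Suc i))) + (real N + 1) * C"
        by (simp add: sum.distrib sum_distrib_left)
      finally have 1: "d x y \<le> K * (\<Sum>i\<le>N. total s' (w i) (w (Suc i))) + (real N + 1) * C"
        using d_path[of N w] w(1-3) by force
      have "(\<Sum>i\<le>N. total s' (w i) (w (Suc i))) \<le> 3 * real B * total s x y"
      proof (rule sum_total_subdivision[where N = N and w = w and B = B, OF X _ s \<theta>])
        show "s' \<ge> 2 * s + 3 * \<theta>" using \<tau> by (simp add: s'_def)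
        fix i V assume "V \<in> D" "i \<le> N" "s' \<le> dd V (w i) (w (Suc i))"
        \<comment> \<open>\<open>V\<close> is relevant for the ends, hence of level at most that of
          \<open>U\<close> and not properly above it, as the count along the subdivision
          requires.\<close>
        then have "lev V \<le> lev U" using visible[of V i] topH U(2) by (auto simp: relevant_def)
        then show "card {i. i \<le> N \<and> dd V (w i) (w (Suc i)) > \<theta>} \<le> B"
          using w(7)[OF \<open>V \<in> D\<close>] lev_less[of U V] by fastforce
      qed (use w in auto)
      then have 2: "K * (\<Sum>i\<le>N. total s' (w i) (w (Suc i))) \<le> K * (3 * real B * total s x y)"
        using KC by (intro mult_left_mono) auto
      have "U \<in> relevant s x y" using U \<tau> by (auto simp: relevant_def)
      then have "real N \<le> total s x y" using le_total[OF X s] w(4) by fastforce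
      then have 3: "real N * C \<le> total s x y * C" using KC by (intro mult_right_mono) auto
      have "0 \<le> K' * total s x y" using KC' T by simp
      then show ?thesis using 1 2 3 KC' by (simp add: algebra_simps)
    qed
  qed
  moreover have "0 \<le> K * (3 * real B) + C + K'" "0 \<le> C + C'" using KC KC' by auto
  ultimately show "\<exists>K\<ge>0. \<exists>C\<ge>0. \<forall>x\<in>X. \<forall>y\<in>X.
     (\<forall>V\<in>relevant \<rho> x y. lev V \<le> k) \<and> card {V \<in> relevant \<rho> x y. lev V = k} \<le> Suc m \<longrightarrow>
     d x y \<le> K * total s x y + C"
    by blast
qed

text \<open>If no relevant domain has level \<open>Suc k\<close>, then \<open>k\<close> bounds the
  levels and \<open>card_top_level\<close> supplies a number \<open>m\<close>, uniform in the two
  points, at which the induction hypothesis is used. At level 0 without domains nothing is relevant,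
  and \<open>uniqueness\<close> applies.\<close>

lemma bounded_above_level: "bounded_above_level k m"
proof (induction k arbitrary: m)
  case 0
  have "bounded_above_level 0 0"
    unfolding bounded_above_level_def
  proof (intro allI impI)
    fix \<rho> s :: real assume \<rho>: "\<rho> \<ge> 16 * E"
    obtain \<theta> where \<theta>: "\<theta> \<ge> 0" "\<And>x y. \<lbrakk>x \<in> X; y \<in> X; \<forall>V\<in>D. dd V x y < \<rho>\<rbrakk> \<Longrightarrow> d x y \<le> \<theta>"
      using uniqueness[of \<rho>] by blast
    have "d x y \<le> 0 * total s x y + \<theta>" if X: "x \<in> X" "y \<in> X"
      and "\<forall>V\<in>relevant \<rho> x y. lev V \<le> 0" and c: "card {V \<in> relevant \<rho> x y. lev V = 0} \<le> 0" for x y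
    proof -
      have "{V \<in> relevant \<rho> x y. lev V = 0} = {}"
        using c finite_relevant[OF X \<rho>] by simp
      then have "relevant \<rho> x y = {}" using that(3) by auto
      then have "\<forall>V\<in>D. dd V x y < \<rho>" by (auto simp: relevant_def not_le)
      then show ?thesis using \<theta>(2)[OF X] by simp
    qed
    then show "\<exists>K\<ge>0. \<exists>C\<ge>0. \<forall>x\<in>X. \<forall>y\<in>X.
      (\<forall>V\<in>relevant \<rho> x y. lev V \<le> 0) \<and> card {V \<in> relevant \<rho> x y. lev V = 0} \<le> 0 \<longrightarrow>
      d x y \<le> K * total s x y + C"
      using \<theta>(1) by (intro exI[of _ 0] exI[of _ \<theta>] conjI) auto
  qed
  then show ?case by (induction m) (auto intro: bounded_above_level_Suc_card)
next
  case (Suc k)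
  have "bounded_above_level (Suc k) 0"
    unfolding bounded_above_level_def
  proof (intro allI impI)
    fix \<rho> s assume \<rho>: "\<rho> \<ge> 16 * E" and s: "s \<ge> 16 * E"
    obtain m where m: "\<And>x y k. \<lbrakk>x \<in> X; y \<in> X; \<forall>V\<in>relevant \<rho> x y. lev V \<le> k\<rbrakk>
      \<Longrightarrow> card {V \<in> relevant \<rho> x y. lev V = k} \<le> m"
      by (rule card_top_level[OF \<rho>]) (rule that)
    obtain K C where KC: "K \<ge> 0" "C \<ge> 0" and bd: "\<And>x y. \<lbrakk>x \<in> X; y \<in> X; \<forall>V\<in>relevant \<rho> x y. lev V \<le> k;
      card {V \<in> relevant \<rho> x y. lev V = k} \<le> m\<rbrakk> \<Longrightarrow> d x y \<le> K * total s x y + C"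
      using Suc.IH[of m, unfolded bounded_above_level_def, rule_format, OF \<rho> s] by blast
    have "d x y \<le> K * total s x y + C" if X: "x \<in> X" "y \<in> X"
      and top: "\<forall>V\<in>relevant \<rho> x y. lev V \<le> Suc k" and c: "card {V \<in> relevant \<rho> x y. lev V = Suc k} \<le> 0" for x y
    proof -
      have "{V \<in> relevant \<rho> x y. lev V = Suc k} = {}"
        using c finite_relevant[OF X \<rho>] by simp
      then have "lev V \<le> k" if "V \<in> relevant \<rho> x y" for V using top that by (auto simp: le_Suc_eq)
      then show ?thesis using bd[OF X] m[OF X] by blast
    qed
    then show "\<exists>K\<ge>0. \<exists>C\<ge>0. \<forall>x\<in>X. \<forall>y\<in>X.
      (\<forall>V\<in>relevant \<rho> x y. lev V \<le> Suc k) \<and> card {V \<in> relevant \<rho> x y. lev V = Suc k} \<le> 0 \<longrightarrow>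
      d x y \<le> K * total s x y + C"
      using KC by blast
  qed
  then show ?case by (induction m) (auto intro: bounded_above_level_Suc_card)
qed

text \<open>Levels are at most \<open>n\<close>, so all pairs of points satisfy the condition for
  level \<open>Suc n\<close> and number 0.\<close>

theorem dist_le_total:
  assumes s: "s \<ge> 16 * E"
  obtains K C where "K \<ge> 0" "C \<ge> 0" "\<And>x y. \<lbrakk>x \<in> X; y \<in> X\<rbrakk> \<Longrightarrow> d x y \<le> K * total s x y + C"
proof -
  obtain K C where KC: "K \<ge> 0" "C \<ge> 0" and bd: "\<And>x y. \<lbrakk>x \<in> X; y \<in> X; \<forall>V\<in>relevant s x y. lev V \<le> Suc n;
      card {V \<in> relevant s x y. lev V = Suc n} \<le> 0\<rbrakk> \<Longrightarrow> d x y \<le> K * total s x y + C"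
    using bounded_above_level[of "Suc n" 0, unfolded bounded_above_level_def, rule_format, OF s s] by blast
  have *: "lev V \<le> n" if "V \<in> relevant s x y" for V x y
    using that lev_le by (auto simp: relevant_def)
  have "\<forall>V\<in>relevant s x y. lev V \<le> Suc n" "{V \<in> relevant s x y. lev V = Suc n} = {}" for x y
    using * by (fastforce simp: le_Suc_eq)+
  then show thesis using that[OF KC] bd by (metis card.empty le0)
qed

theorem total_le_dist:
  assumes s: "s \<ge> 16 * E" and X: "x \<in> X" "y \<in> X"
  shows "total s x y \<le> 2 * E * (n * Suc n) * (E * d x y + E)"
  unfolding total_def
  by (rule sum_le_dist[OF X finite_relevant[OF X s]]) (use s in \<open>auto simp: relevant_def\<close>)

end


section \<open>Hierarchically hyperbolic spaces as coordinate systems\<close>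

lemma bdd_below_dist:
  assumes "Metric_space M d"
  shows "bdd_below ((\<lambda>(a, b). d a b) ` S)"
proof -
  interpret Metric_space M d by fact
  show ?thesis by (rule bdd_belowI[of _ 0]) auto
qed

lemma set_dist_le:
  assumes "Metric_space M d" "a \<in> A" "b \<in> B"
  shows "set_dist d A B \<le> d a b"
  unfolding set_dist_def using cINF_lower[OF bdd_below_dist[OF assms(1)], of "(a, b)" "A \<times> B"] assms by auto

lemma le_set_dist:
  assumes "A \<noteq> {}" "B \<noteq> {}" "\<And>a b. \<lbrakk>a \<in> A; b \<in> B\<rbrakk> \<Longrightarrow> c \<le> d a b"
  shows "c \<le> set_dist d A B"
  unfolding set_dist_def by (rule cINF_greatest) (use assms in auto)

lemma set_dist_less:
  assumes "Metric_space M d" "A \<noteq> {}" "B \<noteq> {}" "set_dist d A B < c"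
  obtains a b where "a \<in> A" "b \<in> B" "d a b < c"
  using assms(4) le_set_dist[OF assms(2,3), of c d] by (meson not_less)

lemma dist_le_set_dist:
  assumes m: "Metric_space M d" and AB: "A \<subseteq> M" "B \<subseteq> M" "diam_le d A \<xi>" "diam_le d B \<xi>" and ab: "a \<in> A" "b \<in> B"
  shows "d a b \<le> set_dist d A B + 2 * \<xi>"
proof -
  interpret Metric_space M d by fact
  have "d a b - 2 * \<xi> \<le> set_dist d A B"
  proof (rule le_set_dist)
    fix a' b' assume ab': "a' \<in> A" "b' \<in> B"
    have "d a b \<le> d a a' + d a' b" "d a' b \<le> d a' b' + d b' b"
      using triangle ab ab' AB by blast+
    moreover have "d a a' \<le> \<xi>" "d b' b \<le> \<xi>"
      using AB ab ab' by (auto simp: diam_le_def)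
    ultimately show "d a b - 2 * \<xi> \<le> d a' b'" by linarith
  qed (use ab in auto)
  then show ?thesis by simp
qed

text \<open>The infimum defining \<open>set_dist\<close> need not be attained, whence
  \<open>R + 1\<close>.\<close>

lemma nbhd_witness:
  assumes "Metric_space M d" "p \<in> nbhd M d R A" "A \<noteq> {}"
  obtains a where "a \<in> A" "d p a < R + 1"
proof (rule set_dist_less[OF assms(1), of "{p}" A "R + 1"])
  show "set_dist d {p} A < R + 1" using assms(2) by (simp add: nbhd_def)
qed (use assms that in auto)

lemma geodesic_ends:
  assumes "geodesic M d x y G"
  shows "x \<in> G" "y \<in> G"
proof -
  obtain L g where g: "(L::real) \<ge> 0" "g 0 = x" "g L = y" "G = g ` {0..L}"
    using assms unfolding geodesic_def by blast
  then have "0 \<in> {0..L}" "L \<in> {0..L}" by auto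
  then show "x \<in> G" "y \<in> G" using g by blast+
qed

lemma geodesic_point_between:
  assumes m: "Metric_space M d" and G: "geodesic M d x y G" and p: "p \<in> G"
  shows "p \<in> M" "d x p + d p y = d x y"
proof -
  obtain L g where g: "L \<ge> 0" "g \<in> {0..L} \<rightarrow> M" "g 0 = x" "g L = y" "G = g ` {0..L}"
    "\<And>s t. \<lbrakk>s \<in> {0..L}; t \<in> {0..L}\<rbrakk> \<Longrightarrow> d (g s) (g t) = \<bar>s - t\<bar>"
    using G unfolding geodesic_def by blast
  obtain t where t: "t \<in> {0..L}" "p = g t" using p g by blast
  show "p \<in> M" using g t by blast
  show "d x p + d p y = d x y"
    using g(6)[of 0 t] g(6)[of t L] g(6)[of 0 L] t g(1,3,4) by auto
qed

text \<open>Along \<open>G\<close> from \<open>x\<close> to \<open>y\<close>, closeness to the side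
  \<open>G3\<close> from \<open>x\<close> to \<open>z\<close> gives way to closeness to the side
  \<open>G2\<close> from \<open>y\<close> to \<open>z\<close>. The point \<open>m\<close> is taken
  near the last moment of closeness to \<open>G3\<close>; as the supremum need not be attained, one
  time is chosen less than 1 before it and another at most 1 later.\<close>

lemma hyperbolic_tripod:
  assumes hyp: "hyperbolic_space \<delta> M d" and M: "x \<in> M" "y \<in> M" "z \<in> M"
    and G: "geodesic M d x y G"
  obtains m p q where "m \<in> G" "p \<in> M" "q \<in> M" "d m p \<le> \<delta> + 3" "d m q \<le> \<delta> + 3"
    "d x p + d p z = d x z" "d y q + d q z = d y z"
proof -
  have gs: "geodesic_space M d" using hyp by (simp add: hyperbolic_space_def)
  then have ms: "Metric_space M d" by (simp add: geodesic_space_def)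
  interpret Metric_space M d by (rule ms)
  obtain G2 G3 where G2: "geodesic M d y z G2" and G3: "geodesic M d x z G3"
    using gs M unfolding geodesic_space_def by blast
  have slim: "G \<subseteq> nbhd M d \<delta> (G2 \<union> G3)"
    using hyp M G G2 G3 unfolding hyperbolic_space_def by blast
  obtain L g where g: "L \<ge> 0" "g \<in> {0..L} \<rightarrow> M" "g 0 = x" "g L = y" "G = g ` {0..L}"
    "\<And>s t. \<lbrakk>s \<in> {0..L}; t \<in> {0..L}\<rbrakk> \<Longrightarrow> d (g s) (g t) = \<bar>s - t\<bar>"
    using G unfolding geodesic_def by blast
  note ends = geodesic_ends(1)[OF G3] geodesic_ends(1)[OF G2]
  \<comment> \<open>Slimness at \<open>x\<close> yields \<open>\<delta> + 1 > 0\<close>, by which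
    the end points of \<open>G\<close> count as close to the sides that start there.\<close>
  have d\<delta>: "\<delta> + 1 > 0"
  proof -
    have "x \<in> nbhd M d \<delta> (G2 \<union> G3)" using slim g(1,3,5) by force
    then obtain a where "d x a < \<delta> + 1" using nbhd_witness[OF ms] ends by blast
    then show ?thesis using nonneg[of x a] by linarith
  qed
  define A where "A = {t \<in> {0..L}. \<exists>p\<in>G3. d (g t) p < \<delta> + 1}"
  have cover: "t \<in> A \<or> (\<exists>q\<in>G2. d (g t) q < \<delta> + 1)" if "t \<in> {0..L}" for t
  proof -
    have "g t \<in> nbhd M d \<delta> (G2 \<union> G3)" using slim g(5) that by blast
    then obtain a where "a \<in> G2 \<union> G3" "d (g t) a < \<delta> + 1" using nbhd_witness[OF ms] ends by blast
    then show ?thesis using that by (auto simp: A_def)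
  qed
  have "0 \<in> A" using g(1,3) ends d\<delta> M by (auto simp: A_def intro!: bexI[of _ x])
  have bdd: "bdd_above A" by (rule bdd_aboveI[of _ L]) (auto simp: A_def)
  obtain t where t: "t \<in> A" "t > Sup A - 1"
    using less_cSup_iff[OF _ bdd, of "Sup A - 1"] \<open>0 \<in> A\<close> by fastforce
  then have tL: "t \<in> {0..L}" by (simp add: A_def)
  define t' where "t' = min (t + 1) L"
  have t': "t' \<in> {0..L}" "\<bar>t - t'\<bar> \<le> 1" using tL by (auto simp: t'_def)
  have "\<exists>q\<in>G2. d (g t') q < \<delta> + 1"
  proof (cases "t' = L")
    case True
    then show ?thesis using g(4) ends d\<delta> M by (auto intro!: bexI[of _ y])
  next
    case False
    then have "t' > Sup A" using t by (auto simp: t'_def min_def split: if_splits)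
    then have "t' \<notin> A" using cSup_upper[OF _ bdd] by fastforce
    then show ?thesis using cover t'(1) by blast
  qed
  then obtain q where q: "q \<in> G2" "d (g t') q < \<delta> + 1" by blast
  obtain p where p: "p \<in> G3" "d (g t) p < \<delta> + 1" using t by (auto simp: A_def)
  note p' = geodesic_point_between[OF ms G3 p(1)] and q' = geodesic_point_between[OF ms G2 q(1)]
  have "g t \<in> M" "g t' \<in> M" using g(2) tL t'(1) by auto
  then have "d (g t) q \<le> d (g t) (g t') + d (g t') q" using triangle q' by blast
  then have "d (g t) q \<le> \<delta> + 3" using g(6)[OF tL t'(1)] t'(2) q by linarith
  then show thesis using that[of "g t" p q] p p' q' g(5) tL by force
qed

text \<open>\<open>A\<close> is a common bound for the constants that enter distance estimates. The
  base point gives \<open>realize\<close> a coordinate to prescribe when only the shadows of a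
  domain matter.\<close>

locale hh_space =
  fixes X :: "'x set" and d :: "'x \<Rightarrow> 'x \<Rightarrow> real" and \<SS> :: "('x, 'w, 'c) hh_structure"
    and q \<delta> \<xi> \<kappa>\<^sub>0 K :: real and n :: nat and \<Lambda> E\<^sub>L E\<^sub>B \<alpha> :: real and \<theta> :: "real \<Rightarrow> real" and A :: real and p\<^sub>0 :: 'x
  assumes quasigeodesic: "quasigeodesic_space q X d"
    and hyperbolic: "\<And>W. W \<in> domains \<SS> \<Longrightarrow> hyperbolic_space \<delta> (cspace \<SS> W) (cdist \<SS> W)"
    and projections: "hh_projections \<xi> K X d \<SS>"
    and nesting: "hh_nesting \<xi> \<SS>"
    and orthogonality: "hh_orthogonality \<SS>"
    and consistency: "hh_consistency \<xi> \<kappa>\<^sub>0 X \<SS>"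
    and complexity: "hh_finite_complexity n \<SS>"
    and links: "hh_large_links \<Lambda> E\<^sub>L X \<SS>"
    and image: "hh_bounded_geodesic_image E\<^sub>B \<SS>"
    and partial_realization: "hh_partial_realization \<alpha> X \<SS>"
    and unique: "hh_uniqueness \<theta> X d \<SS>"
    and xi_nonneg: "\<xi> \<ge> 0" and K_nonneg: "K \<ge> 0" and Lambda_ge: "\<Lambda> \<ge> 1"
    and A: "A \<ge> 1" "q \<le> A" "\<delta> \<le> A" "\<xi> \<le> A" "\<kappa>\<^sub>0 \<le> A" "K \<le> A" "E\<^sub>L \<le> A" "E\<^sub>B \<le> A" "\<alpha> \<le> A"
    and basepoint: "p\<^sub>0 \<in> X"
begin

abbreviation D :: "'w set" where "D \<equiv> domains \<SS>"

lemma AA: "A \<le> A * A"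
  using A(1) by simp

lemma cspace_metric: "W \<in> D \<Longrightarrow> Metric_space (cspace \<SS> W) (cdist \<SS> W)"
  using hyperbolic by (simp add: hyperbolic_space_def geodesic_space_def)

lemma X_metric: "Metric_space X d"
  using quasigeodesic by (simp add: quasigeodesic_space_def)

lemma nest_partial_order: "partial_order_on D (nest \<SS>)"
  using nesting unfolding hh_nesting_def by (rule conjunct1)

lemma nest_dom: "V \<sqsubseteq>\<^bsub>\<SS>\<^esub> W \<Longrightarrow> V \<in> D \<and> W \<in> D"
  using partial_order_onD(4)[OF nest_partial_order] by (auto dest: subsetD)

lemma nest_refl: "V \<in> D \<Longrightarrow> V \<sqsubseteq>\<^bsub>\<SS>\<^esub> V"
  by (rule refl_onD[OF partial_order_onD(1)[OF nest_partial_order]])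

lemma nest_trans: "\<lbrakk>U \<sqsubseteq>\<^bsub>\<SS>\<^esub> V; V \<sqsubseteq>\<^bsub>\<SS>\<^esub> W\<rbrakk> \<Longrightarrow> U \<sqsubseteq>\<^bsub>\<SS>\<^esub> W"
  by (rule transD[OF partial_order_onD(2)[OF nest_partial_order]])

lemma nest_antisym: "\<lbrakk>V \<sqsubseteq>\<^bsub>\<SS>\<^esub> W; W \<sqsubseteq>\<^bsub>\<SS>\<^esub> V\<rbrakk> \<Longrightarrow> V = W"
  by (rule antisymD[OF partial_order_onD(3)[OF nest_partial_order]])

lemma orth_dom: "V \<bottom>\<^bsub>\<SS>\<^esub> W \<Longrightarrow> V \<in> D \<and> W \<in> D"
  using orthogonality[unfolded hh_orthogonality_def, THEN conjunct1] by (auto dest: subsetD)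

lemma orth_sym: "V \<bottom>\<^bsub>\<SS>\<^esub> W \<Longrightarrow> W \<bottom>\<^bsub>\<SS>\<^esub> V"
  by (rule symD[OF orthogonality[unfolded hh_orthogonality_def, THEN conjunct2, THEN conjunct1]])

lemma orth_nest: "\<lbrakk>V \<sqsubseteq>\<^bsub>\<SS>\<^esub> W; W \<bottom>\<^bsub>\<SS>\<^esub> U\<rbrakk> \<Longrightarrow> V \<bottom>\<^bsub>\<SS>\<^esub> U"
  using orthogonality[unfolded hh_orthogonality_def, THEN conjunct2, THEN conjunct2, THEN conjunct2,
      THEN conjunct1, THEN spec, THEN spec, THEN spec, THEN mp] by simp

lemma orth_not_nest: "V \<bottom>\<^bsub>\<SS>\<^esub> W \<Longrightarrow> \<not> V \<sqsubseteq>\<^bsub>\<SS>\<^esub> W"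
  using orthogonality[unfolded hh_orthogonality_def, THEN conjunct2, THEN conjunct2, THEN conjunct2,
      THEN conjunct2, THEN conjunct2, THEN spec, THEN spec, THEN mp] by simp

lemma container:
  assumes "T \<in> D" "U \<sqsubseteq>\<^bsub>\<SS>\<^esub> T" "V \<sqsubseteq>\<^bsub>\<SS>\<^esub> T" "V \<bottom>\<^bsub>\<SS>\<^esub> U"
  obtains W where "W \<sqsubset>\<^bsub>\<SS>\<^esub> T" "\<And>V. \<lbrakk>V \<bottom>\<^bsub>\<SS>\<^esub> U; V \<sqsubseteq>\<^bsub>\<SS>\<^esub> T\<rbrakk> \<Longrightarrow> V \<sqsubseteq>\<^bsub>\<SS>\<^esub> W"
proof -
  have "\<forall>T\<in>D. \<forall>U\<in>domains_below \<SS> T. {V \<in> domains_below \<SS> T. V \<bottom>\<^bsub>\<SS>\<^esub> U} \<noteq> {} \<longrightarrow>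
        (\<exists>W\<in>domains_below \<SS> T - {T}. \<forall>V. V \<bottom>\<^bsub>\<SS>\<^esub> U \<and> V \<sqsubseteq>\<^bsub>\<SS>\<^esub> T \<longrightarrow> V \<sqsubseteq>\<^bsub>\<SS>\<^esub> W)"
    using orthogonality unfolding hh_orthogonality_def by (elim conjE)
  moreover have "U \<in> domains_below \<SS> T" "V \<in> {V \<in> domains_below \<SS> T. V \<bottom>\<^bsub>\<SS>\<^esub> U}"
    using assms nest_dom by (auto simp: domains_below_def)
  ultimately have "\<exists>W\<in>domains_below \<SS> T - {T}. \<forall>V. V \<bottom>\<^bsub>\<SS>\<^esub> U \<and> V \<sqsubseteq>\<^bsub>\<SS>\<^esub> T \<longrightarrow> V \<sqsubseteq>\<^bsub>\<SS>\<^esub> W"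
    using assms(1) by blast
  then show thesis using that by (auto simp: domains_below_def)
qed

section \<open>Levels, the top domain and orthogonal families\<close>

definition chains :: "'w \<Rightarrow> 'w set set" where
  "chains T = {C. C \<subseteq> domains_below \<SS> T \<and> (\<forall>V\<in>C. \<forall>W\<in>C. V \<sqsubseteq>\<^bsub>\<SS>\<^esub> W \<or> W \<sqsubseteq>\<^bsub>\<SS>\<^esub> V)}"

lemma chains_finite: "C \<in> chains T \<Longrightarrow> finite C \<and> card C \<le> n"
  using complexity[unfolded hh_finite_complexity_def, THEN spec, of C, THEN mp]
  by (auto simp: chains_def domains_below_def)

lemma chains_insert:
  assumes "C \<in> chains V" "V \<sqsubset>\<^bsub>\<SS>\<^esub> W"
  shows "insert W C \<in> chains W" "card (insert W C) = Suc (card C)"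
proof -
  have W: "W \<in> D" "W \<sqsubseteq>\<^bsub>\<SS>\<^esub> W" using assms nest_dom nest_refl by auto
  have C: "U \<sqsubseteq>\<^bsub>\<SS>\<^esub> V" "U \<in> D" if "U \<in> C" for U
    using assms that by (auto simp: chains_def domains_below_def)
  then have "U \<sqsubseteq>\<^bsub>\<SS>\<^esub> W" if "U \<in> C" for U using assms(2) nest_trans that by blast
  then show "insert W C \<in> chains W"
    using assms(1) W C(2) unfolding chains_def domains_below_def by auto
  have "W \<notin> C" using C(1)[of W] assms(2) nest_antisym by blast
  then show "card (insert W C) = Suc (card C)" using chains_finite[OF assms(1)] by simp
qed

definition lev :: "'w \<Rightarrow> nat" where
  "lev T = Max (card ` chains T)"

lemma chain_cards: "finite (card ` chains T)" "card ` chains T \<noteq> {}"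
proof -
  have "card ` chains T \<subseteq> {..n}" using chains_finite by auto
  then show "finite (card ` chains T)" by (rule finite_subset) simp
  have "{} \<in> chains T" by (simp add: chains_def)
  then show "card ` chains T \<noteq> {}" by blast
qed

lemma lev_le: "lev T \<le> n"
  unfolding lev_def using chain_cards chains_finite by (subst Max_le_iff) auto

lemma lev_less:
  assumes "V \<sqsubset>\<^bsub>\<SS>\<^esub> W"
  shows "lev V < lev W"
proof -
  have "lev V \<in> card ` chains V" unfolding lev_def by (rule Max_in) (rule chain_cards)+
  then obtain C where C: "C \<in> chains V" "lev V = card C" by blast
  have "card (insert W C) \<le> lev W"
    unfolding lev_def by (rule Max_ge[OF chain_cards(1)]) (use chains_insert[OF C(1) assms] in blast)
  then show ?thesis using chains_insert[OF C(1) assms] C(2) by simp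
qed

text \<open>The axiom gives uniqueness of the maximal domain, not that it lies above all others.
  Levels grow strictly upwards and are at most \<open>n\<close>, so climbing from any
  \<open>V\<close> ends at a maximal domain, which must be \<open>M\<close>.\<close>

lemma ex_top:
  assumes "D \<noteq> {}"
  shows "\<exists>T\<in>D. \<forall>V\<in>D. V \<sqsubseteq>\<^bsub>\<SS>\<^esub> T"
proof -
  have "D = {} \<or> (\<exists>!M. M \<in> D \<and> (\<forall>V\<in>D. M \<sqsubseteq>\<^bsub>\<SS>\<^esub> V \<longrightarrow> V = M))"
    using nesting unfolding hh_nesting_def by (elim conjE)
  then have unique_max: "\<exists>!M. M \<in> D \<and> (\<forall>V\<in>D. M \<sqsubseteq>\<^bsub>\<SS>\<^esub> V \<longrightarrow> V = M)"
    using assms by (elim disjE) simp_all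
  define M where "M = (THE M. M \<in> D \<and> (\<forall>V\<in>D. M \<sqsubseteq>\<^bsub>\<SS>\<^esub> V \<longrightarrow> V = M))"
  have M: "M \<in> D" using theI'[OF unique_max] unfolding M_def by (rule conjunct1)
  have M_eq: "N = M" if "N \<in> D" "\<forall>V\<in>D. N \<sqsubseteq>\<^bsub>\<SS>\<^esub> V \<longrightarrow> V = N" for N
    unfolding M_def by (rule the1_equality[OF unique_max, symmetric]) (use that in simp)
  have "V \<sqsubseteq>\<^bsub>\<SS>\<^esub> M" if "V \<in> D" for V
    using that
  proof (induction "n - lev V" arbitrary: V rule: less_induct)
    case less
    show ?case
    proof (cases "\<forall>W\<in>D. V \<sqsubseteq>\<^bsub>\<SS>\<^esub> W \<longrightarrow> W = V")
      case True
      then show ?thesis using M_eq[OF less.prems] less.prems nest_refl by metis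
    next
      case False
      then obtain W where W: "W \<in> D" "V \<sqsubset>\<^bsub>\<SS>\<^esub> W" by blast
      then have "n - lev W < n - lev V" using lev_less[of V W] lev_le[of W] by linarith
      then show ?thesis using less.hyps[of W] W nest_trans[of V W M] by blast
    qed
  qed
  then show ?thesis using M by blast
qed

text \<open>Containers turn an orthogonal family into a chain: all members but \<open>U\<close> lie
  in a domain \<open>W\<close> properly nested in \<open>T\<close>, so \<open>T\<close> can be added
  to a chain below \<open>W\<close>.\<close>

lemma orth_chain:
  assumes "finite \<V>" "\<V> \<subseteq> domains_below \<SS> T" "T \<in> D" "\<And>V W. \<lbrakk>V \<in> \<V>; W \<in> \<V>; V \<noteq> W\<rbrakk> \<Longrightarrow> V \<bottom>\<^bsub>\<SS>\<^esub> W"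
  shows "\<exists>C\<in>chains T. card C = card \<V>"
  using assms
proof (induction \<V> arbitrary: T rule: finite_induct)
  case empty
  then show ?case by (intro bexI[of _ "{}"]) (auto simp: chains_def)
next
  case (insert U \<V>)
  show ?case
  proof (cases "\<V> = {}")
    case True
    then show ?thesis using insert.prems nest_refl
      by (intro bexI[of _ "{T}"]) (auto simp: chains_def domains_below_def)
  next
    case False
    then obtain V where V: "V \<in> \<V>" by blast
    have orth: "V \<bottom>\<^bsub>\<SS>\<^esub> U" if "V \<in> \<V>" for V using insert.prems(3) insert.hyps that by blast
    have "U \<sqsubseteq>\<^bsub>\<SS>\<^esub> T" "V \<sqsubseteq>\<^bsub>\<SS>\<^esub> T" using insert.prems V by (auto simp: domains_below_def)
    then obtain W where W: "W \<sqsubset>\<^bsub>\<SS>\<^esub> T" "\<And>V. \<lbrakk>V \<bottom>\<^bsub>\<SS>\<^esub> U; V \<sqsubseteq>\<^bsub>\<SS>\<^esub> T\<rbrakk> \<Longrightarrow> V \<sqsubseteq>\<^bsub>\<SS>\<^esub> W"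
      using container[OF insert.prems(2)] orth[OF V] by metis
    have "\<V> \<subseteq> domains_below \<SS> W"
      using W(2) orth insert.prems(1) by (auto simp: domains_below_def)
    moreover have "W \<in> D" using W nest_dom by blast
    ultimately obtain C where C: "C \<in> chains W" "card C = card \<V>"
      using insert.IH[of W] insert.prems(3) by blast
    then show ?thesis using chains_insert[OF C(1) W(1)] insert.hyps by auto
  qed
qed

lemma orth_card:
  assumes "finite \<V>" "\<V> \<subseteq> D" "\<And>V W. \<lbrakk>V \<in> \<V>; W \<in> \<V>; V \<noteq> W\<rbrakk> \<Longrightarrow> V \<bottom>\<^bsub>\<SS>\<^esub> W"
  shows "card \<V> \<le> n"
proof (cases "D = {}")
  case False
  then obtain T where T: "T \<in> D" "\<forall>V\<in>D. V \<sqsubseteq>\<^bsub>\<SS>\<^esub> T" using ex_top by blast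
  then have "\<V> \<subseteq> domains_below \<SS> T" using assms(2) by (auto simp: domains_below_def)
  then show ?thesis using orth_chain[OF assms(1) _ T(1) assms(3)] chains_finite by metis
qed (use assms in auto)

section \<open>Pulled-back pseudometrics and representatives of the sets \<rho>\<close>

definition pt :: "'w \<Rightarrow> 'x \<Rightarrow> 'c" where
  "pt W x = (SOME a. a \<in> proj \<SS> W x)"

text \<open>Distances between chosen points satisfy the triangle inequality, which the infimum
  \<open>dom_dist\<close> need not; the two differ by at most the diameters.\<close>

definition dd :: "'w \<Rightarrow> 'x \<Rightarrow> 'x \<Rightarrow> real" where
  "dd W x y = cdist \<SS> W (pt W x) (pt W y)"

lemma proj:
  assumes "W \<in> D" "x \<in> X"
  shows "proj \<SS> W x \<subseteq> cspace \<SS> W" "proj \<SS> W x \<noteq> {}" "diam_le (cdist \<SS> W) (proj \<SS> W x) \<xi>"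
    "pt W x \<in> proj \<SS> W x" "pt W x \<in> cspace \<SS> W"
proof -
  show 1: "proj \<SS> W x \<subseteq> cspace \<SS> W" "proj \<SS> W x \<noteq> {}" "diam_le (cdist \<SS> W) (proj \<SS> W x) \<xi>"
    using projections assms unfolding hh_projections_def by auto
  show "pt W x \<in> proj \<SS> W x" unfolding pt_def using 1(2) by (simp add: some_in_eq)
  then show "pt W x \<in> cspace \<SS> W" using 1 by blast
qed

lemma dom_dist_le:
  assumes "W \<in> D" "x \<in> X" "y \<in> X"
  shows "dom_dist \<SS> W x y \<le> dd W x y" "dd W x y \<le> dom_dist \<SS> W x y + 2 * A"
proof -
  show "dom_dist \<SS> W x y \<le> dd W x y"
    unfolding dom_dist_def dd_def by (rule set_dist_le[OF cspace_metric[OF assms(1)]]) (use proj assms in auto)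
  have "dd W x y \<le> dom_dist \<SS> W x y + 2 * \<xi>"
    unfolding dom_dist_def dd_def by (rule dist_le_set_dist[OF cspace_metric[OF assms(1)]]) (use proj assms in auto)
  then show "dd W x y \<le> dom_dist \<SS> W x y + 2 * A" using A by linarith
qed

text \<open>The relation that becomes \<open>shadows\<close> in the coordinate system.\<close>

definition has_rho :: "'w \<Rightarrow> 'w \<Rightarrow> bool" where
  "has_rho V W \<longleftrightarrow> V \<in> D \<and> W \<in> D \<and> \<not> V \<bottom>\<^bsub>\<SS>\<^esub> W \<and> \<not> W \<sqsubseteq>\<^bsub>\<SS>\<^esub> V"

lemma has_rho_cases:
  assumes "has_rho V W"
  obtains "V \<sqsubset>\<^bsub>\<SS>\<^esub> W" | "V \<pitchfork>\<^bsub>\<SS>\<^esub> W" "W \<pitchfork>\<^bsub>\<SS>\<^esub> V"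
proof (cases "V \<sqsubseteq>\<^bsub>\<SS>\<^esub> W")
  case True
  moreover have "V \<noteq> W" using assms nest_refl by (auto simp: has_rho_def)
  ultimately show thesis using that(1) by blast
next
  case False
  then have "V \<pitchfork>\<^bsub>\<SS>\<^esub> W" "W \<pitchfork>\<^bsub>\<SS>\<^esub> V"
    using assms orth_sym[of V W] orth_sym[of W V] by (auto simp: has_rho_def transverse_def)
  then show thesis by (rule that(2))
qed

lemma transverse_rho:
  assumes "V \<pitchfork>\<^bsub>\<SS>\<^esub> W"
  shows "rho \<SS> V W \<subseteq> cspace \<SS> W \<and> rho \<SS> V W \<noteq> {} \<and> diam_le (cdist \<SS> W) (rho \<SS> V W) \<xi>"
    and "x \<in> X \<Longrightarrow> dom_dist_set \<SS> W x (rho \<SS> V W) \<le> \<kappa>\<^sub>0 \<or> dom_dist_set \<SS> V x (rho \<SS> W V) \<le> \<kappa>\<^sub>0"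
proof -
  note c = consistency[unfolded hh_consistency_def, THEN conjunct1, THEN spec, THEN spec, THEN mp, OF assms]
  show "rho \<SS> V W \<subseteq> cspace \<SS> W \<and> rho \<SS> V W \<noteq> {} \<and> diam_le (cdist \<SS> W) (rho \<SS> V W) \<xi>"
    using c by (elim conjE) (intro conjI; assumption)
  assume "x \<in> X"
  with c have "min (dom_dist_set \<SS> W x (rho \<SS> V W)) (dom_dist_set \<SS> V x (rho \<SS> W V)) \<le> \<kappa>\<^sub>0"
    by (elim conjE) (rule bspec)
  then show "dom_dist_set \<SS> W x (rho \<SS> V W) \<le> \<kappa>\<^sub>0 \<or> dom_dist_set \<SS> V x (rho \<SS> W V) \<le> \<kappa>\<^sub>0"
    by (simp only: min_le_iff_disj)
qed

lemma nested_consistent: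
  assumes "V \<sqsubset>\<^bsub>\<SS>\<^esub> W" "x \<in> X"
  shows "dom_dist_set \<SS> W x (rho \<SS> V W) \<le> \<kappa>\<^sub>0 \<or>
    diam_le (cdist \<SS> V) (proj \<SS> V x \<union> (\<Union>p\<in>proj \<SS> W x. rho_map \<SS> W V p)) \<kappa>\<^sub>0"
  by (rule conjunct2[OF consistency[unfolded hh_consistency_def], THEN conjunct1, rule_format, OF assms])

lemma rho_consistent:
  assumes "U \<sqsubseteq>\<^bsub>\<SS>\<^esub> V" "V \<sqsubset>\<^bsub>\<SS>\<^esub> W \<or> (V \<pitchfork>\<^bsub>\<SS>\<^esub> W \<and> \<not> W \<bottom>\<^bsub>\<SS>\<^esub> U)"
  shows "set_dist (cdist \<SS> W) (rho \<SS> U W) (rho \<SS> V W) \<le> \<kappa>\<^sub>0"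
  by (rule conjunct2[OF consistency[unfolded hh_consistency_def], THEN conjunct2, rule_format, OF assms])

lemma nested_rho:
  assumes "V \<sqsubset>\<^bsub>\<SS>\<^esub> W"
  shows "rho \<SS> V W \<subseteq> cspace \<SS> W \<and> rho \<SS> V W \<noteq> {} \<and> diam_le (cdist \<SS> W) (rho \<SS> V W) \<xi>"
    and "p \<in> cspace \<SS> W \<Longrightarrow> rho_map \<SS> W V p \<subseteq> cspace \<SS> V \<and> rho_map \<SS> W V p \<noteq> {}"
proof -
  have "V \<in> D" "W \<in> D" using assms nest_dom by blast+
  note n = nesting[unfolded hh_nesting_def, THEN conjunct2, THEN conjunct2, THEN bspec, OF this(1),
      THEN bspec, OF this(2), THEN mp, OF assms]
  show "rho \<SS> V W \<subseteq> cspace \<SS> W \<and> rho \<SS> V W \<noteq> {} \<and> diam_le (cdist \<SS> W) (rho \<SS> V W) \<xi>"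
    using n by (elim conjE) (intro conjI; assumption)
  show "rho_map \<SS> W V p \<subseteq> cspace \<SS> V \<and> rho_map \<SS> W V p \<noteq> {}" if "p \<in> cspace \<SS> W"
    using n that by (elim conjE) (rule bspec)
qed

lemma rho_rel:
  assumes "has_rho V W"
  shows "rho \<SS> V W \<subseteq> cspace \<SS> W" "rho \<SS> V W \<noteq> {}" "diam_le (cdist \<SS> W) (rho \<SS> V W) \<xi>"
proof -
  have "rho \<SS> V W \<subseteq> cspace \<SS> W \<and> rho \<SS> V W \<noteq> {} \<and> diam_le (cdist \<SS> W) (rho \<SS> V W) \<xi>"
    using assms by (cases rule: has_rho_cases) (rule nested_rho transverse_rho; assumption)+
  then show "rho \<SS> V W \<subseteq> cspace \<SS> W" "rho \<SS> V W \<noteq> {}" "diam_le (cdist \<SS> W) (rho \<SS> V W) \<xi>"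
    by simp_all
qed

lemma near_rho:
  assumes "has_rho V W" "x \<in> X" "b \<in> rho \<SS> V W"
  shows "cdist \<SS> W (pt W x) b \<le> dom_dist_set \<SS> W x (rho \<SS> V W) + 2 * A"
proof -
  have W: "W \<in> D" using assms by (simp add: has_rho_def)
  have "cdist \<SS> W (pt W x) b \<le> dom_dist_set \<SS> W x (rho \<SS> V W) + 2 * \<xi>"
    unfolding dom_dist_set_def
    by (rule dist_le_set_dist[OF cspace_metric[OF W]]) (use proj[OF W] rho_rel assms in auto)
  then show ?thesis using A by linarith
qed

lemma realize:
  assumes "\<V> \<subseteq> D" "\<forall>V\<in>\<V>. \<forall>W\<in>\<V>. V \<noteq> W \<longrightarrow> V \<bottom>\<^bsub>\<SS>\<^esub> W" "\<forall>V\<in>\<V>. p V \<in> X"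
  obtains x where "x \<in> X" "\<forall>V\<in>\<V>. dd V x (p V) \<le> 3 * A"
    "\<forall>V\<in>\<V>. \<forall>W. has_rho V W \<longrightarrow> dom_dist_set \<SS> W x (rho \<SS> V W) \<le> A"
proof -
  have "\<exists>x\<in>X. \<forall>V\<in>\<V>. dom_dist_set \<SS> V x {pt V (p V)} \<le> \<alpha> \<and>
      (\<forall>W\<in>D. V \<sqsubset>\<^bsub>\<SS>\<^esub> W \<or> W \<pitchfork>\<^bsub>\<SS>\<^esub> V \<longrightarrow> dom_dist_set \<SS> W x (rho \<SS> V W) \<le> \<alpha>)"
  proof (rule partial_realization[unfolded hh_partial_realization_def, THEN spec, of \<V>, THEN mp, OF assms(1),
        THEN spec, of "\<lambda>V. pt V (p V)", THEN mp, THEN mp])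
    show "\<forall>V\<in>\<V>. pt V (p V) \<in> (\<Union>x\<in>X. proj \<SS> V x)"
    proof
      fix V assume V: "V \<in> \<V>"
      show "pt V (p V) \<in> (\<Union>x\<in>X. proj \<SS> V x)"
        using bspec[OF assms(3) V] proj(4)[OF subsetD[OF assms(1) V] bspec[OF assms(3) V]] by (rule UN_I)
    qed
  qed (rule assms(2))
  then obtain x where x: "x \<in> X" and x': "\<forall>V\<in>\<V>. dom_dist_set \<SS> V x {pt V (p V)} \<le> \<alpha> \<and>
      (\<forall>W\<in>D. V \<sqsubset>\<^bsub>\<SS>\<^esub> W \<or> W \<pitchfork>\<^bsub>\<SS>\<^esub> V \<longrightarrow> dom_dist_set \<SS> W x (rho \<SS> V W) \<le> \<alpha>)" ..
  show thesis
  proof (rule that[OF x]; intro ballI allI impI)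
    fix V assume V: "V \<in> \<V>"
    then have VD: "V \<in> D" using assms by blast
    have "dd V x (p V) \<le> dom_dist_set \<SS> V x {pt V (p V)} + 2 * \<xi>"
      unfolding dom_dist_set_def dd_def
    proof (rule dist_le_set_dist[OF cspace_metric[OF VD]])
      interpret Metric_space "cspace \<SS> V" "cdist \<SS> V" by (rule cspace_metric[OF VD])
      show "diam_le (cdist \<SS> V) {pt V (p V)} \<xi>"
        using proj(5)[OF VD bspec[OF assms(3) V]] xi_nonneg by (simp add: diam_le_def)
    qed (use proj[OF VD x] proj(5)[OF VD bspec[OF assms(3) V]] in auto)
    moreover have "dom_dist_set \<SS> V x {pt V (p V)} \<le> \<alpha>" using x' V by simp
    ultimately show "dd V x (p V) \<le> 3 * A" using A by linarith
  next
    fix V W assume V: "V \<in> \<V>" "has_rho V W"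
    from V(2) have "V \<sqsubset>\<^bsub>\<SS>\<^esub> W \<or> W \<pitchfork>\<^bsub>\<SS>\<^esub> V" by (auto elim: has_rho_cases)
    moreover have W: "W \<in> D" using V(2) by (simp add: has_rho_def)
    ultimately have "dom_dist_set \<SS> W x (rho \<SS> V W) \<le> \<alpha>"
      using x'[THEN bspec, OF V(1), THEN conjunct2, THEN bspec, OF W, THEN mp] by simp
    then show "dom_dist_set \<SS> W x (rho \<SS> V W) \<le> A" using A by linarith
  qed
qed

definition r :: "'w \<Rightarrow> 'w \<Rightarrow> 'x" where
  "r V W = (SOME x. x \<in> X \<and> dom_dist_set \<SS> W x (rho \<SS> V W) \<le> A)"

lemma r:
  assumes "has_rho V W"
  shows "r V W \<in> X" "dom_dist_set \<SS> W (r V W) (rho \<SS> V W) \<le> A"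
    "b \<in> rho \<SS> V W \<Longrightarrow> cdist \<SS> W (pt W (r V W)) b \<le> 3 * A"
proof -
  have V: "V \<in> D" using assms by (simp add: has_rho_def)
  obtain x where "x \<in> X" "\<forall>V\<in>{V}. \<forall>W. has_rho V W \<longrightarrow> dom_dist_set \<SS> W x (rho \<SS> V W) \<le> A"
    by (rule realize[of "{V}" "\<lambda>_. p\<^sub>0"]) (use V basepoint in auto)
  then have "x \<in> X \<and> dom_dist_set \<SS> W x (rho \<SS> V W) \<le> A" using assms by simp
  then have "\<exists>x. x \<in> X \<and> dom_dist_set \<SS> W x (rho \<SS> V W) \<le> A" by (rule exI)
  from someI_ex[OF this] show 1: "r V W \<in> X" "dom_dist_set \<SS> W (r V W) (rho \<SS> V W) \<le> A"
    unfolding r_def by auto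
  show "b \<in> rho \<SS> V W \<Longrightarrow> cdist \<SS> W (pt W (r V W)) b \<le> 3 * A"
    using near_rho[OF assms 1(1), of b] 1(2) by linarith
qed

lemma dd_commute: "V \<in> D \<Longrightarrow> dd V x y = dd V y x"
  unfolding dd_def using Metric_space.commute[OF cspace_metric] by blast

text \<open>\<open>2 * A\<close> leads from the set distance to a point \<open>b\<close> of the set,
  and \<open>3 * A\<close> from \<open>b\<close> to the representative.\<close>

lemma dd_r_le:
  assumes VW: "has_rho V W" and x: "x \<in> X" "dom_dist_set \<SS> W x (rho \<SS> V W) \<le> c"
  shows "dd W x (r V W) \<le> c + 5 * A"
proof -
  have W: "W \<in> D" using VW by (simp add: has_rho_def)
  interpret Metric_space "cspace \<SS> W" "cdist \<SS> W" by (rule cspace_metric[OF W])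
  obtain b where b: "b \<in> rho \<SS> V W" using rho_rel[OF VW] by blast
  have "dd W x (r V W) \<le> cdist \<SS> W (pt W x) b + cdist \<SS> W b (pt W (r V W))"
    unfolding dd_def by (rule triangle) (use proj[OF W] x r[OF VW] rho_rel[OF VW] b in auto)
  then show ?thesis
    using near_rho[OF VW x(1) b] r(3)[OF VW b] x(2) commute[of b] by simp
qed

lemma r_consistent:
  assumes "has_rho V W" "has_rho W V" "x \<in> X"
  shows "dd W x (r V W) \<le> 6 * A \<or> dd V x (r W V) \<le> 6 * A"
proof -
  have "V \<pitchfork>\<^bsub>\<SS>\<^esub> W" using assms by (auto simp: has_rho_def transverse_def)
  from transverse_rho(2)[OF this assms(3)] show ?thesis
    using dd_r_le[OF assms(1,3), of A] dd_r_le[OF assms(2,3), of A] A by auto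
qed

lemma r_nested:
  assumes UV: "U \<sqsubseteq>\<^bsub>\<SS>\<^esub> V" and VW: "has_rho V W" and WU: "\<not> W \<bottom>\<^bsub>\<SS>\<^esub> U"
  shows "dd W (r U W) (r V W) \<le> 9 * A"
proof -
  have W: "W \<in> D" using VW by (simp add: has_rho_def)
  interpret Metric_space "cspace \<SS> W" "cdist \<SS> W" by (rule cspace_metric[OF W])
  have UW: "has_rho U W" using UV VW WU nest_dom nest_trans orth_sym unfolding has_rho_def by blast
  have "V \<sqsubset>\<^bsub>\<SS>\<^esub> W \<or> (V \<pitchfork>\<^bsub>\<SS>\<^esub> W \<and> \<not> W \<bottom>\<^bsub>\<SS>\<^esub> U)" using VW WU by (auto elim: has_rho_cases)
  then have le: "set_dist (cdist \<SS> W) (rho \<SS> U W) (rho \<SS> V W) \<le> \<kappa>\<^sub>0"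
    by (rule rho_consistent[OF UV])
  obtain a b where ab: "a \<in> rho \<SS> U W" "b \<in> rho \<SS> V W" using rho_rel[OF VW] rho_rel[OF UW] by blast
  then have abW: "a \<in> cspace \<SS> W" "b \<in> cspace \<SS> W" using rho_rel[OF VW] rho_rel[OF UW] by blast+
  have "cdist \<SS> W a b \<le> set_dist (cdist \<SS> W) (rho \<SS> U W) (rho \<SS> V W) + 2 * \<xi>"
    by (rule dist_le_set_dist[OF cspace_metric[OF W]]) (use rho_rel[OF VW] rho_rel[OF UW] ab in auto)
  moreover have "dd W (r U W) (r V W) \<le> cdist \<SS> W (pt W (r U W)) a + cdist \<SS> W a (pt W (r V W))"
    unfolding dd_def by (rule triangle) (use proj[OF W] r[OF VW] r[OF UW] abW in auto)
  moreover have "cdist \<SS> W a (pt W (r V W)) \<le> cdist \<SS> W a b + cdist \<SS> W b (pt W (r V W))"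
    by (rule triangle) (use proj[OF W] r[OF VW] abW in auto)
  ultimately show ?thesis
    using r(3)[OF UW ab(1)] r(3)[OF VW ab(2)] le A commute[of b "pt W (r V W)"] by linarith
qed

lemma dd_triangle:
  assumes "V \<in> D" "x \<in> X" "y \<in> X" "z \<in> X"
  shows "dd V x z \<le> dd V x y + dd V y z"
  unfolding dd_def by (rule Metric_space.triangle[OF cspace_metric]) (use assms proj in auto)

lemma dd_nonneg: "V \<in> D \<Longrightarrow> dd V x y \<ge> 0"
  unfolding dd_def using Metric_space.nonneg[OF cspace_metric] by blast

lemma dd_through:
  assumes V: "V \<in> D" and X: "x \<in> X" "y \<in> X" "z \<in> X" and p: "p \<in> cspace \<SS> V"
    and btw: "cdist \<SS> V (pt V x) p + cdist \<SS> V p (pt V y) \<le> dd V x y" and near: "cdist \<SS> V p (pt V z) \<le> c"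
  shows "dd V x z + dd V z y \<le> dd V x y + 2 * c"
proof -
  interpret Metric_space "cspace \<SS> V" "cdist \<SS> V" by (rule cspace_metric[OF V])
  have "dd V x z \<le> cdist \<SS> V (pt V x) p + cdist \<SS> V p (pt V z)"
    "dd V z y \<le> cdist \<SS> V (pt V z) p + cdist \<SS> V p (pt V y)"
    unfolding dd_def by (rule triangle; use proj[OF V] X p in auto)+
  then show ?thesis using btw near commute[of "pt V z" p] by linarith
qed

lemma cspace_geodesic:
  assumes "V \<in> D" "x \<in> X" "y \<in> X"
  obtains G where "geodesic (cspace \<SS> V) (cdist \<SS> V) (pt V x) (pt V y) G"
  using hyperbolic[OF assms(1)] proj(5)[OF assms(1,2)] proj(5)[OF assms(1,3)]
  unfolding hyperbolic_space_def geodesic_space_def by blast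

text \<open>If \<open>x\<close> or \<open>y\<close> is near the set \<rho> in \<open>W\<close>, the
  second alternative is the triangle inequality. Otherwise consistency puts their projections to
  \<open>V\<close> near the images under \<open>rho_map\<close> of the ends of a geodesic. Either
  the image of the geodesic is small and \<open>x\<close>, \<open>y\<close> are close in
  \<open>V\<close>, or the geodesic passes near \<rho>, whose representative is then nearly between
  them.\<close>

lemma r_bounded_image:
  assumes VW: "V \<sqsubset>\<^bsub>\<SS>\<^esub> W" and X: "x \<in> X" "y \<in> X"
  shows "dd V x y \<le> 3 * A \<or> dd W x (r V W) + dd W (r V W) y \<le> dd W x y + 12 * A"
proof -
  have D: "V \<in> D" "W \<in> D" using VW nest_dom by auto
  have has_rho: "has_rho V W" using VW D orth_not_nest nest_antisym unfolding has_rho_def by blast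
  note rX = r(1)[OF has_rho]
  have close: ?thesis if "z \<in> {x, y}" "dom_dist_set \<SS> W z (rho \<SS> V W) \<le> A" for z
  proof -
    have "dd W z (r V W) \<le> 6 * A" using dd_r_le[OF has_rho _ that(2)] that(1) X by auto
    then show ?thesis
      using that(1) dd_triangle[OF D(2) rX X(1) X(2)] dd_triangle[OF D(2) X(1) X(2) rX]
        dd_commute[OF D(2), of "r V W" x] dd_commute[OF D(2), of "r V W" y] by auto
  qed
  have far: "\<forall>u\<in>rho_map \<SS> W V (pt W z). cdist \<SS> V (pt V z) u \<le> A"
    if z: "z \<in> X" "\<not> dom_dist_set \<SS> W z (rho \<SS> V W) \<le> A" for z
  proof -
    have "diam_le (cdist \<SS> V) (proj \<SS> V z \<union> (\<Union>p\<in>proj \<SS> W z. rho_map \<SS> W V p)) \<kappa>\<^sub>0"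
      using nested_consistent[OF VW z(1)] z(2) A(5) by linarith
    then have "cdist \<SS> V (pt V z) u \<le> \<kappa>\<^sub>0" if "u \<in> rho_map \<SS> W V (pt W z)" for u
      using proj(4)[OF D(1) z(1)] proj(4)[OF D(2) z(1)] that unfolding diam_le_def by blast
    then show ?thesis using A(5) by (meson order_trans)
  qed
  show ?thesis
  proof (rule ccontr)
    assume not: "\<not> ?thesis"
    then have notclose: "\<not> dom_dist_set \<SS> W x (rho \<SS> V W) \<le> A" "\<not> dom_dist_set \<SS> W y (rho \<SS> V W) \<le> A"
      using close by blast+
    interpret V: Metric_space "cspace \<SS> V" "cdist \<SS> V" by (rule cspace_metric[OF D(1)])
    interpret W: Metric_space "cspace \<SS> W" "cdist \<SS> W" by (rule cspace_metric[OF D(2)])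
    have rm: "rho_map \<SS> W V (pt W z) \<subseteq> cspace \<SS> V \<and> rho_map \<SS> W V (pt W z) \<noteq> {}" if "z \<in> X" for z
      by (rule nested_rho(2)[OF VW proj(5)[OF D(2) that]])
    obtain u v where u: "u \<in> rho_map \<SS> W V (pt W x)" "u \<in> cspace \<SS> V"
      and v: "v \<in> rho_map \<SS> W V (pt W y)" "v \<in> cspace \<SS> V" using rm X by blast
    obtain G where G: "geodesic (cspace \<SS> W) (cdist \<SS> W) (pt W x) (pt W y) G"
      by (rule cspace_geodesic[OF D(2) X])
    note ends = geodesic_ends[OF G]
    have "diam_le (cdist \<SS> V) (\<Union>p\<in>G. rho_map \<SS> W V p) E\<^sub>B \<or>
         G \<inter> nbhd (cspace \<SS> W) (cdist \<SS> W) E\<^sub>B (rho \<SS> V W) \<noteq> {}"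
      using image[unfolded hh_bounded_geodesic_image_def, THEN spec, THEN spec, THEN mp, OF VW,
          THEN bspec, OF proj(5)[OF D(2) X(1)], THEN bspec, OF proj(5)[OF D(2) X(2)], THEN spec, THEN mp, OF G] .
    then show False
    proof
      assume "diam_le (cdist \<SS> V) (\<Union>p\<in>G. rho_map \<SS> W V p) E\<^sub>B"
      then have "cdist \<SS> V u v \<le> E\<^sub>B" using u v ends unfolding diam_le_def by blast
      moreover have "cdist \<SS> V (pt V x) u \<le> A" "cdist \<SS> V (pt V y) v \<le> A"
        using far notclose X u v by blast+
      moreover have "dd V x y \<le> cdist \<SS> V (pt V x) u + cdist \<SS> V u (pt V y)"
        "cdist \<SS> V u (pt V y) \<le> cdist \<SS> V u v + cdist \<SS> V v (pt V y)"
        unfolding dd_def by (rule V.triangle; use proj[OF D(1)] X u v in auto)+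
      ultimately show False using not A V.commute[of v "pt V y"] by linarith
    next
      assume "G \<inter> nbhd (cspace \<SS> W) (cdist \<SS> W) E\<^sub>B (rho \<SS> V W) \<noteq> {}"
      then obtain p where p: "p \<in> G" "p \<in> nbhd (cspace \<SS> W) (cdist \<SS> W) E\<^sub>B (rho \<SS> V W)" by blast
      then obtain b where b: "b \<in> rho \<SS> V W" "cdist \<SS> W p b < E\<^sub>B + 1"
        using nbhd_witness[OF cspace_metric[OF D(2)]] rho_rel(2)[OF has_rho] by blast
      note p' = geodesic_point_between[OF cspace_metric[OF D(2)] G p(1)]
      have "cdist \<SS> W p (pt W (r V W)) \<le> cdist \<SS> W p b + cdist \<SS> W b (pt W (r V W))"
        by (rule W.triangle) (use p' b rho_rel[OF has_rho] proj[OF D(2)] rX in auto)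
      then have "cdist \<SS> W p (pt W (r V W)) \<le> 6 * A"
        using b(2) r(3)[OF has_rho b(1)] A W.commute[of b "pt W (r V W)"] by linarith
      then have "dd W x (r V W) + dd W (r V W) y \<le> dd W x y + 2 * (6 * A)"
        by (intro dd_through[OF D(2) X rX p'(1)]) (use p'(2) in \<open>auto simp: dd_def\<close>)
      then show False using not by linarith
    qed
  qed
qed

text \<open>This is where quasiconvexity of the projection enters: points of geodesics can be
  replaced by points of \<open>X\<close>, the only ones a coordinate system knows.\<close>

lemma near_image:
  assumes V: "V \<in> D" and X: "x \<in> X" "y \<in> X"
    and G: "geodesic (cspace \<SS> V) (cdist \<SS> V) (pt V x) (pt V y) G" and p: "p \<in> G"
  obtains z where "z \<in> X" "cdist \<SS> V p (pt V z) \<le> 3 * A"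
proof -
  interpret Metric_space "cspace \<SS> V" "cdist \<SS> V" by (rule cspace_metric[OF V])
  let ?I = "\<Union>x\<in>X. proj \<SS> V x"
  have qc: "quasiconvex K (cspace \<SS> V) (cdist \<SS> V) ?I" using projections V unfolding hh_projections_def by blast
  have I: "pt V x \<in> ?I" "pt V y \<in> ?I" using proj(4)[OF V] X by blast+
  then have "p \<in> nbhd (cspace \<SS> V) (cdist \<SS> V) K ?I"
    using qc G p unfolding quasiconvex_def by blast
  then obtain a where a: "a \<in> ?I" "cdist \<SS> V p a < K + 1"
    using nbhd_witness[OF cspace_metric[OF V]] I by blast
  then obtain z where z: "z \<in> X" "a \<in> proj \<SS> V z" by blast
  have "cdist \<SS> V a (pt V z) \<le> \<xi>" using proj(3,4)[OF V z(1)] z(2) unfolding diam_le_def by blast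
  moreover have "cdist \<SS> V p (pt V z) \<le> cdist \<SS> V p a + cdist \<SS> V a (pt V z)"
    by (rule triangle) (use geodesic_point_between(1)[OF cspace_metric[OF V] G p] proj[OF V z(1)] z in auto)
  ultimately show thesis using that[OF z(1)] a(2) A by linarith
qed

text \<open>The tripod point on one side is close to the other two sides, so a point of
  \<open>X\<close> projecting near it is nearly between each pair. The distance \<open>7 * A\<close>
  consists of \<open>\<delta> + 3\<close>, at most \<open>4 * A\<close>, and of \<open>3 * A\<close>
  from \<open>near_image\<close>.\<close>

lemma ex_median:
  assumes V: "V \<in> D" and X: "x \<in> X" "y \<in> X" "z \<in> X"
  shows "\<exists>m\<in>X. dd V x m + dd V m y \<le> dd V x y + 14 * A * A \<and>
        dd V x m + dd V m z \<le> dd V x z + 14 * A * A \<and> dd V y m + dd V m z \<le> dd V y z + 14 * A * A"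
proof -
  interpret Metric_space "cspace \<SS> V" "cdist \<SS> V" by (rule cspace_metric[OF V])
  note ptV = proj(5)[OF V]
  obtain G where G: "geodesic (cspace \<SS> V) (cdist \<SS> V) (pt V x) (pt V y) G"
    by (rule cspace_geodesic[OF V X(1,2)])
  obtain m p q where m: "m \<in> G" and pq: "p \<in> cspace \<SS> V" "q \<in> cspace \<SS> V"
    "cdist \<SS> V m p \<le> \<delta> + 3" "cdist \<SS> V m q \<le> \<delta> + 3"
    "cdist \<SS> V (pt V x) p + cdist \<SS> V p (pt V z) = cdist \<SS> V (pt V x) (pt V z)"
    "cdist \<SS> V (pt V y) q + cdist \<SS> V q (pt V z) = cdist \<SS> V (pt V y) (pt V z)"
    by (rule hyperbolic_tripod[OF hyperbolic[OF V] ptV[OF X(1)] ptV[OF X(2)] ptV[OF X(3)] G]) (rule that)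
  obtain w where w: "w \<in> X" "cdist \<SS> V m (pt V w) \<le> 3 * A" by (rule near_image[OF V X(1,2) G m])
  note m' = geodesic_point_between[OF cspace_metric[OF V] G m]
  have near: "cdist \<SS> V c (pt V w) \<le> 7 * A" if "c \<in> cspace \<SS> V" "cdist \<SS> V m c \<le> \<delta> + 3" for c
    using triangle[OF that(1) m'(1) ptV[OF w(1)]] that(2) w(2) A commute[of c m] by linarith
  have "dd V x w + dd V w y \<le> dd V x y + 2 * (3 * A)"
    by (rule dd_through[OF V X(1,2) w(1) m'(1) _ w(2)]) (simp add: m' dd_def)
  moreover have "dd V x w + dd V w z \<le> dd V x z + 2 * (7 * A)"
    by (rule dd_through[OF V X(1,3) w(1) pq(1) _ near[OF pq(1,3)]]) (simp add: pq dd_def)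
  moreover have "dd V y w + dd V w z \<le> dd V y z + 2 * (7 * A)"
    by (rule dd_through[OF V X(2,3) w(1) pq(2) _ near[OF pq(2,4)]]) (simp add: pq dd_def)
  ultimately show ?thesis using w(1) A(1) AA by (intro bexI[of _ w] conjI) linarith+
qed

text \<open>The parametrisation by arc length is kept; every point of a geodesic is moved by at most
  \<open>3 * A\<close> to the projection of a point of \<open>X\<close>.\<close>

lemma ex_geodesic:
  assumes V: "V \<in> D" and X: "x \<in> X" "y \<in> X"
  shows "\<exists>h. (\<forall>t\<in>{0..dd V x y}. h t \<in> X) \<and>
        (\<forall>s\<in>{0..dd V x y}. \<forall>t\<in>{0..dd V x y}. \<bar>dd V (h s) (h t) - \<bar>s - t\<bar>\<bar> \<le> 14 * A * A) \<and>
        dd V x (h 0) \<le> 14 * A * A \<and> dd V (h (dd V x y)) y \<le> 14 * A * A"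
proof -
  interpret Metric_space "cspace \<SS> V" "cdist \<SS> V" by (rule cspace_metric[OF V])
  note ptV = proj(5)[OF V]
  obtain G where G: "geodesic (cspace \<SS> V) (cdist \<SS> V) (pt V x) (pt V y) G"
    by (rule cspace_geodesic[OF V X])
  then obtain L g where g: "L \<ge> 0" "g \<in> {0..L} \<rightarrow> cspace \<SS> V" "g 0 = pt V x" "g L = pt V y" "G = g ` {0..L}"
    "\<And>s t. \<lbrakk>s \<in> {0..L}; t \<in> {0..L}\<rbrakk> \<Longrightarrow> cdist \<SS> V (g s) (g t) = \<bar>s - t\<bar>"
    unfolding geodesic_def by blast
  have L: "L = dd V x y" using g(1,3,4) g(6)[of 0 L] by (simp add: dd_def)
  have "\<exists>z\<in>X. cdist \<SS> V (g t) (pt V z) \<le> 3 * A" if "t \<in> {0..L}" for t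
    using near_image[OF V X G, of "g t"] g(5) that by blast
  then obtain h where h: "\<And>t. t \<in> {0..L} \<Longrightarrow> h t \<in> X" "\<And>t. t \<in> {0..L} \<Longrightarrow> cdist \<SS> V (g t) (pt V (h t)) \<le> 3 * A"
    by metis
  have gV: "g t \<in> cspace \<SS> V" if "t \<in> {0..L}" for t using g(2) that by blast
  have hV: "pt V (h t) \<in> cspace \<SS> V" if "t \<in> {0..L}" for t using h(1) ptV that by blast
  have "\<bar>dd V (h s) (h t) - \<bar>s - t\<bar>\<bar> \<le> 14 * A * A" if s: "s \<in> {0..L}" and t: "t \<in> {0..L}" for s t
  proof -
    have "cdist \<SS> V (g s) (g t) \<le> cdist \<SS> V (g s) (pt V (h s)) + dd V (h s) (h t) + cdist \<SS> V (g t) (pt V (h t))"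
      using triangle[OF gV[OF s] hV[OF s] gV[OF t]] triangle[OF hV[OF s] hV[OF t] gV[OF t]]
        commute[of "g t"] unfolding dd_def by simp
    moreover have "dd V (h s) (h t) \<le> cdist \<SS> V (g s) (pt V (h s)) + cdist \<SS> V (g s) (g t) + cdist \<SS> V (g t) (pt V (h t))"
      using triangle[OF hV[OF s] gV[OF s] hV[OF t]] triangle[OF gV[OF s] gV[OF t] hV[OF t]]
        commute[of "g s"] unfolding dd_def by simp
    ultimately show ?thesis using h(2)[OF s] h(2)[OF t] g(6)[OF s t] AA A(1) unfolding abs_le_iff by linarith
  qed
  moreover have "cdist \<SS> V (pt V x) (pt V (h 0)) \<le> 3 * A" "cdist \<SS> V (pt V y) (pt V (h L)) \<le> 3 * A"
    using h(2)[of 0] h(2)[of L] g(1,3,4) by simp_all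
  then have "dd V x (h 0) \<le> 14 * A * A" "dd V (h L) y \<le> 14 * A * A"
    using commute[of "pt V y" "pt V (h L)"] A(1) AA unfolding dd_def by linarith+
  ultimately show ?thesis using h(1) L by blast
qed

text \<open>Unit times along a quasigeodesic: the Lipschitz bound on projections controls the steps,
  the lower quasigeodesic bound their number. Both estimates multiply two constants of the axioms,
  hence \<open>A * A\<close>.\<close>

lemma ex_chain:
  assumes X: "x \<in> X" "y \<in> X"
  shows "\<exists>c N. c 0 = x \<and> c N = y \<and> (\<forall>i\<le>N. c i \<in> X) \<and>
        (\<forall>i<N. \<forall>V\<in>D. dd V (c i) (c (Suc i)) \<le> 14 * A * A) \<and> real N \<le> 14 * A * A * d x y + 14 * A * A"
proof -
  obtain L g where L: "L \<ge> 0" and q: "q \<ge> 1" and g: "g \<in> {0..L} \<rightarrow> X" "g 0 = x" "g L = y"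
    "\<And>s t. \<lbrakk>s \<in> {0..L}; t \<in> {0..L}\<rbrakk> \<Longrightarrow> \<bar>s - t\<bar> / q - q \<le> d (g s) (g t) \<and> d (g s) (g t) \<le> q * \<bar>s - t\<bar> + q"
    using quasigeodesic X unfolding quasigeodesic_space_def by meson
  define N where "N = nat \<lceil>L\<rceil>"
  \<comment> \<open>The minimum makes the last sample, at \<open>N \<ge> L\<close>, the end point
    \<open>g L\<close>.\<close>
  define c where "c i = g (min (real i) L)" for i
  have mem: "min (real i) L \<in> {0..L}" for i using L by simp
  have N: "L \<le> N" "N \<le> L + 1" using L unfolding N_def by linarith+
  have cX: "c i \<in> X" for i using g(1) mem unfolding c_def by blast
  have "dd V (c i) (c (Suc i)) \<le> 14 * A * A" if V: "V \<in> D" for V i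
  proof -
    have "\<bar>min (real i) L - min (real (Suc i)) L\<bar> \<le> 1" by (simp add: min_def)
    then have "q * \<bar>min (real i) L - min (real (Suc i)) L\<bar> \<le> q * 1" using q by (intro mult_left_mono) auto
    then have "d (c i) (c (Suc i)) \<le> 2 * A"
      using g(4)[OF mem[of i] mem[of "Suc i"]] A unfolding c_def by linarith
    then have "K * d (c i) (c (Suc i)) \<le> A * (2 * A)"
      using A K_nonneg Metric_space.nonneg[OF X_metric] by (intro mult_mono) auto
    moreover have "dom_dist \<SS> V (c i) (c (Suc i)) \<le> K * d (c i) (c (Suc i)) + K"
      using projections V cX unfolding hh_projections_def by blast
    ultimately show ?thesis
      using AA A(1) dom_dist_le(2)[OF V cX[of i] cX[of "Suc i"]] A by linarith
  qed
  moreover have "real N \<le> 14 * A * A * d x y + 14 * A * A"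
  proof -
    have "L / q - q \<le> d x y" using g(4)[of 0 L] g(2,3) L by simp
    then have "L \<le> q * d x y + q * q" using q by (simp add: field_simps)
    moreover have "q * d x y \<le> A * d x y" "q * q \<le> A * A"
      using A q Metric_space.nonneg[OF X_metric] by (auto intro!: mult_mono)
    moreover have "A * d x y \<le> 14 * A * A * d x y"
      using AA A(1) Metric_space.nonneg[OF X_metric] by (intro mult_right_mono) auto
    ultimately show ?thesis using N AA A(1) by linarith
  qed
  moreover have "c 0 = x" "c N = y" using g L N by (auto simp: c_def)
  ultimately show ?thesis using cX by blast
qed

text \<open>Since \<open>dom_dist\<close> is at most \<open>dd\<close>, the bound \<open>a\<close>
  limits the number of links uniformly; in the other direction \<open>14 * A * A\<close> leaves room
  for the loss of \<open>2 * A\<close>.\<close>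

lemma large_links:
  "\<exists>N::nat. \<forall>W\<in>D. \<forall>x\<in>X. \<forall>y\<in>X. dd W x y \<le> a \<longrightarrow>
        (\<exists>\<T>. finite \<T> \<and> card \<T> \<le> N \<and> (\<forall>T\<in>\<T>. T \<sqsubset>\<^bsub>\<SS>\<^esub> W) \<and>
           (\<forall>V\<in>D. V \<sqsubseteq>\<^bsub>\<SS>\<^esub> W \<and> V \<noteq> W \<and> dd V x y \<ge> 14 * A * A \<longrightarrow> (\<exists>T\<in>\<T>. V \<sqsubseteq>\<^bsub>\<SS>\<^esub> T)))"
proof (intro exI[of _ "nat \<lfloor>\<Lambda> * a + \<Lambda>\<rfloor>"] ballI impI)
  fix W x y assume W: "W \<in> D" and X: "x \<in> X" "y \<in> X" and a: "dd W x y \<le> a"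
  obtain \<T> where T: "\<T> \<subseteq> domains_below \<SS> W - {W}" "finite \<T>"
    "int (card \<T>) \<le> \<lfloor>\<Lambda> * dom_dist \<SS> W x y + \<Lambda>\<rfloor>"
    "\<forall>T\<in>domains_below \<SS> W - {W}. (\<exists>T'\<in>\<T>. T \<in> domains_below \<SS> T') \<or> dom_dist \<SS> T x y < E\<^sub>L"
    using links[unfolded hh_large_links_def Let_def, THEN bspec, OF W, THEN bspec, OF X(1), THEN bspec, OF X(2)]
    by (elim exE conjE)
  have "\<Lambda> * dom_dist \<SS> W x y \<le> \<Lambda> * a"
    using dom_dist_le(1)[OF W X] a Lambda_ge by (intro mult_left_mono) auto
  then have "\<lfloor>\<Lambda> * dom_dist \<SS> W x y + \<Lambda>\<rfloor> \<le> \<lfloor>\<Lambda> * a + \<Lambda>\<rfloor>" by (intro floor_mono) simp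
  then have "int (card \<T>) \<le> \<lfloor>\<Lambda> * a + \<Lambda>\<rfloor>" using T(3) by (rule order_trans[rotated])
  then have "card \<T> \<le> nat \<lfloor>\<Lambda> * a + \<Lambda>\<rfloor>" by simp
  moreover have "\<exists>T\<in>\<T>. V \<sqsubseteq>\<^bsub>\<SS>\<^esub> T" if V: "V \<in> D" "V \<sqsubset>\<^bsub>\<SS>\<^esub> W" "dd V x y \<ge> 14 * A * A" for V
  proof -
    have "\<not> dom_dist \<SS> V x y < E\<^sub>L" using dom_dist_le(2)[OF V(1) X] V(3) A AA by linarith
    moreover have "V \<in> domains_below \<SS> W - {W}" using V by (auto simp: domains_below_def)
    ultimately show ?thesis using T(4) unfolding domains_below_def by blast
  qed
  moreover have "T \<sqsubset>\<^bsub>\<SS>\<^esub> W" if "T \<in> \<T>" for T using T(1) that by (auto simp: domains_below_def)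
  ultimately show "\<exists>\<T>. finite \<T> \<and> card \<T> \<le> nat \<lfloor>\<Lambda> * a + \<Lambda>\<rfloor> \<and> (\<forall>T\<in>\<T>. T \<sqsubset>\<^bsub>\<SS>\<^esub> W) \<and>
           (\<forall>V\<in>D. V \<sqsubseteq>\<^bsub>\<SS>\<^esub> W \<and> V \<noteq> W \<and> dd V x y \<ge> 14 * A * A \<longrightarrow> (\<exists>T\<in>\<T>. V \<sqsubseteq>\<^bsub>\<SS>\<^esub> T))"
    using T(2) by blast
qed

lemma uniqueness:
  "\<exists>\<theta>'\<ge>0. \<forall>x\<in>X. \<forall>y\<in>X. (\<forall>V\<in>D. dd V x y < \<kappa>) \<longrightarrow> d x y \<le> \<theta>'"
proof (intro exI[of _ "\<bar>\<theta> \<bar>\<kappa>\<bar>\<bar>"] conjI ballI impI)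
  fix x y assume X: "x \<in> X" "y \<in> X" and small: "\<forall>V\<in>D. dd V x y < \<kappa>"
  have "\<not> \<bar>\<kappa>\<bar> \<le> dom_dist \<SS> V x y" if "V \<in> D" for V
    using small dom_dist_le(1)[OF that X] that by fastforce
  then have "\<not> \<theta> \<bar>\<kappa>\<bar> \<le> d x y" using unique X unfolding hh_uniqueness_def by (meson abs_ge_zero)
  then show "d x y \<le> \<bar>\<theta> \<bar>\<kappa>\<bar>\<bar>" by linarith
qed simp

text \<open>\<open>14 * A\<close> is the largest multiple of \<open>A\<close> met above, from
  \<open>ex_median\<close>; the second factor \<open>A\<close> is due to
  \<open>ex_chain\<close>.\<close>

sublocale coords: coordinate_system X d D dd "\<lambda>V W. V \<sqsubseteq>\<^bsub>\<SS>\<^esub> W" "\<lambda>V W. V \<bottom>\<^bsub>\<SS>\<^esub> W" r lev n "14 * A * A"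
proof
  show "14 * A * A \<ge> 1" using AA A(1) by linarith
  show "d x z \<le> d x y + d y z" if "x \<in> X" "y \<in> X" "z \<in> X" for x y z
    using Metric_space.triangle[OF X_metric that] .
  show "dd V x x = 0" if "V \<in> D" "x \<in> X" for V x
    unfolding dd_def using Metric_space.zero[OF cspace_metric[OF that(1)]] proj(5)[OF that] by blast
  show "dd W x (r V W) \<le> 14 * A * A \<or> dd V x (r W V) \<le> 14 * A * A"
    if "V \<in> D" "W \<in> D" "\<not> V \<bottom>\<^bsub>\<SS>\<^esub> W" "\<not> V \<sqsubseteq>\<^bsub>\<SS>\<^esub> W" "\<not> W \<sqsubseteq>\<^bsub>\<SS>\<^esub> V" "x \<in> X" for V W x
  proof -
    have "has_rho V W" "has_rho W V" using that orth_sym by (auto simp: has_rho_def)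
    from r_consistent[OF this that(6)] show ?thesis using AA A(1) by linarith
  qed
  show "dd W (r U W) (r V W) \<le> 14 * A * A"
    if "U \<sqsubseteq>\<^bsub>\<SS>\<^esub> V" "W \<in> D" "\<not> V \<bottom>\<^bsub>\<SS>\<^esub> W" "\<not> W \<sqsubseteq>\<^bsub>\<SS>\<^esub> V" "\<not> W \<bottom>\<^bsub>\<SS>\<^esub> U" for U V W
  proof -
    have "has_rho V W" using that nest_dom by (auto simp: has_rho_def)
    from r_nested[OF that(1) this that(5)] show ?thesis using AA A(1) by linarith
  qed
  show "dd V x y \<le> 14 * A * A \<or> dd W x (r V W) + dd W (r V W) y \<le> dd W x y + 14 * A * A"
    if "V \<sqsubseteq>\<^bsub>\<SS>\<^esub> W" "V \<noteq> W" "x \<in> X" "y \<in> X" for V W x y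
    using r_bounded_image[OF _ that(3,4), of V W] that(1,2) AA A(1) by linarith
  show "\<exists>x\<in>X. \<forall>V\<in>\<V>. dd V x (p V) \<le> 14 * A * A \<and>
      (\<forall>W\<in>D. \<not> V \<bottom>\<^bsub>\<SS>\<^esub> W \<and> \<not> W \<sqsubseteq>\<^bsub>\<SS>\<^esub> V \<longrightarrow> dd W x (r V W) \<le> 14 * A * A)"
    if V: "\<V> \<subseteq> D" "\<And>V W. \<lbrakk>V \<in> \<V>; W \<in> \<V>; V \<noteq> W\<rbrakk> \<Longrightarrow> V \<bottom>\<^bsub>\<SS>\<^esub> W" "\<And>V. V \<in> \<V> \<Longrightarrow> p V \<in> X" for \<V> p
  proof -
    obtain x where x: "x \<in> X" "\<forall>V\<in>\<V>. dd V x (p V) \<le> 3 * A"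
      "\<forall>V\<in>\<V>. \<forall>W. has_rho V W \<longrightarrow> dom_dist_set \<SS> W x (rho \<SS> V W) \<le> A"
      by (rule realize[of \<V> p]) (use V in blast)+
    have 1: "dd V x (p V) \<le> 14 * A * A" if "V \<in> \<V>" for V
      using bspec[OF x(2) that] AA A(1) by linarith
    have 2: "dd W x (r V W) \<le> 14 * A * A" if "V \<in> \<V>" "has_rho V W" for V W
      using dd_r_le[OF that(2) x(1) x(3)[THEN bspec, OF that(1), THEN spec, THEN mp, OF that(2)]] AA A(1)
      by linarith
    have 3: "has_rho V W" if "V \<in> \<V>" "W \<in> D" "\<not> V \<bottom>\<^bsub>\<SS>\<^esub> W" "\<not> W \<sqsubseteq>\<^bsub>\<SS>\<^esub> V" for V W
      using that V(1) by (auto simp: has_rho_def)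
    show ?thesis
    proof (rule bexI[OF _ x(1)], intro ballI conjI impI; (elim conjE)?)
      fix V W assume "V \<in> \<V>" "W \<in> D" "\<not> V \<bottom>\<^bsub>\<SS>\<^esub> W" "\<not> W \<sqsubseteq>\<^bsub>\<SS>\<^esub> V"
      then show "dd W x (r V W) \<le> 14 * A * A" using 2[of V W] 3[of V W] by simp
    qed (rule 1)
  qed
  show "\<exists>N::nat. \<forall>W\<in>D. \<forall>x\<in>X. \<forall>y\<in>X. dd W x y \<le> a \<longrightarrow>
        (\<exists>\<T>. finite \<T> \<and> card \<T> \<le> N \<and> (\<forall>T\<in>\<T>. T \<sqsubset>\<^bsub>\<SS>\<^esub> W) \<and>
           (\<forall>V\<in>D. V \<sqsubseteq>\<^bsub>\<SS>\<^esub> W \<and> V \<noteq> W \<and> 14 * A * A \<le> dd V x y \<longrightarrow> (\<exists>T\<in>\<T>. V \<sqsubseteq>\<^bsub>\<SS>\<^esub> T)))" for a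
    by (rule large_links)
  show "V \<in> D \<Longrightarrow> 0 \<le> dd V x y" for V x y by (rule dd_nonneg)
  show "V \<in> D \<Longrightarrow> dd V x y = dd V y x" for V x y by (rule dd_commute)
  show "\<lbrakk>V \<in> D; x \<in> X; y \<in> X; z \<in> X\<rbrakk> \<Longrightarrow> dd V x z \<le> dd V x y + dd V y z" for V x y z
    by (rule dd_triangle)
  show "V \<sqsubseteq>\<^bsub>\<SS>\<^esub> W \<Longrightarrow> V \<in> D \<and> W \<in> D" for V W by (rule nest_dom)
  show "V \<in> D \<Longrightarrow> V \<sqsubseteq>\<^bsub>\<SS>\<^esub> V" for V by (rule nest_refl)
  show "\<lbrakk>U \<sqsubseteq>\<^bsub>\<SS>\<^esub> V; V \<sqsubseteq>\<^bsub>\<SS>\<^esub> W\<rbrakk> \<Longrightarrow> U \<sqsubseteq>\<^bsub>\<SS>\<^esub> W" for U V W by (rule nest_trans)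
  show "\<lbrakk>V \<sqsubseteq>\<^bsub>\<SS>\<^esub> W; W \<sqsubseteq>\<^bsub>\<SS>\<^esub> V\<rbrakk> \<Longrightarrow> V = W" for V W by (rule nest_antisym)
  show "V \<bottom>\<^bsub>\<SS>\<^esub> W \<Longrightarrow> V \<in> D \<and> W \<in> D" for V W by (rule orth_dom)
  show "V \<bottom>\<^bsub>\<SS>\<^esub> W \<Longrightarrow> W \<bottom>\<^bsub>\<SS>\<^esub> V" for V W by (rule orth_sym)
  show "\<lbrakk>V \<sqsubseteq>\<^bsub>\<SS>\<^esub> W; W \<bottom>\<^bsub>\<SS>\<^esub> U\<rbrakk> \<Longrightarrow> V \<bottom>\<^bsub>\<SS>\<^esub> U" for U V W by (rule orth_nest)
  show "V \<bottom>\<^bsub>\<SS>\<^esub> W \<Longrightarrow> \<not> V \<sqsubseteq>\<^bsub>\<SS>\<^esub> W" for V W by (rule orth_not_nest)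
  show "\<lbrakk>V \<sqsubseteq>\<^bsub>\<SS>\<^esub> W; V \<noteq> W\<rbrakk> \<Longrightarrow> lev V < lev W" for V W by (rule lev_less) (rule conjI)
  show "lev V \<le> n" for V by (rule lev_le)
  show "card \<V> \<le> n" if "finite \<V>" "\<V> \<subseteq> D" "\<And>V W. \<lbrakk>V \<in> \<V>; W \<in> \<V>; V \<noteq> W\<rbrakk> \<Longrightarrow> V \<bottom>\<^bsub>\<SS>\<^esub> W" for \<V>
    using that by (rule orth_card)
  show "r V W \<in> X" if "V \<in> D" "W \<in> D" "\<not> V \<bottom>\<^bsub>\<SS>\<^esub> W" "\<not> W \<sqsubseteq>\<^bsub>\<SS>\<^esub> V" for V W
    using that by (intro r(1)) (simp add: has_rho_def)
qed (rule ex_top uniqueness ex_median ex_geodesic ex_chain; assumption)+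

section \<open>The distance formula for \<open>dom_dist\<close>\<close>

lemma infsum_threshold:
  fixes f :: "'w \<Rightarrow> real"
  assumes "finite {W \<in> D. s \<le> f W}"
  shows "(\<lambda>W. threshold s (f W)) summable_on D"
    and "(\<Sum>\<^sub>\<infinity>W\<in>D. threshold s (f W)) = (\<Sum>W | W \<in> D \<and> s \<le> f W. f W)"
proof -
  let ?F = "{W \<in> D. s \<le> f W}"
  have "(\<lambda>W. threshold s (f W)) summable_on D \<longleftrightarrow> f summable_on ?F"
    by (rule summable_on_cong_neutral) (auto simp: threshold_def)
  then show "(\<lambda>W. threshold s (f W)) summable_on D"
    using summable_on_finite[OF assms] by blast
  have "(\<Sum>\<^sub>\<infinity>W\<in>D. threshold s (f W)) = infsum f ?F"
    by (rule infsum_cong_neutral) (auto simp: threshold_def)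
  then show "(\<Sum>\<^sub>\<infinity>W\<in>D. threshold s (f W)) = (\<Sum>W | W \<in> D \<and> s \<le> f W. f W)"
    using infsum_finite[OF assms, of f] by simp
qed

text \<open>Passing between \<open>dom_dist\<close> and \<open>dd\<close> shifts thresholds:
  \<open>dom_dist\<close> at least \<open>s\<close> implies \<open>dd\<close> at least
  \<open>s\<close>, and \<open>dd\<close> at least \<open>s + 2 * A\<close> implies
  \<open>dom_dist\<close> at least \<open>s\<close>. So the sum is compared with the total at
  \<open>s\<close> for the upper bound and with the total at \<open>s + 2 * A\<close> for the lower
  one. On the domains that count, \<open>dom_dist\<close> is at least 1, which turns the error
  \<open>2 * A\<close> into a factor \<open>1 + 2 * A\<close>.\<close>

lemma distance_formula:
  assumes s: "s \<ge> 16 * (14 * A * A)"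
  shows "\<exists>K\<ge>1. \<exists>C\<ge>0. \<forall>x\<in>X. \<forall>y\<in>X.
           (\<lambda>W. threshold s (dom_dist \<SS> W x y)) summable_on D \<and>
           coarse_eq K C (d x y) (\<Sum>\<^sub>\<infinity>W\<in>D. threshold s (dom_dist \<SS> W x y))"
proof -
  have s1: "s \<ge> 1" using s AA A(1) by linarith
  have s': "s + 2 * A \<ge> 16 * (14 * A * A)" using s A(1) by linarith
  obtain K\<^sub>2 C\<^sub>2 where KC: "K\<^sub>2 \<ge> 0" "C\<^sub>2 \<ge> 0"
    "\<And>x y. \<lbrakk>x \<in> X; y \<in> X\<rbrakk> \<Longrightarrow> d x y \<le> K\<^sub>2 * coords.total (s + 2 * A) x y + C\<^sub>2"
    by (rule coords.dist_le_total[OF s']) (rule that)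
  define K\<^sub>1 where "K\<^sub>1 = 2 * (14 * A * A) * (n * Suc n) * (14 * A * A)"
  have K1: "K\<^sub>1 \<ge> 0" using A(1) by (simp add: K\<^sub>1_def)
  define L where "L = 1 + K\<^sub>1 + K\<^sub>2 * (1 + 2 * A)"
  have "K\<^sub>2 * (1 + 2 * A) \<ge> 0" using KC A(1) by simp
  then have L: "L \<ge> 1" "L \<ge> K\<^sub>1" "L \<ge> K\<^sub>2 * (1 + 2 * A)" using K1 by (simp_all add: L_def)
  have "(\<lambda>W. threshold s (dom_dist \<SS> W x y)) summable_on D \<and>
      coarse_eq L (K\<^sub>1 + C\<^sub>2) (d x y) (\<Sum>\<^sub>\<infinity>W\<in>D. threshold s (dom_dist \<SS> W x y))"
    if X: "x \<in> X" "y \<in> X" for x y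
  proof -
    define F where "F = {W \<in> D. s \<le> dom_dist \<SS> W x y}"
    define S where "S = (\<Sum>W\<in>F. dom_dist \<SS> W x y)"
    have FR: "F \<subseteq> coords.relevant s x y"
      using dom_dist_le(1)[OF _ X] by (force simp: F_def coords.relevant_def)
    have finR: "finite (coords.relevant s x y)" by (rule coords.finite_relevant[OF X s])
    have fin: "finite F" by (rule finite_subset[OF FR finR])
    have d0: "d x y \<ge> 0" by (rule Metric_space.nonneg[OF X_metric])
    have F: "dom_dist \<SS> W x y \<ge> 1" "W \<in> D" if "W \<in> F" for W using that s1 by (auto simp: F_def)
    have S0: "S \<ge> 0" unfolding S_def by (rule sum_nonneg) (use F in force)
    have "S \<le> (\<Sum>W\<in>F. dd W x y)"
      unfolding S_def by (rule sum_mono) (use dom_dist_le(1)[OF _ X] F in auto)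
    also have "\<dots> \<le> coords.total s x y"
      unfolding coords.total_def by (rule sum_mono2[OF finR FR]) (auto simp: coords.relevant_def dd_nonneg)
    also have "\<dots> \<le> K\<^sub>1 * d x y + K\<^sub>1"
      using coords.total_le_dist[OF s X] by (simp add: K\<^sub>1_def algebra_simps)
    also have "\<dots> \<le> L * d x y + (K\<^sub>1 + C\<^sub>2)"
      using mult_right_mono[OF L(2) d0] KC(2) by linarith
    finally have upper: "S \<le> L * d x y + (K\<^sub>1 + C\<^sub>2)" .
    have RF: "coords.relevant (s + 2 * A) x y \<subseteq> F"
    proof
      fix W assume "W \<in> coords.relevant (s + 2 * A) x y"
      then show "W \<in> F" using dom_dist_le(2)[of W, OF _ X] by (auto simp: F_def coords.relevant_def)
    qed
    have "coords.total (s + 2 * A) x y \<le> (\<Sum>W\<in>F. dd W x y)"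
      unfolding coords.total_def by (rule sum_mono2[OF fin RF]) (use F dd_nonneg in auto)
    also have "\<dots> \<le> (\<Sum>W\<in>F. (1 + 2 * A) * dom_dist \<SS> W x y)"
    proof (rule sum_mono)
      fix W assume W: "W \<in> F"
      have "2 * A * 1 \<le> 2 * A * dom_dist \<SS> W x y" using F(1)[OF W] A(1) by (intro mult_left_mono) auto
      then show "dd W x y \<le> (1 + 2 * A) * dom_dist \<SS> W x y"
        using dom_dist_le(2)[OF F(2)[OF W] X] by (simp add: algebra_simps)
    qed
    also have "\<dots> = (1 + 2 * A) * S" by (simp add: S_def sum_distrib_left)
    finally have "K\<^sub>2 * coords.total (s + 2 * A) x y \<le> K\<^sub>2 * ((1 + 2 * A) * S)"
      using KC(1) by (rule mult_left_mono)
    then have "d x y \<le> L * S + C\<^sub>2"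
      using KC(3)[OF X] mult_right_mono[OF L(3) S0] by (simp add: mult.assoc)
    \<comment> \<open>As \<open>L\<close> is at least 1, the additive constant can be put inside the
      bracket, ready for the division by \<open>L\<close>.\<close>
    also have "\<dots> \<le> L * (S + (K\<^sub>1 + C\<^sub>2))"
      using mult_right_mono[OF L(1), of "K\<^sub>1 + C\<^sub>2"] K1 KC(2) by (simp add: algebra_simps)
    finally have "inverse L * d x y \<le> S + (K\<^sub>1 + C\<^sub>2)"
      using L(1) by (simp add: field_simps)
    then have "coarse_eq L (K\<^sub>1 + C\<^sub>2) (d x y) S" using upper by (simp add: coarse_eq_def)
    then show ?thesis
      using infsum_threshold[of s "\<lambda>W. dom_dist \<SS> W x y"] fin by (simp add: F_def S_def)
  qed
  then show ?thesis using L(1) K1 KC(2) by (intro exI[of _ L] exI[of _ "K\<^sub>1 + C\<^sub>2"] conjI) auto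
qed

end

theorem theorem4p5:
  fixes X :: "'x set" and d :: "'x \<Rightarrow> 'x \<Rightarrow> real" and \<SS> :: "('x, 'w, 'c) hh_structure"
  assumes "hierarchically_hyperbolic_space X d \<SS>"
  shows "\<exists>s\<^sub>0::real. \<forall>s\<ge>s\<^sub>0. \<exists>K\<ge>1. \<exists>C\<ge>0. \<forall>x\<in>X. \<forall>y\<in>X.
           (\<lambda>W. threshold s (dom_dist \<SS> W x y)) summable_on domains \<SS> \<and>
           coarse_eq K C (d x y) (\<Sum>\<^sub>\<infinity>W\<in>domains \<SS>. threshold s (dom_dist \<SS> W x y))"
proof (cases "X = {}")
  case True
  \<comment> \<open>Without points there is no base point, and nothing to show.\<close>
  then show ?thesis by (intro exI[of _ 0] allI impI exI[of _ 1]) auto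
next
  case False
  then obtain p\<^sub>0 where p0: "p\<^sub>0 \<in> X" by blast
  from assms[unfolded hierarchically_hyperbolic_space_def]
  obtain q \<delta> \<xi> \<kappa>\<^sub>0 K n \<Lambda> E\<^sub>L E\<^sub>B \<alpha> \<theta> where hhs: "quasigeodesic_space q X d"
    "\<forall>W\<in>domains \<SS>. hyperbolic_space \<delta> (cspace \<SS> W) (cdist \<SS> W)"
    "\<xi> \<ge> 0" "K \<ge> 0" "hh_projections \<xi> K X d \<SS>" "hh_nesting \<xi> \<SS>" "hh_orthogonality \<SS>"
    "hh_consistency \<xi> \<kappa>\<^sub>0 X \<SS>" "hh_finite_complexity n \<SS>" "\<Lambda> \<ge> 1" "hh_large_links \<Lambda> E\<^sub>L X \<SS>"
    "hh_bounded_geodesic_image E\<^sub>B \<SS>" "hh_partial_realization \<alpha> X \<SS>" "hh_uniqueness \<theta> X d \<SS>"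
    by (elim conjE exE)
  define A where "A = 1 + \<bar>q\<bar> + \<bar>\<delta>\<bar> + \<bar>\<xi>\<bar> + \<bar>\<kappa>\<^sub>0\<bar> + \<bar>K\<bar> + \<bar>E\<^sub>L\<bar> + \<bar>E\<^sub>B\<bar> + \<bar>\<alpha>\<bar>"
  interpret hh_space X d \<SS> q \<delta> \<xi> \<kappa>\<^sub>0 K n \<Lambda> E\<^sub>L E\<^sub>B \<alpha> \<theta> A p\<^sub>0
    by unfold_locales (use hhs p0 in \<open>simp_all add: A_def\<close>)
  show ?thesis using distance_formula by blast
qed

end
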